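(* Let $p$ be a prime with $p\equiv 3$ or $7\pmod{10}$, and let $n>0$ with $(n,10)=1$. When $T_{p}(D_{n})$ is written as a sum of distinct $D_{k}$, each $k$ satisfies $k<n$.
   Context: All power series are in $\mathbb{Z}/2[[x]]$. Let $F=\sum_{n\ \mathrm{odd},\,n>0}x^{n^{2}}$, $G=F(x^{5})$, $D=\sum_{n>0,\ (n,10)=1}x^{n^{2}}$. For $k>0$, $(k,10)=1$, define $D_{1}=D$, $D_{3}=D^{8}/G$, $D_{7}=D^{2}G$, $D_{9}=D^{4}G$, $D_{k+10}=G^{2}D_{k}$. These are linearly independent, and for primes $p\ne 2,5$, $T_{p}(D_{n})$ lies in their span, where $T_{p}(\sum c_{n}x^{n})=\sum c_{pn}x^{n}+\sum c_{n}x^{pn}$. *)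

theory Defs
  imports "HOL-Library.Z2" "HOL-Computational_Algebra.Formal_Power_Series"
    "HOL-Computational_Algebra.Primes"
begin

definition F :: "bit fps" where
  "F = Abs_fps (\<lambda>m. of_bool (\<exists>n::nat. odd n \<and> n > 0 \<and> m = n^2))"

definition G :: "bit fps" where
  "G = Abs_fps (\<lambda>m. if 5 dvd m then fps_nth F (m div 5) else 0)"

definition D :: "bit fps" where
  "D = Abs_fps (\<lambda>m. of_bool (\<exists>n::nat. n > 0 \<and> coprime n 10 \<and> m = n^2))"

text \<open>D_k for k > 0 with gcd(k,10) = 1; D_1 = D, D_3 = D^8/G, D_7 = D^2 G,
  D_9 = D^4 G, D_(k+10) = G^2 D_k.  (Value 0 for other k is irrelevant.)\<close>
fun Dk :: "nat \<Rightarrow> bit fps" where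
  "Dk k = (if k < 10 then
             (if k = 1 then D
              else if k = 3 then D^8 / G
              else if k = 7 then D^2 * G
              else if k = 9 then D^4 * G
              else 0)
           else G^2 * Dk (k - 10))"

definition Tp :: "nat \<Rightarrow> bit fps \<Rightarrow> bit fps" where
  "Tp p f = Abs_fps (\<lambda>m. fps_nth f (p * m) + (if p dvd m then fps_nth f (m div p) else 0))"

end

theory Submission
imports
  "HOL-Algebra.Algebraic_Closure_Type"
  "HOL-Number_Theory.Residues"
  Defs
begin

text \<open>
  The idea is to bound pole orders at the supersingular point. With \<open>E = D^3 / G\<close> the relation
  \<open>D^15 = G^4 D^3 + G^3\<close> reads \<open>E (E + 1)^4 = G^(-2)\<close>. Take a valuation ring in which
  \<open>\<epsilon> = E + 1\<close> is a nonunit; there \<open>G\<close> has a pole, and \<open>D\<close> has a third of its order. Up to a change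
  of variable, \<open>T_p f\<close> is the sum of the \<open>p + 1\<close> series \<open>f(x^p)\<close>, \<open>f(\<zeta>^i x^(1/p))\<close>. None of the
  corresponding series for \<open>G\<close> has a larger pole than \<open>G\<close> itself, hence by the relation those for
  \<open>D\<close> have poles of order at most a third of that, and \<open>T_p D_n\<close> has a pole no larger than the
  formula for \<open>D_n\<close> suggests. Since \<open>p\<close> is \<open>\<plusminus> 2\<close> modulo 5, \<open>T_p\<close> exchanges exponents
  \<open>\<plusminus> 1\<close> and \<open>\<plusminus> 2\<close> modulo 5, so only the \<open>D_k\<close> with \<open>k\<close> in the other class occur.
  Within one class the leading terms of the \<open>D_k\<close> can cancel at the pole, but only down to a factor
  \<open>\<epsilon>\<close> or \<open>\<epsilon>^2\<close>, and the resulting inequality still forces \<open>k < n\<close>.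

  The bound for \<open>G\<close> comes from theta functions at torsion points. With
  \<open>A(v)\<close>, \<open>B(v)\<close> the sums of \<open>x^(n^2) v^n\<close> over odd and even integers, one has in characteristic 2
  the duplication formulas \<open>F A(v^2) = (A(v) B(v))^2\<close> and \<open>B(v^2) = (A(v) + B(v))^4\<close>. Where \<open>F\<close> has
  a pole, the induced map on \<open>B/A\<close> is expanding away from the units, so at a torsion point \<open>v\<close>,
  whose orbit is periodic, \<open>B/A\<close> is a unit and \<open>A\<close> has a third of the pole of \<open>F\<close>.
\<close>

section \<open>Generating series in characteristic two\<close>

text \<open>Measure poles in units of the pole of G at the chosen place. There
  \<open>\<epsilon>\<close> vanishes to order 1/2, since \<open>\<epsilon>\<close>^4 is G^(-2) up to
  a unit. As D^3 = (1 + \<open>\<epsilon>\<close>) G, the D_k with k = 10 i - 1 and k = 10 i + 1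
  both have pole 2 i + 1/3 and ratio 1 + \<open>\<epsilon>\<close>; those with k = 10 i + 3 and k =
  10 i + 7 have pole 2 i + 5/3 and ratio 1 + \<open>\<epsilon>\<close>^2. Cancellation thus costs at
  most 1/2 in one class and at most 1 in the other. The theorem rests on 2 m + 5/3 < 2 (m + 1) + 1/3
  - 1/2 and 2 l + 1/3 < 2 l + 5/3 - 1, margins of 1/6 and 1/3. Both need n and k in opposite
  classes; within one class the same count cannot exclude k = n. The place is not x = 0, where G
  vanishes, so it is produced abstractly by Chevalley's theorem. Nothing is known about its value
  group: sizes are compared by membership of quotients in V, and thirds are avoided by cubing. To
  have all p + 1 conjugates of f in one field of Laurent series, everything is written in a p^2-th
  root of the variable, so that f itself becomes f(x^(p^2)).\<close>

class char_two = comm_ring_1 +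
  assumes one_plus_one_char_two: "1 + 1 = 0"
begin

lemma add_self_char_two [simp]: "x + x = 0"
proof -
  have "x + x = x * (1 + 1)" by (simp only: distrib_left mult_1_right)
  then show ?thesis by (simp only: one_plus_one_char_two mult_zero_right)
qed

lemma add_self_left_char_two [simp]: "x + (x + y) = y"
  by (simp only: add.assoc[symmetric] add_self_char_two add_0_left)

lemma add_eq_0_iff_char_two: "x + y = 0 \<longleftrightarrow> x = y"
  by (metis add_self_left_char_two add_0_right add_self_char_two)

lemma power2_add_char_two: "(x + y)\<^sup>2 = x\<^sup>2 + y\<^sup>2"
proof -
  have "(x + y)\<^sup>2 = x\<^sup>2 + y\<^sup>2 + (x * y + x * y)"
    by (simp only: power2_eq_square distrib_left distrib_right ac_simps)
  then show ?thesis by (simp only: add_self_char_two add_0_right)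
qed

lemma power4_add_char_two: "(x + y) ^ 4 = x ^ 4 + y ^ 4"
proof -
  have *: "z ^ 4 = (z\<^sup>2)\<^sup>2" for z by (simp only: power_mult[symmetric]) simp
  show ?thesis by (simp only: * power2_add_char_two)
qed

lemma of_nat_odd_char_two: "odd n \<Longrightarrow> of_nat n = 1"
proof (elim oddE)
  fix m assume "n = 2 * m + 1"
  then have "n = Suc (m + m)" by simp
  then show "of_nat n = 1" by (simp only: of_nat_Suc of_nat_add add_self_char_two add_0_right)
qed

end

instance bit :: char_two
  by standard (simp only: one_add_one bit_2_eq_0)

instance fps :: (char_two) char_two
  by standard (simp only: fps_eq_iff fps_add_nth add_self_char_two fps_zero_nth simp_thms)

instance fls :: (char_two) char_two
  by standard (simp only: fls_eq_iff fls_plus_nth add_self_char_two fls_zero_nth simp_thms)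

text \<open>Each two-element orbit contributes \<open>f x + f x = 0\<close>, so only fixed points
  survive. The induction removes one such orbit at a time.\<close>

lemma sum_involution_char_two:
  fixes f :: "'i \<Rightarrow> 'a::char_two"
  assumes "finite S" "\<And>x. x \<in> S \<Longrightarrow> \<phi> x \<in> S" "\<And>x. x \<in> S \<Longrightarrow> \<phi> (\<phi> x) = x"
    and "\<And>x. x \<in> S \<Longrightarrow> f (\<phi> x) = f x"
  shows "sum f S = sum f {x \<in> S. \<phi> x = x}"
  using assms
proof (induction "card S" arbitrary: S rule: less_induct)
  case less
  show ?case
  proof (cases "\<exists>x\<in>S. \<phi> x \<noteq> x")
    case False
    then have "{x \<in> S. \<phi> x = x} = S" by auto
    then show ?thesis by simp
  next
    case True
    then obtain x where x: "x \<in> S" "\<phi> x \<noteq> x" by auto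
    define T where "T = S - {x, \<phi> x}"
    have S: "S = insert x (insert (\<phi> x) T)" "x \<notin> insert (\<phi> x) T" "\<phi> x \<notin> T" "finite T"
      using x less.prems by (auto simp: T_def)
    have "sum f S = f x + (f (\<phi> x) + sum f T)"
      using S by simp
    also have "\<dots> = sum f T" using less.prems(4)[OF x(1)] by simp
    also have "\<dots> = sum f {x \<in> T. \<phi> x = x}"
    proof (rule less.hyps)
      show "card T < card S" using S by (simp add: card_insert_if)
      show "\<phi> y \<in> T" if "y \<in> T" for y
        using that less.prems(2,3) x unfolding T_def by (metis DiffD1 DiffD2 DiffI empty_iff insert_iff)
    qed (use less.prems in \<open>auto simp: T_def\<close>)
    also have "{x \<in> T. \<phi> x = x} = {x \<in> S. \<phi> x = x}"
      using x less.prems by (auto simp: T_def)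
    finally show ?thesis .
  qed
qed

text \<open>The sum of w(s) x^(d(s)) over an arbitrary index set. Keeping the index set visible
  reduces identities between theta products to degree-preserving bijections and involutions. For an
  infinite fibre the coefficient is the default 0 of \<open>sum\<close>, hence the condition
  \<open>fin_fibres\<close>.\<close>

definition gf :: "'i set \<Rightarrow> ('i \<Rightarrow> nat) \<Rightarrow> ('i \<Rightarrow> 'a) \<Rightarrow> 'a::comm_ring_1 fps" where
  "gf S d w = Abs_fps (\<lambda>N. \<Sum>s | s \<in> S \<and> d s = N. w s)"

definition fin_fibres :: "'i set \<Rightarrow> ('i \<Rightarrow> nat) \<Rightarrow> bool" where
  "fin_fibres S d \<longleftrightarrow> (\<forall>N. finite {s \<in> S. d s = N})"

lemma fin_fibresD: "fin_fibres S d \<Longrightarrow> finite {s \<in> S. d s = N}"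
  by (simp add: fin_fibres_def)

lemma fin_fibres_atMost:
  assumes "fin_fibres S d" shows "finite {s \<in> S. d s \<le> N}"
proof -
  have "{s \<in> S. d s \<le> N} = (\<Union>M\<le>N. {s \<in> S. d s = M})" by auto
  then show ?thesis using assms by (simp add: fin_fibres_def)
qed

lemma fin_fibres_subset: "fin_fibres S d \<Longrightarrow> T \<subseteq> S \<Longrightarrow> fin_fibres T d"
  unfolding fin_fibres_def
proof
  fix N assume *: "\<forall>N. finite {s \<in> S. d s = N}" "T \<subseteq> S"
  have "{s \<in> T. d s = N} \<subseteq> {s \<in> S. d s = N}" using *(2) by auto
  then show "finite {s \<in> T. d s = N}" using *(1) finite_subset by blast
qed
    
lemma fin_fibres_Times:
  assumes "fin_fibres S d" "fin_fibres T e"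
  shows "fin_fibres (S \<times> T) (\<lambda>(s, t). d s + e t)"
  unfolding fin_fibres_def
proof
  fix N
  have "{x \<in> S \<times> T. (\<lambda>(s, t). d s + e t) x = N} \<subseteq> {s \<in> S. d s \<le> N} \<times> {t \<in> T. e t \<le> N}"
    by auto
  then show "finite {x \<in> S \<times> T. (\<lambda>(s, t). d s + e t) x = N}"
    by (rule finite_subset) (intro finite_cartesian_product fin_fibres_atMost assms)
qed

lemma gf_nth: "gf S d w $ N = (\<Sum>s | s \<in> S \<and> d s = N. w s)"
  by (simp add: gf_def)

lemma gf_mult:
  assumes "fin_fibres S d" "fin_fibres T e"
  shows "gf S d w * gf T e v = gf (S \<times> T) (\<lambda>(s, t). d s + e t) (\<lambda>(s, t). w s * v t)"
proof (rule fps_ext)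
  fix N
  have "(gf S d w * gf T e v) $ N
      = (\<Sum>i=0..N. (\<Sum>x\<in>{s\<in>S. d s = i} \<times> {t\<in>T. e t = N - i}. w (fst x) * v (snd x)))"
    by (simp add: fps_mult_nth gf_nth sum_product sum.cartesian_product case_prod_beta)
  also have "\<dots> = (\<Sum>x\<in>(\<Union>i\<in>{0..N}. {s\<in>S. d s = i} \<times> {t\<in>T. e t = N - i}). w (fst x) * v (snd x))"
    by (rule sum.UNION_disjoint[symmetric]) (use assms in \<open>auto simp: fin_fibres_def\<close>)
  also have "(\<Union>i\<in>{0..N}. {s\<in>S. d s = i} \<times> {t\<in>T. e t = N - i})
      = {x \<in> S \<times> T. (\<lambda>(s, t). d s + e t) x = N}" by auto
  finally show "(gf S d w * gf T e v) $ N
      = gf (S \<times> T) (\<lambda>(s, t). d s + e t) (\<lambda>(s, t). w s * v t) $ N"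
    by (simp add: gf_nth case_prod_beta)
qed

lemma gf_reindex:
  assumes "bij_betw h S T" "\<And>s. s \<in> S \<Longrightarrow> e (h s) = d s" "\<And>s. s \<in> S \<Longrightarrow> v (h s) = w s"
  shows "gf S d w = gf T e v"
proof (rule fps_ext)
  fix N
  have "bij_betw h {s \<in> S. d s = N} {t \<in> T. e t = N}"
    using assms(1,2) unfolding bij_betw_def inj_on_def by (auto simp: image_iff)
  from sum.reindex_bij_betw[OF this, of v] show "gf S d w $ N = gf T e v $ N"
    using assms(3) by (simp add: gf_nth)
qed

lemma gf_cong:
  assumes "S = T" "\<And>s. s \<in> T \<Longrightarrow> d s = e s" "\<And>s. s \<in> T \<Longrightarrow> w s = v s"
  shows "gf S d w = gf T e v"
  using assms by (intro gf_reindex[where h=id]) auto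

lemma gf_Un:
  assumes "fin_fibres S d" "fin_fibres T d" "S \<inter> T = {}"
  shows "gf (S \<union> T) d w = gf S d w + gf T d w"
proof (rule fps_ext)
  fix N
  have "{s \<in> S \<union> T. d s = N} = {s \<in> S. d s = N} \<union> {s \<in> T. d s = N}" by auto
  then show "gf (S \<union> T) d w $ N = (gf S d w + gf T d w) $ N"
    using assms by (simp add: gf_nth) (subst sum.union_disjoint; auto simp: fin_fibres_def)
qed

lemma gf_add: "gf S d (\<lambda>s. w s + v s) = gf S d w + gf S d v"
  by (rule fps_ext) (simp add: gf_nth sum.distrib)

lemma gf_sum: "gf S d (\<lambda>s. \<Sum>i\<in>I. w i s) = (\<Sum>i\<in>I. gf S d (w i))"
  by (rule fps_ext) (simp add: gf_nth fps_sum_nth sum.swap[of _ I])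

lemma gf_involution:
  fixes w :: "'i \<Rightarrow> 'a::char_two"
  assumes "fin_fibres S d" "\<And>x. x \<in> S \<Longrightarrow> \<phi> x \<in> S" "\<And>x. x \<in> S \<Longrightarrow> \<phi> (\<phi> x) = x"
    and "\<And>x. x \<in> S \<Longrightarrow> d (\<phi> x) = d x" "\<And>x. x \<in> S \<Longrightarrow> w (\<phi> x) = w x"
  shows "gf S d w = gf {x \<in> S. \<phi> x = x} d w"
proof (rule fps_ext)
  fix N
  have "sum w {s \<in> S. d s = N} = sum w {x \<in> {s \<in> S. d s = N}. \<phi> x = x}"
    by (rule sum_involution_char_two) (use assms in \<open>auto simp: fin_fibres_def\<close>)
  also have "{x \<in> {s \<in> S. d s = N}. \<phi> x = x} = {s \<in> {x \<in> S. \<phi> x = x}. d s = N}" by auto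
  finally show "gf S d w $ N = gf {x \<in> S. \<phi> x = x} d w $ N" by (simp add: gf_nth)
qed

text \<open>In the square, the pairs (s, t) and (t, s) cancel and only the diagonal remains: this is
  the Frobenius map.\<close>

lemma gf_power2:
  fixes w :: "'i \<Rightarrow> 'a::char_two"
  assumes "fin_fibres S d"
  shows "(gf S d w)\<^sup>2 = gf S (\<lambda>s. 2 * d s) (\<lambda>s. (w s)\<^sup>2)"
proof -
  let ?d = "\<lambda>x. d (fst x) + d (snd x)" and ?w = "\<lambda>x. w (fst x) * w (snd x)"
  have fin: "fin_fibres (S \<times> S) ?d"
    using fin_fibres_Times[OF assms assms] by (simp only: case_prod_unfold)
  have "(gf S d w)\<^sup>2 = gf (S \<times> S) ?d ?w"
    unfolding power2_eq_square gf_mult[OF assms assms] by (simp only: case_prod_unfold)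
  also have "\<dots> = gf {x \<in> S \<times> S. prod.swap x = x} ?d ?w"
    by (rule gf_involution[OF fin]) (auto simp: ac_simps)
  also have "{x \<in> S \<times> S. prod.swap x = x} = {x \<in> S \<times> S. fst x = snd x}"
    by (rule Collect_cong) (simp add: prod_eq_iff, metis)
  also have "gf {x \<in> S \<times> S. fst x = snd x} ?d ?w = gf S (\<lambda>s. 2 * d s) (\<lambda>s. (w s)\<^sup>2)"
  proof (rule gf_reindex)
    show "bij_betw fst {x \<in> S \<times> S. fst x = snd x} S"
      by (rule bij_betwI[where g="\<lambda>s. (s, s)"]) auto
  qed (auto simp: mult_2 power2_eq_square)
  finally show ?thesis .
qed

lemma fin_fibres_mult: "fin_fibres S d \<Longrightarrow> k > 0 \<Longrightarrow> fin_fibres S (\<lambda>s. k * d s)"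
  unfolding fin_fibres_def
proof
  fix N assume *: "\<forall>N. finite {s \<in> S. d s = N}" "k > 0"
  have "{s \<in> S. k * d s = N} \<subseteq> {s \<in> S. d s = N div k}" using *(2) by auto
  then show "finite {s \<in> S. k * d s = N}" using *(1) finite_subset by blast
qed

text \<open>The substitution f(c x^e). With roots of unity for \<open>c\<close> it yields all
  conjugates of a series under the isogenies of degree p.\<close>

definition ev :: "'a::field \<Rightarrow> nat \<Rightarrow> 'a fps \<Rightarrow> 'a fps" where
  "ev c e f = Abs_fps (\<lambda>n. if e dvd n then c ^ (n div e) * f $ (n div e) else 0)"

lemma ev_eq_compose: "e > 0 \<Longrightarrow> ev c e f = (f oo (fps_const c * fps_X)) oo (fps_X ^ e)"
  by (rule fps_ext) (simp add: ev_def fps_nth_compose_X_power fps_compose_linear)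

lemma ev_ring_hom:
  fixes f g :: "'a::field fps"
  assumes "e > 0"
  shows "ev c e (f + g) = ev c e f + ev c e g" "ev c e (f * g) = ev c e f * ev c e g"
    "ev c e 1 = 1"
  using assms by (simp_all add: ev_eq_compose fps_compose_add_distrib fps_compose_mult_distrib)

lemma ev_eq_0_iff: "c \<noteq> 0 \<Longrightarrow> e > 0 \<Longrightarrow> ev c e f = 0 \<longleftrightarrow> f = 0"
proof
  assume *: "c \<noteq> 0" "e > 0" "ev c e f = 0"
  show "f = 0"
  proof (rule fps_ext)
    fix n
    have "ev c e f $ (e * n) = 0" using * by simp
    then show "f $ n = 0 $ n" using * by (simp add: ev_def)
  qed
qed (auto simp: ev_def fps_eq_iff)

lemma ev_gf:
  assumes "e > 0"
  shows "ev c e (gf S d w) = gf S (\<lambda>s. e * d s) (\<lambda>s. c ^ d s * w s)"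
proof (rule fps_ext)
  fix n
  show "ev c e (gf S d w) $ n = gf S (\<lambda>s. e * d s) (\<lambda>s. c ^ d s * w s) $ n"
  proof (cases "e dvd n")
    case True
    then obtain m where m: "n = e * m" by auto
    show ?thesis using assms by (simp add: m ev_def gf_nth sum_distrib_left)
  next
    case False
    then have "{s \<in> S. e * d s = n} = {}" by auto
    with False show ?thesis by (simp only: ev_def gf_nth fps_nth_Abs_fps sum.empty if_False)
  qed
qed

lemma ev_ev: "e > 0 \<Longrightarrow> e' > 0 \<Longrightarrow> ev c e (ev c' e' f) = ev (c' * c ^ e') (e * e') f"
  apply (rule fps_ext)
  subgoal for n
    apply (cases "e * e' dvd n")
     apply (auto simp: ev_def power_mult_distrib power_mult elim!: dvdE)
    done
  done

section \<open>Valuation rings\<close>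

definition subring_set :: "'a::field set \<Rightarrow> bool" where
  "subring_set V \<longleftrightarrow> 0 \<in> V \<and> 1 \<in> V \<and> (\<forall>x\<in>V. \<forall>y\<in>V. x + y \<in> V \<and> x * y \<in> V) \<and> (\<forall>x\<in>V. - x \<in> V)"

lemma subring_setD:
  assumes "subring_set V"
  shows "0 \<in> V" "1 \<in> V" "x \<in> V \<Longrightarrow> y \<in> V \<Longrightarrow> x + y \<in> V"
    "x \<in> V \<Longrightarrow> y \<in> V \<Longrightarrow> x * y \<in> V" "x \<in> V \<Longrightarrow> - x \<in> V"
    "x \<in> V \<Longrightarrow> y \<in> V \<Longrightarrow> x - y \<in> V"
  using assms unfolding subring_set_def by (auto simp only: diff_conv_add_uminus)

lemma subring_set_power: "subring_set V \<Longrightarrow> x \<in> V \<Longrightarrow> x ^ n \<in> V"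
  by (induction n) (auto intro: subring_setD)

lemma subring_set_sum: "subring_set V \<Longrightarrow> (\<And>i. i \<in> I \<Longrightarrow> f i \<in> V) \<Longrightarrow> sum f I \<in> V"
  by (induction I rule: infinite_finite_induct) (auto intro: subring_setD)

lemma subring_set_adjoin:
  assumes M: "subring_set M"
  shows "subring_set {poly q x |q. \<forall>i. coeff q i \<in> M}" (is "subring_set ?B")
  unfolding subring_set_def
proof (intro conjI ballI)
  show "0 \<in> ?B" using subring_setD[OF M] by (auto intro!: exI[of _ 0])
  show "1 \<in> ?B" using subring_setD[OF M] by (auto intro!: exI[of _ 1] simp: coeff_1)
next
  fix a b assume "a \<in> ?B" "b \<in> ?B"
  then obtain f g where fg: "a = poly f x" "b = poly g x" "\<forall>i. coeff f i \<in> M" "\<forall>i. coeff g i \<in> M"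
    by auto
  show "a + b \<in> ?B" using fg subring_setD[OF M] by (auto intro!: exI[of _ "f + g"])
  have "coeff (f * g) i \<in> M" for i
    unfolding coeff_mult by (intro subring_set_sum[OF M] subring_setD(4)[OF M]) (use fg in auto)
  then show "a * b \<in> ?B" using fg by (auto intro!: exI[of _ "f * g"])
next
  fix a assume "a \<in> ?B"
  then obtain f where "a = poly f x" "\<forall>i. coeff f i \<in> M" by auto
  then show "- a \<in> ?B" using subring_setD[OF M] by (auto intro!: exI[of _ "- f"])
qed

lemma subring_set_localize:
  assumes M: "subring_set M" and u: "u \<in> M" "u \<noteq> 0"
  shows "subring_set {c / u ^ n |c n. c \<in> M}" (is "subring_set ?B")
  unfolding subring_set_def
proof (intro conjI ballI)
  have "0 / u ^ 0 \<in> ?B" "1 / u ^ 0 \<in> ?B" using subring_setD(1,2)[OF M] by blast+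
  then show "0 \<in> ?B" "1 \<in> ?B" by simp_all
next
  fix a b assume "a \<in> ?B" "b \<in> ?B"
  then obtain c m d n where ab: "a = c / u ^ m" "b = d / u ^ n" "c \<in> M" "d \<in> M" by auto
  have "a + b = (c * u ^ n + d * u ^ m) / u ^ (m + n)" "a * b = (c * d) / u ^ (m + n)"
    using u by (simp_all add: ab power_add field_simps)
  moreover have "c * u ^ n + d * u ^ m \<in> M" "c * d \<in> M"
    using ab u by (auto intro!: subring_setD[OF M] subring_set_power[OF M])
  ultimately show "a + b \<in> ?B" "a * b \<in> ?B" by blast+
next
  fix a assume "a \<in> ?B"
  then obtain c m where "a = c / u ^ m" "c \<in> M" by auto
  then have "- a = (- c) / u ^ m" "- c \<in> M" using subring_setD[OF M] by auto
  then show "- a \<in> ?B" by blast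
qed

definition valuation_ring :: "'a::field set \<Rightarrow> bool" where
  "valuation_ring V \<longleftrightarrow> subring_set V \<and> (\<forall>x. x \<in> V \<or> inverse x \<in> V)"

text \<open>The maximal ideal of a valuation ring. Zero is listed separately because
  \<open>inverse 0 = 0\<close> lies in \<open>V\<close>.\<close>

definition nonunits :: "'a::field set \<Rightarrow> 'a set" where
  "nonunits V = {x \<in> V. x = 0 \<or> inverse x \<notin> V}"

text \<open>Degree reduction in Chevalley's argument. Since 1 - s g_0 is a unit of \<open>M\<close>,
  the relation in \<open>inverse x\<close> expresses 1 by strictly positive powers of
  \<open>inverse x\<close>; multiplying it by the top term f_n x^n rewrites that term in lower
  powers of x, which is possible because m \<le> n.\<close>

lemma valuation_ring_extension_aux:
  fixes x s :: "'a::field"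
  assumes M: "subring_set M" and s: "s \<in> M"
    and units: "\<And>b. b \<in> M \<Longrightarrow> inverse (1 - s * b) \<in> M" "\<And>b. b \<in> M \<Longrightarrow> s * b \<noteq> 1"
    and x: "x \<noteq> 0" and f: "\<And>i. f i \<in> M" "s * (\<Sum>i\<le>n. f i * x ^ i) = 1"
    and g: "\<And>i. g i \<in> M" "s * (\<Sum>i\<le>m. g i * inverse x ^ i) = 1"
    and mn: "0 < m" "m \<le> n"
  shows "\<exists>h. (\<forall>i. h i \<in> M) \<and> s * (\<Sum>i\<le>n-1. h i * x ^ i) = 1"
proof -
  define v where "v = inverse (1 - s * g 0)"
  have v: "v \<in> M" using units(1) g(1) by (simp add: v_def)
  have v1: "(1 - s * g 0) * v = 1" using units(2)[OF g(1)[of 0]] by (simp add: v_def)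
  have "1 = s * g 0 + s * (\<Sum>i\<in>{1..m}. g i * inverse x ^ i)"
    using g(2) by (simp add: atMost_atLeast0 sum.atLeast_Suc_atMost distrib_left)
  then have "1 - s * g 0 = s * (\<Sum>i\<in>{1..m}. g i * inverse x ^ i)" by (simp add: algebra_simps)
  then have one: "1 = v * s * (\<Sum>j\<in>{1..m}. g j * inverse x ^ j)" using v1 by (simp add: mult_ac)
  have top: "f n * x ^ n = (\<Sum>i\<in>{n-m..n-1}. f n * v * s * g (n - i) * x ^ i)"
  proof -
    have "f n * x ^ n = f n * x ^ n * (v * s * (\<Sum>j\<in>{1..m}. g j * inverse x ^ j))"
      by (simp only: one[symmetric] mult_1_right)
    also have "\<dots> = (\<Sum>j\<in>{1..m}. f n * v * s * g j * (x ^ n * inverse x ^ j))"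
      by (simp add: sum_distrib_left mult_ac)
    also have "\<dots> = (\<Sum>i\<in>{n-m..n-1}. f n * v * s * g (n - i) * x ^ i)"
    proof (rule sum.reindex_bij_witness[of _ "\<lambda>i. n - i" "\<lambda>j. n - j"])
      fix j assume j: "j \<in> {1..m}"
      have "x ^ n = x ^ (n - j) * x ^ j" using j mn by (simp flip: power_add)
      then have "x ^ n * inverse x ^ j = x ^ (n - j)"
        using x by (simp add: field_simps)
      then show "f n * v * s * g (n - (n - j)) * x ^ (n - j) = f n * v * s * g j * (x ^ n * inverse x ^ j)"
        using j mn by simp
    qed (use mn in auto)
    finally show ?thesis .
  qed
  \<comment> \<open>The old coefficients below degree n plus those of the rewritten top term; values
    of \<open>h\<close> beyond n - 1 do not enter the sum.\<close>
  define h where "h i = f i + (if n - m \<le> i then f n * v * s * g (n - i) else 0)" for i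
  have "(\<Sum>i\<le>n-1. h i * x ^ i)
      = (\<Sum>i\<le>n-1. f i * x ^ i) + (\<Sum>i\<le>n-1. if n - m \<le> i then f n * v * s * g (n - i) * x ^ i else 0)"
    by (simp add: h_def distrib_right if_distrib sum.distrib flip: sum.distrib cong: if_cong)
       (rule sum.cong; simp add: algebra_simps)
  also have "(\<Sum>i\<le>n-1. if n - m \<le> i then f n * v * s * g (n - i) * x ^ i else 0)
      = (\<Sum>i\<in>{n-m..n-1}. f n * v * s * g (n - i) * x ^ i)"
    by (rule sum.mono_neutral_cong_right) auto
  also have "(\<Sum>i\<le>n-1. f i * x ^ i) + \<dots> = (\<Sum>i\<le>n. f i * x ^ i)"
  proof -
    obtain k where "n = Suc k" using mn by (cases n) auto
    then show ?thesis using top by simp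
  qed
  finally have "s * (\<Sum>i\<le>n-1. h i * x ^ i) = 1" using f(2) by simp
  moreover have "\<forall>i. h i \<in> M"
    using f(1) g(1) s v by (auto simp: h_def intro!: subring_setD[OF M])
  ultimately show ?thesis by blast
qed

text \<open>Chevalley's extension theorem for the principal ideal generated by \<open>s\<close>: a subring that is
  maximal among those in which \<open>s\<close> is not invertible is a valuation ring.\<close>

theorem valuation_ring_exists:
  fixes s :: "'a::field"
  assumes A: "subring_set A" "s \<in> A" "\<And>a. a \<in> A \<Longrightarrow> s * a \<noteq> 1"
  obtains V where "valuation_ring V" "A \<subseteq> V" "s \<in> nonunits V"
proof -
  define C where "C = {B. subring_set B \<and> A \<subseteq> B \<and> (\<forall>b\<in>B. s * b \<noteq> 1)}"
  have "\<exists>M\<in>C. \<forall>U\<in>C. M \<subseteq> U \<longrightarrow> U = M"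
  proof (rule subset_Zorn_nonempty)
    show "C \<noteq> {}" using A by (auto simp: C_def)
    fix T assume T: "T \<noteq> {}" "subset.chain C T"
    have TC: "U \<in> C" if "U \<in> T" for U using T(2) that by (auto simp: subset.chain_def)
    have lin: "\<exists>Z\<in>T. x \<in> Z \<and> y \<in> Z" if "x \<in> U" "U \<in> T" "y \<in> Y" "Y \<in> T" for x y U Y
    proof -
      have "U \<subseteq> Y \<or> Y \<subseteq> U" using T(2) that by (auto simp: subset_chain_def)
      then show ?thesis using that by blast
    qed
    obtain X0 where X0: "X0 \<in> T" using T(1) by auto
    have "subring_set (\<Union>T)" unfolding subring_set_def
    proof (intro conjI ballI)
      show "0 \<in> \<Union>T" "1 \<in> \<Union>T" using TC[OF X0] X0 subring_setD by (auto simp: C_def)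
      fix x assume "x \<in> \<Union>T"
      then obtain U where U: "x \<in> U" "U \<in> T" by auto
      then show "- x \<in> \<Union>T" using TC[OF U(2)] subring_setD(5) by (auto simp: C_def)
      fix y assume "y \<in> \<Union>T"
      then obtain Y where "y \<in> Y" "Y \<in> T" by auto
      from lin[OF U this] obtain Z where Z: "Z \<in> T" "x \<in> Z" "y \<in> Z" by blast
      then show "x + y \<in> \<Union>T" "x * y \<in> \<Union>T"
        using TC[OF Z(1)] subring_setD(3,4)[of Z x y] by (auto simp: C_def)
    qed
    then show "\<Union>T \<in> C" using TC X0 by (auto simp: C_def)
  qed
  then obtain M where MC: "M \<in> C" and max: "\<And>U. U \<in> C \<Longrightarrow> M \<subseteq> U \<Longrightarrow> U = M" by blast
  have M: "subring_set M" and AM: "A \<subseteq> M" and no: "\<And>b. b \<in> M \<Longrightarrow> s * b \<noteq> 1"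
    using MC by (auto simp: C_def)
  have sM: "s \<in> M" using A AM by auto
  \<comment> \<open>Localising \<open>M\<close> at u = 1 - s b keeps \<open>s\<close>
    non-invertible: powers of u stay of the form 1 - s d, so s c = u^n would give s (c + d) = 1
    inside \<open>M\<close>. Maximality then puts the inverse of u into \<open>M\<close>.\<close>
  have units: "inverse (1 - s * b) \<in> M" if b: "b \<in> M" for b
  proof -
    define u where "u = 1 - s * b"
    have u: "u \<in> M" "u \<noteq> 0" using no[OF b] b sM by (auto simp: u_def intro!: subring_setD[OF M])
    let ?B = "{c / u ^ n |c n. c \<in> M}"
    have pow: "\<exists>d\<in>M. u ^ n = 1 - s * d" for n
    proof (induction n)
      case 0 show ?case by (rule bexI[of _ 0]) (auto intro: subring_setD[OF M])
    next
      case (Suc n)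
      then obtain d where d: "d \<in> M" "u ^ n = 1 - s * d" by auto
      have "u ^ Suc n = 1 - s * (b + d - b * s * d)"
        unfolding power_Suc d(2) by (simp add: u_def algebra_simps)
      moreover have "b + d - b * s * d \<in> M"
        using b d sM by (auto intro!: subring_setD[OF M])
      ultimately show ?case by blast
    qed
    have MB: "M \<subseteq> ?B"
    proof
      fix c assume "c \<in> M"
      then have "c / u ^ 0 \<in> ?B" by blast
      then show "c \<in> ?B" by simp
    qed
    have "s * (c / u ^ n) \<noteq> 1" if c: "c \<in> M" for c n
    proof
      assume "s * (c / u ^ n) = 1"
      then have *: "s * c = u ^ n" using u by simp
      obtain d where d: "d \<in> M" "u ^ n = 1 - s * d" using pow by blast
      then have "s * (c + d) = 1" using * by (simp add: distrib_left)
      then show False using no c d subring_setD(3)[OF M] by blast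
    qed
    then have "\<forall>b\<in>?B. s * b \<noteq> 1" by blast
    then have "?B \<in> C"
      using subring_set_localize[OF M u] subset_trans[OF AM MB] unfolding C_def by blast
    from max[OF this MB] have "?B = M" .
    moreover have "1 / u ^ 1 \<in> ?B" using subring_setD(2)[OF M] by blast
    ultimately show ?thesis by (simp add: u_def inverse_eq_divide)
  qed
  \<comment> \<open>The ring generated by \<open>M\<close> and x is strictly larger, so by
    maximality \<open>s\<close> becomes invertible in it.\<close>
  have ex: "\<exists>n f. (\<forall>i. f i \<in> M) \<and> s * (\<Sum>i\<le>n. f i * x ^ i) = 1" if x: "x \<notin> M" for x
  proof -
    let ?B = "{poly q x |q. \<forall>i. coeff q i \<in> M}"
    have MB: "M \<subseteq> ?B"
    proof
      fix c assume "c \<in> M" then show "c \<in> ?B" using subring_setD(1)[OF M]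
        by (auto intro!: exI[of _ "[:c:]"] simp: coeff_pCons split: nat.split)
    qed
    have "x \<in> ?B" using subring_setD(1,2)[OF M]
      by (auto intro!: exI[of _ "[:0, 1:]"] simp: coeff_pCons split: nat.split)
    then have "?B \<notin> C" using max[OF _ MB] x by blast
    then obtain q where "\<forall>i. coeff q i \<in> M" "s * poly q x = 1"
      using subring_set_adjoin[OF M] AM MB unfolding C_def by blast
    then show ?thesis by (auto simp: poly_altdef)
  qed
  have "x \<in> M \<or> inverse x \<in> M" for x
  proof (rule ccontr)
    assume neg: "\<not> (x \<in> M \<or> inverse x \<in> M)"
    then have x0: "x \<noteq> 0" using subring_setD(1)[OF M] by auto
    define R where "R y n \<longleftrightarrow> (\<exists>f. (\<forall>i. f i \<in> M) \<and> s * (\<Sum>i\<le>n. f i * y ^ i) = 1)" for y n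
    have R0: "\<not> R y 0" for y using no by (auto simp: R_def)
    have step: "R y (n - 1)" if "R y n" "R (inverse y) m" "y \<noteq> 0" "m \<le> n" for y n m
    proof -
      have "0 < m" using R0 that(2) by (cases m) auto
      from that(1) obtain f where f: "\<And>i. f i \<in> M" "s * (\<Sum>i\<le>n. f i * y ^ i) = 1"
        unfolding R_def by blast
      from that(2) obtain g where g: "\<And>i. g i \<in> M" "s * (\<Sum>i\<le>m. g i * inverse y ^ i) = 1"
        unfolding R_def by blast
      show ?thesis unfolding R_def
        by (rule valuation_ring_extension_aux[OF M sM units no that(3) f g \<open>0 < m\<close> that(4)])
    qed
    \<comment> \<open>With both degrees minimal, the reduction lemma lowers the larger of the two, a
      contradiction.\<close>
    define n where "n = (LEAST n. R x n)"
    define m where "m = (LEAST n. R (inverse x) n)"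
    have "\<exists>n. R x n" "\<exists>m. R (inverse x) m" using ex neg unfolding R_def by blast+
    then have n: "R x n" and m: "R (inverse x) m" unfolding n_def m_def by (auto intro: LeastI_ex)
    have "0 < n" "0 < m" using n m R0 by (metis gr0I)+
    show False
    proof (cases "m \<le> n")
      case True
      then have "R x (n - 1)" using step n m x0 by blast
      then have "n \<le> n - 1" unfolding n_def by (rule Least_le)
      with \<open>0 < n\<close> show False by simp
    next
      case False
      then have "R (inverse x) (m - 1)" using step[of "inverse x" m n] n m x0 by simp
      then have "m \<le> m - 1" unfolding m_def by (rule Least_le)
      with \<open>0 < m\<close> show False by simp
    qed
  qed
  then have "valuation_ring M" using M by (simp add: valuation_ring_def)
  moreover have "s \<in> nonunits M"
    using sM no[of "inverse s"] by (auto simp: nonunits_def)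
  ultimately show ?thesis using AM that by blast
qed

section \<open>Theta series\<close>

definition sq :: "int \<Rightarrow> nat" where "sq n = nat (n\<^sup>2)"

lemma int_sq [simp]: "int (sq n) = n\<^sup>2"
  by (simp add: sq_def)

lemma sq_minus [simp]: "sq (- n) = sq n"
  by (simp add: sq_def)

lemma fin_fibres_sq: "fin_fibres S sq"
  unfolding fin_fibres_def
proof
  fix N
  have "n \<in> {- int N..int N}" if "sq n = N" for n
  proof -
    have "\<bar>n\<bar> \<le> \<bar>n\<bar>\<^sup>2" by (cases "n = 0", simp) (rule self_le_power; simp)
    then have "\<bar>n\<bar> \<le> n\<^sup>2" by simp
    then show ?thesis using that by auto
  qed
  then have "{n \<in> S. sq n = N} \<subseteq> {- int N..int N}" by blast
  then show "finite {n \<in> S. sq n = N}" by (rule finite_subset) simp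
qed

lemma half_sum_diff:
  fixes m n :: int
  assumes "even (m + n)"
  shows "(m + n) div 2 + (m - n) div 2 = m" "(m + n) div 2 - (m - n) div 2 = n"
proof -
  obtain k where "m + n = 2 * k" using assms by (elim evenE)
  then have "m = 2 * k - n" by simp
  then show "(m + n) div 2 + (m - n) div 2 = m" "(m + n) div 2 - (m - n) div 2 = n"
    by simp_all
qed

definition theta_odd :: "(int \<Rightarrow> 'a) \<Rightarrow> 'a::comm_ring_1 fps" where
  "theta_odd \<psi> = gf {n. odd n} sq \<psi>"

definition theta_even :: "(int \<Rightarrow> 'a) \<Rightarrow> 'a::comm_ring_1 fps" where
  "theta_even \<psi> = gf {n. even n} sq \<psi>"

text \<open>For an even weight the terms at n and - n of \<open>theta_odd\<close> cancel in
  characteristic 2, so F has to be summed over positive indices.\<close>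

definition theta_pos :: "(int \<Rightarrow> 'a) \<Rightarrow> 'a::comm_ring_1 fps" where
  "theta_pos \<psi> = gf {n. odd n \<and> n > 0} sq \<psi>"

abbreviation "theta_one \<equiv> theta_pos (\<lambda>_. 1)"

lemma gf_restrict:
  assumes "fin_fibres S d" "\<And>s. s \<in> S \<Longrightarrow> \<not> P s \<Longrightarrow> w s = 0"
  shows "gf S d w = gf {s \<in> S. P s} d w"
proof (rule fps_ext)
  fix N
  have "sum w {s \<in> S. d s = N} = sum w {s \<in> {s \<in> S. P s}. d s = N}"
    by (rule sum.mono_neutral_right) (use assms in \<open>auto simp: fin_fibres_def\<close>)
  then show "gf S d w $ N = gf {s \<in> S. P s} d w $ N" by (simp add: gf_nth)
qed

lemma gf_fibre:
  assumes "fin_fibres I e" "\<And>i. i \<in> I \<Longrightarrow> finite (J i)"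
  shows "gf (Sigma I J) (\<lambda>x. e (fst x)) w = gf I e (\<lambda>i. \<Sum>j\<in>J i. w (i, j))"
proof (rule fps_ext)
  fix N
  have "{x \<in> Sigma I J. e (fst x) = N} = Sigma {i \<in> I. e i = N} J" by auto
  then show "gf (Sigma I J) (\<lambda>x. e (fst x)) w $ N = gf I e (\<lambda>i. \<Sum>j\<in>J i. w (i, j)) $ N"
    using assms by (simp add: gf_nth sum.Sigma fin_fibres_def)
qed

lemma gf_mult':
  assumes "fin_fibres S d" "fin_fibres T e"
  shows "gf S d w * gf T e v = gf (S \<times> T) (\<lambda>x. d (fst x) + e (snd x)) (\<lambda>x. w (fst x) * v (snd x))"
  unfolding gf_mult[OF assms] by (simp only: case_prod_unfold)

lemma fin_fibres_Times':
  assumes "fin_fibres S d" "fin_fibres T e"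
  shows "fin_fibres (S \<times> T) (\<lambda>x. d (fst x) + e (snd x))"
  using fin_fibres_Times[OF assms] by (simp only: case_prod_unfold)

lemmas fin_fibres_sq2 = fin_fibres_mult[OF fin_fibres_sq zero_less_numeral]

text \<open>The change of variables m = a - b, n = a + b gives m^2 + n^2 = 2 a^2 + 2 b^2, the
  exponent in the squared product. Evenness of \<open>\<kappa>\<close> permits replacing m by its
  absolute value.\<close>

lemma theta_odd_doubling:
  fixes \<psi> \<chi> \<kappa> :: "int \<Rightarrow> 'a::char_two"
  assumes mult: "\<And>a b. odd a \<Longrightarrow> even b \<Longrightarrow> (\<psi> a)\<^sup>2 * (\<psi> b)\<^sup>2 = \<chi> (a + b) * \<kappa> (a - b)"
    and even: "\<And>m. \<kappa> (- m) = \<kappa> m"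
  shows "theta_pos \<kappa> * theta_odd \<chi> = (theta_odd \<psi> * theta_even \<psi>)\<^sup>2"
proof -
  define h :: "int \<times> int \<Rightarrow> int \<times> int" where "h x = (\<bar>fst x - snd x\<bar>, fst x + snd x)" for x
  \<comment> \<open>The absolute value forgets the sign of a - b. It is recovered by parity: of (n -
    m)/2 and (n + m)/2 exactly one is even, and that one must be b.\<close>
  define g :: "int \<times> int \<Rightarrow> int \<times> int" where "g y = (if 4 dvd snd y - fst y
    then ((snd y + fst y) div 2, (snd y - fst y) div 2)
    else ((snd y - fst y) div 2, (snd y + fst y) div 2))" for y
  have "(theta_odd \<psi> * theta_even \<psi>)\<^sup>2
      = gf ({a::int. odd a} \<times> {b::int. even b}) (\<lambda>x. 2 * sq (fst x) + 2 * sq (snd x))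
          (\<lambda>x. (\<psi> (fst x))\<^sup>2 * (\<psi> (snd x))\<^sup>2)"
    unfolding power_mult_distrib theta_odd_def theta_even_def gf_power2[OF fin_fibres_sq]
    by (rule gf_mult') (rule fin_fibres_sq2)+
  also have "\<dots> = gf ({m. odd m \<and> m > 0} \<times> {n. odd n}) (\<lambda>x. sq (fst x) + sq (snd x))
      (\<lambda>x. \<kappa> (fst x) * \<chi> (snd x))"
  proof (rule gf_reindex[where h=h])
    show "bij_betw h ({a::int. odd a} \<times> {b::int. even b}) ({m. odd m \<and> m > 0} \<times> {n. odd n})"
    proof (rule bij_betwI[where g=g])
      show "h \<in> {a::int. odd a} \<times> {b::int. even b} \<rightarrow> {m. odd m \<and> m > 0} \<times> {n. odd n}"
        by (auto simp: h_def)
      show "g \<in> {m. odd m \<and> m > 0} \<times> {n. odd n} \<rightarrow> {a::int. odd a} \<times> {b::int. even b}"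
        unfolding g_def by (auto split: if_splits) presburger+
      show "g (h x) = x" if x: "x \<in> {a::int. odd a} \<times> {b::int. even b}" for x
      proof -
        obtain a b where ab: "x = (a, b)" "odd a" "even b" using x by auto
        have "4 dvd 2 * b" "\<not> 4 dvd 2 * a" using ab by presburger+
        then show ?thesis by (cases "a - b \<ge> 0") (auto simp: ab g_def h_def abs_if)
      qed
      show "h (g y) = y" if y: "y \<in> {m. odd m \<and> m > 0} \<times> {n. odd n}" for y
      proof -
        obtain m n where mn: "y = (m, n)" "odd m" "odd n" "m > 0" using y by auto
        have "(n + m) div 2 - (n - m) div 2 = m" "(n + m) div 2 + (n - m) div 2 = n"
          using mn half_sum_diff[of n m] by simp_all
        then show ?thesis using mn(4) by (auto simp: mn(1) g_def h_def abs_if)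
      qed
    qed
  next
    fix x assume x: "x \<in> {a::int. odd a} \<times> {b::int. even b}"
    have "int (sq (fst (h x)) + sq (snd (h x))) = int (2 * sq (fst x) + 2 * sq (snd x))"
      by (simp add: h_def power2_eq_square algebra_simps)
    then show "sq (fst (h x)) + sq (snd (h x)) = 2 * sq (fst x) + 2 * sq (snd x)"
      by (simp only: of_nat_eq_iff)
    have "\<kappa> \<bar>m\<bar> = \<kappa> m" for m using even by (simp add: abs_if)
    then show "\<kappa> (fst (h x)) * \<chi> (snd (h x)) = (\<psi> (fst x))\<^sup>2 * (\<psi> (snd x))\<^sup>2"
      using mult x by (auto simp: h_def mult.commute)
  qed
  also have "\<dots> = theta_pos \<kappa> * theta_odd \<chi>"
    unfolding theta_pos_def theta_odd_def by (rule gf_mult'[symmetric]) (rule fin_fibres_sq)+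
  finally show ?thesis by simp
qed

text \<open>Two applications of Frobenius to the sum over all integers: the exponents 4 m^2 = (2
  m)^2 are the even squares.\<close>

lemma theta_even_doubling:
  fixes \<psi> \<chi> :: "int \<Rightarrow> 'a::char_two"
  assumes "\<And>m. \<chi> (2 * m) = \<psi> m ^ 4"
  shows "theta_even \<chi> = (theta_odd \<psi> + theta_even \<psi>) ^ 4"
proof -
  have "theta_odd \<psi> + theta_even \<psi> = gf ({n. odd n} \<union> {n. even n}) sq \<psi>"
    unfolding theta_odd_def theta_even_def
    by (rule gf_Un[symmetric]) (use fin_fibres_sq in auto)
  also have "{n::int. odd n} \<union> {n. even n} = UNIV" by auto
  finally have "(theta_odd \<psi> + theta_even \<psi>) ^ 4 = ((gf UNIV sq \<psi>)\<^sup>2)\<^sup>2"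
    by (simp flip: power_mult)
  also have "\<dots> = gf UNIV (\<lambda>s. 2 * (2 * sq s)) (\<lambda>s. ((\<psi> s)\<^sup>2)\<^sup>2)"
    by (simp only: gf_power2 fin_fibres_sq fin_fibres_sq2)
  also have "\<dots> = gf {n. even n} sq \<chi>"
  proof (rule gf_reindex[where h="\<lambda>m. 2 * m"])
    show "bij_betw ((*) 2) UNIV {n::int. even n}"
      by (rule bij_betwI[where g="\<lambda>n. n div 2"]) auto
    fix m :: int
    show "sq (2 * m) = 2 * (2 * sq m)"
      by (simp add: sq_def power_mult_distrib nat_mult_distrib)
    show "\<chi> (2 * m) = ((\<psi> m)\<^sup>2)\<^sup>2" by (simp add: assms flip: power_mult)
  qed
  finally show ?thesis by (simp add: theta_even_def)
qed

text \<open>A Riemann-type relation from the substitution (a + b, a - b), which maps all pairs (a,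
  b) onto the pairs of equal parity: odd pairs come from a, b of opposite parity, even pairs from a,
  b of the same parity.\<close>

lemma theta_addition:
  fixes \<phi> \<psi> \<chi> \<xi> :: "int \<Rightarrow> 'a::char_two"
  assumes mult: "\<And>a b. \<chi> (a + b) * \<xi> (a - b) = (\<phi> a)\<^sup>2 * (\<psi> b)\<^sup>2"
  shows "theta_odd \<chi> * theta_odd \<xi>
      = (theta_odd \<phi> * theta_even \<psi> + theta_even \<phi> * theta_odd \<psi>)\<^sup>2" (is ?odd)
    and "theta_even \<chi> * theta_even \<xi>
      = (theta_odd \<phi> * theta_odd \<psi> + theta_even \<phi> * theta_even \<psi>)\<^sup>2" (is ?even)
proof -
  let ?d = "\<lambda>x. 2 * sq (fst x) + 2 * sq (snd x)" and ?w = "\<lambda>x. (\<phi> (fst x))\<^sup>2 * (\<psi> (snd x))\<^sup>2"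
  have fin: "fin_fibres S ?d" for S
    by (rule fin_fibres_subset[of UNIV])
       (use fin_fibres_Times'[OF fin_fibres_sq2[of UNIV] fin_fibres_sq2[of UNIV]] in auto)
  have prod: "(gf S sq \<phi> * gf T sq \<psi>)\<^sup>2 = gf (S \<times> T) ?d ?w" for S T
    unfolding power_mult_distrib gf_power2[OF fin_fibres_sq]
    by (rule gf_mult') (rule fin_fibres_sq2)+
  have split: "gf (S \<times> T) (\<lambda>x. sq (fst x) + sq (snd x)) (\<lambda>x. \<chi> (fst x) * \<xi> (snd x))
      = gf {x. fst x + snd x \<in> S \<and> fst x - snd x \<in> T} ?d ?w"
    if "\<And>m n. m \<in> S \<Longrightarrow> n \<in> T \<Longrightarrow> even (m + n)" for S T
  proof (rule gf_reindex[where h="\<lambda>y. ((fst y + snd y) div 2, (fst y - snd y) div 2)"])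
    show "bij_betw (\<lambda>y. ((fst y + snd y) div 2, (fst y - snd y) div 2)) (S \<times> T)
        {x. fst x + snd x \<in> S \<and> fst x - snd x \<in> T}"
    proof (rule bij_betwI[where g="\<lambda>x. (fst x + snd x, fst x - snd x)"], goal_cases)
      case 1
      show ?case using that by (auto simp: half_sum_diff)
    next
      case (3 x)
      then show ?case using that by (auto simp: half_sum_diff)
    qed auto
    fix x assume x: "x \<in> S \<times> T"
    define a where "a = (fst x + snd x) div 2"
    define b where "b = (fst x - snd x) div 2"
    have "even (fst x + snd x)" using x that by auto
    then have ab: "fst x = a + b" "snd x = a - b" unfolding a_def b_def by (simp_all add: half_sum_diff)
    have "int (?d (a, b)) = int (sq (fst x) + sq (snd x))"
      unfolding ab by (simp add: power2_eq_square algebra_simps)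
    then show "?d ((fst x + snd x) div 2, (fst x - snd x) div 2) = sq (fst x) + sq (snd x)"
      by (simp only: of_nat_eq_iff flip: a_def b_def)
    show "?w ((fst x + snd x) div 2, (fst x - snd x) div 2) = \<chi> (fst x) * \<xi> (snd x)"
      using mult[of a b] by (simp flip: a_def b_def add: ab)
  qed
  have "theta_odd \<chi> * theta_odd \<xi> = gf {x. fst x + snd x \<in> {n. odd n} \<and> fst x - snd x \<in> {n. odd n}} ?d ?w"
    unfolding theta_odd_def gf_mult'[OF fin_fibres_sq fin_fibres_sq] by (rule split) auto
  also have "{x. fst x + snd x \<in> {n::int. odd n} \<and> fst x - snd x \<in> {n. odd n}}
      = {n. odd n} \<times> {n. even n} \<union> {n. even n} \<times> {n. odd n}" by auto
  also have "gf \<dots> ?d ?w = gf ({n. odd n} \<times> {n. even n}) ?d ?w + gf ({n. even n} \<times> {n. odd n}) ?d ?w"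
    by (rule gf_Un[OF fin fin]) auto
  finally show ?odd
    by (simp only: power2_add_char_two prod theta_odd_def theta_even_def)
  have "theta_even \<chi> * theta_even \<xi> = gf {x. fst x + snd x \<in> {n. even n} \<and> fst x - snd x \<in> {n. even n}} ?d ?w"
    unfolding theta_even_def gf_mult'[OF fin_fibres_sq fin_fibres_sq] by (rule split) auto
  also have "{x. fst x + snd x \<in> {n::int. even n} \<and> fst x - snd x \<in> {n. even n}}
      = {n. odd n} \<times> {n. odd n} \<union> {n. even n} \<times> {n. even n}" by auto
  also have "gf \<dots> ?d ?w = gf ({n. odd n} \<times> {n. odd n}) ?d ?w + gf ({n. even n} \<times> {n. even n}) ?d ?w"
    by (rule gf_Un[OF fin fin]) auto
  finally show ?even
    by (simp only: power2_add_char_two prod theta_odd_def theta_even_def)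
qed

lemma theta_minus:
  "theta_odd (\<lambda>n. \<psi> (- n)) = theta_odd \<psi>" "theta_even (\<lambda>n. \<psi> (- n)) = theta_even \<psi>"
  unfolding theta_odd_def theta_even_def
  by (rule gf_reindex[where h=uminus]; (rule bij_betwI[where g=uminus])?; auto)+

section \<open>The Lambert series of F B / A and its additivity under isogenies\<close>

definition dsum :: "'a::field \<Rightarrow> int \<Rightarrow> 'a" where
  "dsum \<omega> n = \<omega> powi n + \<omega> powi (- n)"

lemma dsum_minus [simp]: "dsum \<omega> (- n) = dsum \<omega> n"
  by (simp add: dsum_def add.commute)

lemma dsum_0: "dsum \<omega> 0 = (0::'a::{field,char_two})"
  by (simp add: dsum_def del: one_add_one)

lemma dsum_mult:
  "\<omega> \<noteq> 0 \<Longrightarrow> dsum \<omega> m * dsum \<omega> n = dsum \<omega> (m + n) + dsum \<omega> (m - n)"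
  by (simp add: dsum_def algebra_simps flip: power_int_add)

text \<open>In characteristic 2 \<open>dsum \<omega> n\<close> is also a difference, so the quotient
  is a geometric sum over the even exponents from -(n - 1) to n - 1, with opposite exponents
  paired.\<close>

lemma dsum_quotient:
  fixes \<omega> :: "'a::{field,char_two}"
  assumes w: "\<omega> \<noteq> 0" "dsum \<omega> 1 \<noteq> 0" and n: "odd n" "n > 0"
  shows "dsum \<omega> n / dsum \<omega> 1 + (\<Sum>m | m > 0 \<and> 2 * m < n. dsum \<omega> (2 * m)) = 1"
proof -
  have "dsum \<omega> (2 * int k + 1) + (\<Sum>m | m > 0 \<and> 2 * m < 2 * int k + 1. dsum \<omega> (2 * m)) * dsum \<omega> 1
      = dsum \<omega> 1" for k
  proof (induction k)
    case 0
    have *: "{m. m > 0 \<and> 2 * m < 2 * int 0 + 1} = {}" by auto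
    show ?case unfolding * by simp
  next
    case (Suc k)
    have fin: "finite {m::int. m > 0 \<and> 2 * m < 2 * int k + 1}"
      by (rule finite_subset[of _ "{0..int k}"]) auto
    have "{m. m > 0 \<and> 2 * m < 2 * int (Suc k) + 1} = insert (int k + 1) {m. m > 0 \<and> 2 * m < 2 * int k + 1}"
      by auto
    then have A: "(\<Sum>m | m > 0 \<and> 2 * m < 2 * int (Suc k) + 1. dsum \<omega> (2 * m))
       = dsum \<omega> (2 * int k + 2) + (\<Sum>m | m > 0 \<and> 2 * m < 2 * int k + 1. dsum \<omega> (2 * m))"
      using fin by simp
    have B: "dsum \<omega> (2 * int k + 2) * dsum \<omega> 1 = dsum \<omega> (2 * int k + 3) + dsum \<omega> (2 * int k + 1)"
      using dsum_mult[OF w(1), of "2 * int k + 2" 1] by (simp add: add.commute)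
    have "2 * int (Suc k) + 1 = 2 * int k + 3" by simp
    then show ?case unfolding A distrib_right B
      using Suc by (simp only: add.assoc add_self_left_char_two)
  qed
  from this[of "nat ((n - 1) div 2)"] have
    "dsum \<omega> n + (\<Sum>m | m > 0 \<and> 2 * m < n. dsum \<omega> (2 * m)) * dsum \<omega> 1 = dsum \<omega> 1"
    using n by (auto elim!: oddE)
  then show ?thesis using w(2) by (simp add: field_simps)
qed

text \<open>The expansion of F B(\<open>\<omega>\<close>) / A(\<open>\<omega>\<close>). Apart from
  its constant it is linear in the values \<open>dsum \<omega> k\<close>, so sums over translates by
  roots of unity can be evaluated termwise.\<close>

definition lambert :: "'a::field \<Rightarrow> 'a fps" where
  "lambert \<omega> = fps_const (inverse (dsum \<omega> 1))
    + gf ({n::int. n > 0} \<times> {k. odd k \<and> k > 0}) (\<lambda>x. nat (4 * (fst x * snd x))) (\<lambda>x. dsum \<omega> (snd x))"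

lemma theta_odd_powi:
  fixes \<omega> :: "'a::field"
  shows "theta_odd ((powi) \<omega>) = theta_pos (dsum \<omega>)"
proof -
  have *: "{n::int. odd n} = {n. odd n \<and> n > 0} \<union> {n. odd n \<and> n < 0}"
    by (auto simp: not_less order_le_less)
  have "theta_odd ((powi) \<omega>) = gf {n. odd n \<and> n > 0} sq ((powi) \<omega>) + gf {n. odd n \<and> n < 0} sq ((powi) \<omega>)"
    unfolding theta_odd_def * by (intro gf_Un fin_fibres_sq) auto
  also have "gf {n. odd n \<and> n < 0} sq ((powi) \<omega>) = gf {n. odd n \<and> n > 0} sq (\<lambda>n. \<omega> powi (- n))"
    by (rule gf_reindex[where h=uminus], rule bij_betwI[where g=uminus]) auto
  finally show ?thesis
    unfolding theta_pos_def gf_add[symmetric] by (simp only: dsum_def[abs_def])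
qed

lemma theta_even_powi:
  fixes \<omega> :: "'a::field"
  shows "theta_even ((powi) \<omega>) = 1 + gf {n. even n \<and> n > 0} sq (dsum \<omega>)"
proof -
  have *: "{n::int. even n} = {0} \<union> ({n. even n \<and> n > 0} \<union> {n. even n \<and> n < 0})"
    by auto
  have "theta_even ((powi) \<omega>)
    = gf {0} sq ((powi) \<omega>) + gf ({n. even n \<and> n > 0} \<union> {n. even n \<and> n < 0}) sq ((powi) \<omega>)"
    unfolding theta_even_def * by (intro gf_Un fin_fibres_sq) auto
  also have "gf ({n. even n \<and> n > 0} \<union> {n. even n \<and> n < 0}) sq ((powi) \<omega>)
      = gf {n. even n \<and> n > 0} sq ((powi) \<omega>) + gf {n. even n \<and> n < 0} sq ((powi) \<omega>)"
    by (intro gf_Un fin_fibres_sq) auto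
  also have "gf {n. even n \<and> n < 0} sq ((powi) \<omega>) = gf {n. even n \<and> n > 0} sq (\<lambda>n. \<omega> powi (- n))"
    by (rule gf_reindex[where h=uminus], rule bij_betwI[where g=uminus]) auto
  also have "gf {0} sq ((powi) \<omega>) = 1"
  proof (rule fps_ext)
    fix N
    have "{s. s = 0 \<and> sq s = N} = (if N = 0 then {0} else {})" by (auto simp: sq_def)
    then show "gf {0} sq ((powi) \<omega>) $ N = 1 $ N" by (simp add: gf_nth)
  qed
  finally show ?thesis
    unfolding gf_add[symmetric] by (simp only: dsum_def[abs_def])
qed

lemma fps_const_mult_gf: "fps_const c * gf S d w = gf S d (\<lambda>s. c * w s)"
  by (rule fps_ext) (simp add: gf_nth sum_distrib_left)

lemma fin_fibres_nat_image:
  assumes "\<And>N. finite {s \<in> S. f s \<le> int N}" shows "fin_fibres S (\<lambda>s. nat (f s))"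
  unfolding fin_fibres_def
proof
  fix N
  have "{s \<in> S. nat (f s) = N} \<subseteq> {s \<in> S. f s \<le> int N}" by auto
  then show "finite {s \<in> S. nat (f s) = N}" using assms finite_subset by blast
qed

lemma fin_fibres_lambert:
  "fin_fibres ({n::int. n > 0} \<times> {k. odd k \<and> k > 0}) (\<lambda>x. nat (4 * (fst x * snd x)))"
proof (rule fin_fibres_nat_image)
  fix N
  have *: "n \<le> int N \<and> k \<le> int N" if "4 * (n * k) \<le> int N" "n > 0" "k > 0" for n k
  proof -
    have 1: "n * 1 \<le> n * k" using that by (intro mult_left_mono) auto
    have 2: "1 * k \<le> n * k" using that by (intro mult_right_mono) auto
    show ?thesis using 1 2 that(1) by linarith
  qed
  have "{x \<in> {n::int. n > 0} \<times> {k. odd k \<and> k > 0}. 4 * (fst x * snd x) \<le> int N}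
      \<subseteq> {0..int N} \<times> {0..int N}"
  proof
    fix x assume "x \<in> {x \<in> {n::int. n > 0} \<times> {k. odd k \<and> k > 0}. 4 * (fst x * snd x) \<le> int N}"
    then have "4 * (fst x * snd x) \<le> int N" "fst x > 0" "snd x > 0" by auto
    from *[OF this] this(2,3) show "x \<in> {0..int N} \<times> {0..int N}" by (simp add: mem_Times_iff)
  qed
  then show "finite {x \<in> {n::int. n > 0} \<times> {k. odd k \<and> k > 0}. 4 * (fst x * snd x) \<le> int N}"
    by (rule finite_subset) simp
qed

text \<open>
  Comparing coefficients of \<open>x^N\<close>, the triples \<open>l^2 + 4 n k = N\<close> on the right are rewritten as
  \<open>4 m^2 + u v = N\<close> with \<open>2 m = k + l\<close>, \<open>u = k\<close> and \<open>v = k + 4 (n - m)\<close>. Adding the terms for \<open>m\<close> and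
  \<open>- m\<close> leaves the range \<open>u - 4 m < v \<le> u + 4 m\<close>; there \<open>(u, v)\<close> cancels against \<open>(v, u)\<close> or
  \<open>(- v, - u)\<close>, except for \<open>u = v\<close> and the boundary \<open>v = u + 4 m\<close>.
\<close>

lemma lambert_theta:
  fixes \<omega> :: "'a::{field,char_two}"
  assumes w: "\<omega> \<noteq> 0" "dsum \<omega> 1 \<noteq> 0"
  shows "theta_one * theta_even ((powi) \<omega>) = theta_odd ((powi) \<omega>) * lambert \<omega>"
proof -
  let ?O = "{n::int. odd n}" and ?P = "{n::int. n > 0}" and ?OP = "{k::int. odd k \<and> k > 0}"
  let ?T = "?O \<times> (?P \<times> ?OP)"
  let ?d = "\<lambda>x::int \<times> int \<times> int. sq (fst x) + nat (4 * (fst (snd x) * snd (snd x)))"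
  \<comment> \<open>The last inequality is the old condition n > 0, since v + 4 m - u = 4 n.\<close>
  define T2 where "T2 = {(m::int, u::int, v::int). odd u \<and> u > 0 \<and> 4 dvd v - u \<and> v + 4 * m > u}"
  define e :: "int \<times> int \<times> int \<Rightarrow> nat"
    where "e x = nat (4 * (fst x)\<^sup>2 + fst (snd x) * snd (snd x))" for x
  define w where "w x = dsum \<omega> (2 * fst x)" for x :: "int \<times> int \<times> int"
  define Q where "Q = {(m::int, u::int, v::int). m > 0 \<and> odd u \<and> u > 0 \<and> 4 dvd v - u \<and> \<bar>v - u\<bar> < 4 * m}"
  define Q' where "Q' = {(m::int, u::int, v::int). m > 0 \<and> odd u \<and> u > 0 \<and> v = u + 4 * m}"
  define N where "N = {(m::int, u::int, v::int). m > 0 \<and> odd u \<and> u > 0 \<and> 4 dvd v - u \<and> v > u + 4 * m}"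
  define N' where "N' = {(m::int, u::int, v::int). m < 0 \<and> odd u \<and> u > 0 \<and> 4 dvd v - u \<and> v + 4 * m > u}"
  have fT: "fin_fibres ?T ?d"
    by (rule fin_fibres_Times'[OF fin_fibres_sq fin_fibres_lambert])
  define h :: "int \<times> int \<times> int \<Rightarrow> int \<times> int \<times> int"
    where "h x = ((snd (snd x) + fst x) div 2, snd (snd x),
      snd (snd x) + 4 * (fst (snd x) - (snd (snd x) + fst x) div 2))" for x
  have hb: "bij_betw h ?T T2"
  proof (rule bij_betwI[where g="\<lambda>x. (2 * fst x - fst (snd x), fst x + (snd (snd x) - fst (snd x)) div 4, fst (snd x))"])
    show "h \<in> ?T \<rightarrow> T2" by (auto simp: h_def T2_def)
    show "(\<lambda>x. (2 * fst x - fst (snd x), fst x + (snd (snd x) - fst (snd x)) div 4, fst (snd x))) \<in> T2 \<rightarrow> ?T"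
      by (auto simp: T2_def)
    show "(2 * fst (h x) - fst (snd (h x)), fst (h x) + (snd (snd (h x)) - fst (snd (h x))) div 4, fst (snd (h x))) = x"
      if "x \<in> ?T" for x
      using that by (auto simp: h_def elim!: oddE)
    show "h (2 * fst x - fst (snd x), fst x + (snd (snd x) - fst (snd x)) div 4, fst (snd x)) = x"
      if "x \<in> T2" for x
      using that by (auto simp: h_def T2_def)
  qed
  have he: "e (h x) = ?d x" and hpos: "0 \<le> 4 * (fst (h x))\<^sup>2 + fst (snd (h x)) * snd (snd (h x))"
    and hw: "w (h x) = dsum \<omega> (fst x + snd (snd x))" if x: "x \<in> ?T" for x
  proof -
    obtain l n k where lnk: "x = (l, n, k)" "odd l" "n > 0" "odd k" "k > 0" using x by auto
    obtain m where "k + l = 2 * m" using lnk by (metis even_add evenE)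
    then have l: "l = 2 * m - k" by simp
    have hx: "h (l, n, k) = (m, k, k + 4 * (n - m))" by (simp add: h_def l)
    have *: "4 * m\<^sup>2 + k * (k + 4 * (n - m)) = l\<^sup>2 + 4 * (n * k)"
      by (simp add: l power2_eq_square algebra_simps)
    have nn: "0 \<le> l\<^sup>2" "0 \<le> 4 * (n * k)" using lnk by simp_all
    show "e (h x) = ?d x"
      unfolding e_def lnk(1) hx fst_conv snd_conv * sq_def using nn by (simp add: nat_add_distrib)
    show "0 \<le> 4 * (fst (h x))\<^sup>2 + fst (snd (h x)) * snd (snd (h x))"
      unfolding lnk(1) hx fst_conv snd_conv * using nn by simp
    show "w (h x) = dsum \<omega> (fst x + snd (snd x))"
      unfolding lnk(1) hx w_def by (simp add: l)
  qed
  have pos: "0 \<le> 4 * (fst y)\<^sup>2 + fst (snd y) * snd (snd y)" if "y \<in> T2" for y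
    using that hb hpos unfolding bij_betw_def by blast
  have fT2: "fin_fibres T2 e"
    unfolding fin_fibres_def
  proof
    fix N
    have "{y \<in> T2. e y = N} = h ` {x \<in> ?T. ?d x = N}"
      using hb he unfolding bij_betw_def by auto
    then show "finite {y \<in> T2. e y = N}" using fin_fibresD[OF fT] by simp
  qed
  have sub: "Q \<subseteq> T2" "Q' \<subseteq> T2" "N \<subseteq> T2" "N' \<subseteq> T2"
    by (auto simp: Q_def Q'_def N_def N'_def T2_def)
  note fin = sub[THEN fin_fibres_subset[OF fT2]]

  have "theta_odd ((powi) \<omega>) * gf (?P \<times> ?OP) (\<lambda>x. nat (4 * (fst x * snd x))) (\<lambda>x. dsum \<omega> (snd x))
      = gf ?T ?d (\<lambda>x. \<omega> powi (fst x) * dsum \<omega> (snd (snd x)))"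
    unfolding theta_odd_def by (rule gf_mult'[OF fin_fibres_sq fin_fibres_lambert])
  also have "\<dots> = gf ?T ?d (\<lambda>x. \<omega> powi (fst x + snd (snd x)) + \<omega> powi (fst x - snd (snd x)))"
    using w(1) by (intro gf_cong) (auto simp: dsum_def distrib_left simp flip: power_int_add)
  also have "\<dots> = gf ?T ?d (\<lambda>x. \<omega> powi (fst x + snd (snd x))) + gf ?T ?d (\<lambda>x. \<omega> powi (fst x - snd (snd x)))"
    by (rule gf_add)
  \<comment> \<open>Changing the sign of l makes the two exponents opposite, so that together they
    form \<open>dsum \<omega> (l + k)\<close>.\<close>
  also have "gf ?T ?d (\<lambda>x. \<omega> powi (fst x - snd (snd x))) = gf ?T ?d (\<lambda>x. \<omega> powi (- (fst x + snd (snd x))))"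
  proof (rule gf_reindex[where h="\<lambda>x. (- fst x, snd x)"])
    show "bij_betw (\<lambda>x. (- fst x, snd x)) ?T ?T"
      by (rule bij_betwI[where g="\<lambda>x. (- fst x, snd x)"]) auto
  qed auto
  also have "gf ?T ?d (\<lambda>x. \<omega> powi (fst x + snd (snd x))) + \<dots> = gf ?T ?d (\<lambda>x. dsum \<omega> (fst x + snd (snd x)))"
    by (simp only: dsum_def gf_add)
  also have "\<dots> = gf T2 e w"
    by (rule gf_reindex[OF hb]) (use he hw in auto)
  also have "\<dots> = gf {x \<in> T2. fst x \<noteq> 0} e w"
    by (rule gf_restrict[OF fT2]) (simp add: w_def dsum_0)
  also have "{x \<in> T2. fst x \<noteq> 0} = (Q \<union> (Q' \<union> N)) \<union> N'"
    by (auto simp: Q_def Q'_def N_def N'_def T2_def)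
  also have "gf \<dots> e w = gf (Q \<union> (Q' \<union> N)) e w + gf N' e w"
    by (intro gf_Un fin_fibres_subset[OF fT2] Un_least sub) (auto simp: Q_def Q'_def N_def N'_def)
  also have "gf (Q \<union> (Q' \<union> N)) e w = gf Q e w + gf (Q' \<union> N) e w"
    by (intro gf_Un fin_fibres_subset[OF fT2] Un_least sub) (auto simp: Q_def Q'_def N_def N'_def)
  also have "gf (Q' \<union> N) e w = gf Q' e w + gf N e w"
    by (intro gf_Un fin_fibres_subset[OF fT2] Un_least sub) (auto simp: Q_def Q'_def N_def N'_def)
  also have "gf N' e w = gf N e w"
  proof (rule gf_reindex[where h="\<lambda>x. (- fst x, snd x)"])
    show "bij_betw (\<lambda>x. (- fst x, snd x)) N' N"
      by (rule bij_betwI[where g="\<lambda>x. (- fst x, snd x)"]) (auto simp: N_def N'_def)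
  qed (auto simp: e_def w_def)
  also have "gf Q e w + (gf Q' e w + gf N e w) + gf N e w = gf Q e w + gf Q' e w"
    by (simp add: add.assoc)
  also have "gf Q e w = gf (?OP \<times> {m. m > 0}) (\<lambda>x. sq (fst x) + sq (2 * snd x)) (\<lambda>x. dsum \<omega> (2 * snd x))"
  proof -
    \<comment> \<open>Both swaps keep u v, hence the degree, and keep u positive. A fixed point has
      v = u, because v = - u would make v - u = - 2 u divisible by 4 although u is odd.\<close>
    define \<phi> :: "int \<times> int \<times> int \<Rightarrow> int \<times> int \<times> int"
      where "\<phi> x = (if snd (snd x) > 0 then (fst x, snd (snd x), fst (snd x))
                   else (fst x, - snd (snd x), - fst (snd x)))" for x
    have "gf Q e w = gf {x \<in> Q. \<phi> x = x} e w"
    proof (rule gf_involution[OF fin(1)])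
      fix x assume "x \<in> Q"
      then obtain m u v where x: "x = (m, u, v)" "m > 0" "odd u" "u > 0" "4 dvd v - u" "\<bar>v - u\<bar> < 4 * m"
        by (auto simp: Q_def)
      have "odd v" "4 dvd u - v" using x by presburger+
      moreover from this have "v \<noteq> 0" by auto
      ultimately show "\<phi> x \<in> Q" "\<phi> (\<phi> x) = x" "e (\<phi> x) = e x" "w (\<phi> x) = w x"
        using x(2-) by (auto simp: x(1) \<phi>_def Q_def e_def w_def mult.commute)
    qed
    also have "\<dots> = gf (?OP \<times> {m. m > 0}) (\<lambda>x. sq (fst x) + sq (2 * snd x)) (\<lambda>x. dsum \<omega> (2 * snd x))"
    proof (rule gf_reindex[where h="\<lambda>x. (fst (snd x), fst x)"])
      have "\<not> 4 dvd v - u" if "v = - u" "odd u" for u v :: int using that by presburger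
      then have eq: "{x \<in> Q. \<phi> x = x} = {(m, u, v). m > 0 \<and> odd u \<and> u > 0 \<and> v = u}"
        unfolding Q_def \<phi>_def by (auto split: if_splits)
      show "bij_betw (\<lambda>x. (fst (snd x), fst x)) {x \<in> Q. \<phi> x = x} (?OP \<times> {m. m > 0})"
        unfolding eq by (rule bij_betwI[where g="\<lambda>x. (snd x, fst x, fst x)"]) auto
      fix x assume "x \<in> {x \<in> Q. \<phi> x = x}"
      then obtain m u where x: "x = (m, u, u)" unfolding eq by auto
      have "int (e x) = int (sq (fst (fst (snd x), fst x)) + sq (2 * snd (fst (snd x), fst x)))"
        unfolding x e_def by (simp add: power2_eq_square)
      then show "sq (fst (fst (snd x), fst x)) + sq (2 * snd (fst (snd x), fst x)) = e x"
        by (simp only: of_nat_eq_iff)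
    qed (simp add: w_def)
    finally show ?thesis .
  qed
  \<comment> \<open>On the boundary 4 m^2 + u (u + 4 m) = (u + 2 m)^2 is an odd square. These terms
    are exactly what \<open>dsum_quotient\<close> needs to complete the constant part of
    \<open>lambert \<omega>\<close> to F.\<close>
  also have "gf Q' e w = gf (Sigma ?OP (\<lambda>n. {m. m > 0 \<and> 2 * m < n})) (\<lambda>x. sq (fst x)) (\<lambda>x. dsum \<omega> (2 * snd x))"
  proof (rule gf_reindex[where h="\<lambda>x. (2 * fst x + fst (snd x), fst x)"])
    show "bij_betw (\<lambda>x. (2 * fst x + fst (snd x), fst x)) Q' (Sigma ?OP (\<lambda>n. {m. m > 0 \<and> 2 * m < n}))"
      by (rule bij_betwI[where g="\<lambda>x. (snd x, fst x - 2 * snd x, fst x + 2 * snd x)"]) (auto simp: Q'_def)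
    fix x assume "x \<in> Q'"
    then obtain m u where x: "x = (m, u, u + 4 * m)" by (auto simp: Q'_def)
    show "sq (fst (2 * fst x + fst (snd x), fst x)) = e x"
      unfolding x e_def sq_def by (simp add: power2_eq_square algebra_simps)
  qed (simp add: w_def)
  also have "\<dots> = gf ?OP sq (\<lambda>n. \<Sum>m | m > 0 \<and> 2 * m < n. dsum \<omega> (2 * m))"
  proof (subst gf_fibre[OF fin_fibres_sq])
    show "finite {m::int. m > 0 \<and> 2 * m < n}" for n
      by (rule finite_subset[of _ "{0..n}"]) auto
  qed simp
  finally have 1: "theta_odd ((powi) \<omega>) * gf (?P \<times> ?OP) (\<lambda>x. nat (4 * (fst x * snd x))) (\<lambda>x. dsum \<omega> (snd x))
    = gf (?OP \<times> {m. m > 0}) (\<lambda>x. sq (fst x) + sq (2 * snd x)) (\<lambda>x. dsum \<omega> (2 * snd x))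
      + gf ?OP sq (\<lambda>n. \<Sum>m | m > 0 \<and> 2 * m < n. dsum \<omega> (2 * m))" .
  have 2: "theta_odd ((powi) \<omega>) * fps_const (inverse (dsum \<omega> 1)) = gf ?OP sq (\<lambda>n. dsum \<omega> n / dsum \<omega> 1)"
    unfolding theta_odd_powi theta_pos_def mult.commute[of _ "fps_const _"] fps_const_mult_gf
    by (simp only: divide_inverse mult.commute)
  have 3: "gf ?OP sq (\<lambda>n. dsum \<omega> n / dsum \<omega> 1) + gf ?OP sq (\<lambda>n. \<Sum>m | m > 0 \<and> 2 * m < n. dsum \<omega> (2 * m))
      = theta_one"
    unfolding theta_pos_def gf_add[symmetric]
    by (rule gf_cong) (use dsum_quotient[OF w] in auto)
  have "theta_odd ((powi) \<omega>) * lambert \<omega> = theta_one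
      + gf (?OP \<times> {m. m > 0}) (\<lambda>x. sq (fst x) + sq (2 * snd x)) (\<lambda>x. dsum \<omega> (2 * snd x))"
    unfolding lambert_def distrib_left 1 2 3[symmetric] by (rule add.left_commute[THEN trans]) (rule add.commute)
  moreover have "theta_one * gf {n::int. even n \<and> n > 0} sq (dsum \<omega>)
      = gf (?OP \<times> {m. m > 0}) (\<lambda>x. sq (fst x) + sq (2 * snd x)) (\<lambda>x. dsum \<omega> (2 * snd x))"
    unfolding theta_pos_def gf_mult'[OF fin_fibres_sq fin_fibres_sq]
  proof (rule gf_reindex[where h="\<lambda>x. (fst x, snd x div 2)"])
    show "bij_betw (\<lambda>x. (fst x, snd x div 2)) (?OP \<times> {n::int. even n \<and> n > 0}) (?OP \<times> {m. m > 0})"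
      by (rule bij_betwI[where g="\<lambda>x. (fst x, 2 * snd x)"]) auto
  qed auto
  ultimately show ?thesis
    unfolding theta_even_powi distrib_left by simp
qed


lemma powi_eq_1_coprime:
  fixes \<zeta> :: "'a::field"
  assumes "\<zeta> powi m = 1" "\<zeta> powi n = 1" "coprime m n"
  shows "\<zeta> = 1"
proof (cases "\<zeta> = 0")
  case True
  then have "m = 0" "n = 0" using assms by (auto simp: power_int_0_left_if split: if_splits)
  then show ?thesis using assms(3) by simp
next
  case False
  obtain u v where "u * m + v * n = 1"
    using assms(3) bezout_int[of m n] by auto
  then have "\<zeta> = \<zeta> powi (m * u + n * v)" by (simp add: mult.commute)
  also have "\<dots> = 1" using False assms by (simp add: power_int_add power_int_mult)
  finally show ?thesis .
qed

text \<open>Orthogonality of characters; since p is odd, the p equal terms add up to 1 in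
  characteristic 2 and no division by p is needed.\<close>

lemma sum_roots_of_unity_powi:
  fixes \<zeta> :: "'a::{field,char_two}"
  assumes p: "prime p" "odd p" and \<zeta>: "\<zeta> ^ p = 1" "\<zeta> \<noteq> 1"
  shows "(\<Sum>i<p. (\<zeta> ^ i) powi k) = (if int p dvd k then 1 else 0)"
proof -
  have pi: "\<zeta> powi int p = 1" using \<zeta> by simp
  have eq: "(\<zeta> ^ i) powi k = (\<zeta> powi k) ^ i" for i
    by (simp add: mult.commute flip: power_int_of_nat power_int_mult)
  show ?thesis
  proof (cases "int p dvd k")
    case True
    then obtain j where "k = int p * j" by auto
    then have "\<zeta> powi k = 1" using pi by (simp only: power_int_mult power_int_1_left)
    then show ?thesis using True p by (simp add: eq of_nat_odd_char_two)
  next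
    case False
    then have "coprime (int p) k" using p(1) by (simp add: prime_imp_coprime)
    then have "\<zeta> powi k \<noteq> 1" using powi_eq_1_coprime[OF pi _ ] \<zeta>(2) by blast
    moreover have "(\<zeta> powi k) ^ p = 1" using \<zeta>(1) by (simp flip: eq)
    ultimately show ?thesis using False by (simp add: eq sum_gp_strict)
  qed
qed

lemma sum_dsum_roots_of_unity:
  fixes \<zeta> :: "'a::{field,char_two}"
  assumes "prime p" "odd p" "\<zeta> ^ p = 1" "\<zeta> \<noteq> 1"
  shows "(\<Sum>i<p. dsum (\<zeta> ^ i * \<omega>) k) = (if int p dvd k then dsum \<omega> k else 0)"
  by (simp add: dsum_def power_int_mult_distrib sum.distrib sum_roots_of_unity_powi[OF assms]
      flip: sum_distrib_right)

text \<open>Summation over the translates \<open>\<zeta> ^ i * \<omega>\<close> keeps the terms with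
  k divisible by p, and k = p k' turns x^(4 n k) into x^(4 n p k') with weight
  \<open>dsum (\<omega> ^ p) k'\<close>. The constants are treated separately.\<close>

lemma lambert_sum:
  fixes \<zeta> \<omega> :: "'a::{field,char_two}"
  assumes p: "prime p" "odd p" and \<zeta>: "\<zeta> ^ p = 1" "\<zeta> \<noteq> 1" and \<omega>: "\<omega> \<noteq> 0"
    and nz: "\<And>i. dsum (\<zeta> ^ i * \<omega>) 1 \<noteq> 0" "dsum (\<omega> ^ p) 1 \<noteq> 0"
  shows "(\<Sum>i<p. lambert (\<zeta> ^ i * \<omega>)) = ev 1 p (lambert (\<omega> ^ p))"
proof -
  have p0: "p > 0" using p(1) prime_gt_0_nat by blast
  have \<zeta>0: "\<zeta> \<noteq> 0" using \<zeta>(1) p0 by (auto simp: power_0_left)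
  have dp: "dsum (\<zeta> ^ i * \<omega>) (int p) = dsum (\<omega> ^ p) 1" for i
  proof -
    have "(\<zeta> ^ i) ^ p = 1" using \<zeta>(1) by (metis power_commutes power_mult mult.commute power_one)
    then show ?thesis by (simp add: dsum_def power_mult_distrib power_int_minus)
  qed
  \<comment> \<open>The factor equals the p-th \<open>dsum\<close> of every translate, so each
    summand becomes a quotient covered by \<open>dsum_quotient\<close>. Its nonconstant terms have
    exponents 2 m with 0 < 2 m < p and vanish by orthogonality.\<close>
  have "dsum (\<omega> ^ p) 1 * (\<Sum>i<p. inverse (dsum (\<zeta> ^ i * \<omega>) 1))
      = (\<Sum>i<p. dsum (\<zeta> ^ i * \<omega>) (int p) / dsum (\<zeta> ^ i * \<omega>) 1)"
    by (simp add: dp sum_distrib_left divide_inverse)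
  also have "\<dots> = (\<Sum>i<p. 1 + (\<Sum>m | m > 0 \<and> 2 * m < int p. dsum (\<zeta> ^ i * \<omega>) (2 * m)))"
  proof (rule sum.cong)
    fix i
    have *: "x = 1 + y" if "x + y = 1" for x y :: 'a
      using that by (metis add.assoc add_self_char_two add_0_right)
    show "dsum (\<zeta> ^ i * \<omega>) (int p) / dsum (\<zeta> ^ i * \<omega>) 1
      = 1 + (\<Sum>m | m > 0 \<and> 2 * m < int p. dsum (\<zeta> ^ i * \<omega>) (2 * m))"
      by (rule *, rule dsum_quotient) (use \<zeta>0 \<omega> nz p p0 in auto)
  qed simp
  also have "\<dots> = 1 + (\<Sum>m | m > 0 \<and> 2 * m < int p. \<Sum>i<p. dsum (\<zeta> ^ i * \<omega>) (2 * m))"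
    by (simp add: sum.distrib of_nat_odd_char_two p sum.swap[of _ _ "{..<p}"])
  also have "(\<Sum>m | m > 0 \<and> 2 * m < int p. \<Sum>i<p. dsum (\<zeta> ^ i * \<omega>) (2 * m)) = 0"
  proof (rule sum.neutral, safe)
    fix m :: int assume "0 < m" "2 * m < int p"
    then have "\<not> int p dvd 2 * m" by (auto dest: zdvd_imp_le)
    then show "(\<Sum>i<p. dsum (\<zeta> ^ i * \<omega>) (2 * m)) = 0"
      using sum_dsum_roots_of_unity[OF p \<zeta>] by simp
  qed
  finally have c: "(\<Sum>i<p. inverse (dsum (\<zeta> ^ i * \<omega>) 1)) = inverse (dsum (\<omega> ^ p) 1)"
    using nz(2) by (simp add: field_simps)
  let ?S = "{n::int. n > 0} \<times> {k::int. odd k \<and> k > 0}" and ?d = "\<lambda>x::int \<times> int. nat (4 * (fst x * snd x))"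
  have "(\<Sum>i<p. gf ?S ?d (\<lambda>x. dsum (\<zeta> ^ i * \<omega>) (snd x)))
      = gf ?S ?d (\<lambda>x. if int p dvd snd x then dsum \<omega> (snd x) else 0)"
    by (simp only: gf_sum[symmetric] sum_dsum_roots_of_unity[OF p \<zeta>])
  also have "\<dots> = gf {x \<in> ?S. int p dvd snd x} ?d (\<lambda>x. if int p dvd snd x then dsum \<omega> (snd x) else 0)"
    by (rule gf_restrict[OF fin_fibres_lambert]) simp
  also have "\<dots> = gf ?S (\<lambda>x. p * ?d x) (\<lambda>x. dsum (\<omega> ^ p) (snd x))"
  proof (rule gf_reindex[symmetric, where h="\<lambda>x. (fst x, int p * snd x)"])
    show "bij_betw (\<lambda>x. (fst x, int p * snd x)) ?S {x \<in> ?S. int p dvd snd x}"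
      by (rule bij_betwI[where g="\<lambda>x. (fst x, snd x div int p)"])
         (use p p0 in \<open>auto simp: zero_less_mult_iff\<close>)
    fix x :: "int \<times> int"
    have "4 * (fst x * (int p * snd x)) = int p * (4 * (fst x * snd x))" by (simp add: mult_ac)
    then show "?d (fst x, int p * snd x) = p * ?d x"
      by (simp only: fst_conv snd_conv nat_mult_distrib of_nat_0_le_iff nat_int)
    show "(if int p dvd snd (fst x, int p * snd x) then dsum \<omega> (snd (fst x, int p * snd x)) else 0)
        = dsum (\<omega> ^ p) (snd x)"
      by (simp add: dsum_def power_int_mult flip: mult_minus_right)
  qed
  finally have g: "(\<Sum>i<p. gf ?S ?d (\<lambda>x. dsum (\<zeta> ^ i * \<omega>) (snd x))) = gf ?S (\<lambda>x. p * ?d x) (\<lambda>x. dsum (\<omega> ^ p) (snd x))" .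
  have cc: "(\<Sum>i<p. fps_const (inverse (dsum (\<zeta> ^ i * \<omega>) 1))) = fps_const (inverse (dsum (\<omega> ^ p) 1))"
    by (rule fps_ext) (simp add: fps_sum_nth c if_distrib[of "\<lambda>f. _"] cong: if_cong flip: c)
  have "ev 1 p (fps_const a) = fps_const a" for a :: 'a
    by (rule fps_ext) (use p0 in \<open>auto simp: ev_def elim!: dvdE\<close>)
  then show ?thesis
    using p0 unfolding lambert_def by (simp add: sum.distrib cc g ev_ring_hom ev_gf)
qed

section \<open>Theta series of residue classes modulo p\<close>

definition cls :: "int \<Rightarrow> 'a \<Rightarrow> int \<Rightarrow> int \<Rightarrow> 'a::comm_ring_1" where
  "cls p \<xi> c n = (if p dvd n - c then \<xi> ^ sq n else 0)"

lemma cls_cong: "p dvd c - c' \<Longrightarrow> cls p \<xi> c = cls p \<xi> c'"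
proof
  fix n assume *: "p dvd c - c'"
  have "p dvd n - c \<longleftrightarrow> p dvd n - c'"
    using dvd_add_left_iff[OF *, of "n - c"] by simp
  then show "cls p \<xi> c n = cls p \<xi> c' n" by (simp add: cls_def)
qed

lemma theta_cls_minus:
  "theta_odd (cls p \<xi> (- c)) = theta_odd (cls p \<xi> c)" "theta_even (cls p \<xi> (- c)) = theta_even (cls p \<xi> c)"
proof -
  have "p dvd - n - c \<longleftrightarrow> p dvd n + c" for n
    using dvd_minus_iff[of p "n + c"] by simp
  then have "cls p \<xi> (- c) = (\<lambda>n. cls p \<xi> c (- n))"
    by (auto simp: cls_def fun_eq_iff)
  then show "theta_odd (cls p \<xi> (- c)) = theta_odd (cls p \<xi> c)"
    "theta_even (cls p \<xi> (- c)) = theta_even (cls p \<xi> c)"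
    by (simp_all only: theta_minus)
qed

lemma dvd_double_iff: "odd (p::int) \<Longrightarrow> p dvd 2 * a \<longleftrightarrow> p dvd a"
  by (simp add: coprime_dvd_mult_right_iff)

text \<open>For odd p, a and b are both congruent to c exactly when a + b is congruent to 2 c and a
  - b to 0. So the class c behaves like a torsion point that duplication sends to 2 c, with the
  multiples of p in the role of F.\<close>

lemma theta_cls_doubling:
  fixes \<xi> :: "'a::char_two"
  assumes p: "odd p"
  shows "theta_pos (cls p \<xi> 0) * theta_odd (cls p \<xi> (2 * c))
      = (theta_odd (cls p \<xi> c) * theta_even (cls p \<xi> c))\<^sup>2"
    and "theta_even (cls p \<xi> (2 * c)) = (theta_odd (cls p \<xi> c) + theta_even (cls p \<xi> c)) ^ 4"
proof -
  show "theta_pos (cls p \<xi> 0) * theta_odd (cls p \<xi> (2 * c))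
      = (theta_odd (cls p \<xi> c) * theta_even (cls p \<xi> c))\<^sup>2"
  proof (rule theta_odd_doubling)
    fix a b :: int
    have "int (2 * sq a + 2 * sq b) = int (sq (a + b) + sq (a - b))"
      by (simp add: power2_eq_square algebra_simps)
    then have e: "2 * sq a + 2 * sq b = sq (a + b) + sq (a - b)" by (simp only: of_nat_eq_iff)
    have "p dvd a - c \<and> p dvd b - c \<longleftrightarrow> p dvd a + b - 2 * c \<and> p dvd a - b"
    proof safe
      assume *: "p dvd a - c" "p dvd b - c"
      show "p dvd a + b - 2 * c" using dvd_add[OF *] by (simp add: algebra_simps)
      show "p dvd a - b" using dvd_diff[OF *] by (simp add: algebra_simps)
    next
      assume *: "p dvd a + b - 2 * c" "p dvd a - b"
      have "p dvd 2 * (a - c)" using dvd_add[OF *] by (simp add: algebra_simps)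
      then show "p dvd a - c" using dvd_double_iff[OF p] by blast
      have "p dvd 2 * (b - c)" using dvd_diff[OF *] by (simp add: algebra_simps)
      then show "p dvd b - c" using dvd_double_iff[OF p] by blast
    qed
    moreover have "(\<xi> ^ sq a)\<^sup>2 * (\<xi> ^ sq b)\<^sup>2 = \<xi> ^ sq (a + b) * \<xi> ^ sq (a - b)"
      unfolding power_add[symmetric] e[symmetric] by (simp add: power_add mult.commute flip: power_mult)
    ultimately show "(cls p \<xi> c a)\<^sup>2 * (cls p \<xi> c b)\<^sup>2 = cls p \<xi> (2 * c) (a + b) * cls p \<xi> 0 (a - b)"
      unfolding cls_def by auto
  qed (simp add: cls_def)
  show "theta_even (cls p \<xi> (2 * c)) = (theta_odd (cls p \<xi> c) + theta_even (cls p \<xi> c)) ^ 4"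
  proof (rule theta_even_doubling)
    fix m :: int
    have "int (sq (2 * m)) = int (sq m * 4)" by simp
    then have e: "sq (2 * m) = sq m * 4" by (simp only: of_nat_eq_iff)
    have "p dvd 2 * m - 2 * c \<longleftrightarrow> p dvd m - c"
      using dvd_double_iff[OF p, of "m - c"] by (simp only: right_diff_distrib)
    then show "cls p \<xi> (2 * c) (2 * m) = cls p \<xi> c m ^ 4"
      by (simp add: cls_def e power_mult)
  qed
qed

text \<open>The terms at n and - n cancel, leaving only n = 0.\<close>

lemma theta_even_zero:
  assumes "P 0" "\<And>n. P (- n) = P n" "w 0 = 1" "\<And>n. w (- n) = w n"
  shows "gf {n. even n \<and> P n} sq w = (1::'a::char_two fps)"
proof -
  have "gf {n. even n \<and> P n} sq w = gf {x \<in> {n. even n \<and> P n}. - x = x} sq w"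
    by (rule gf_involution[OF fin_fibres_sq]) (use assms in auto)
  also have "{x \<in> {n. even n \<and> P n}. - x = x} = {0}" using assms by auto
  also have "gf {0} sq w = 1"
  proof (rule fps_ext)
    fix N
    have "{s. s = 0 \<and> sq s = N} = (if N = 0 then {0} else {})" by (auto simp: sq_def)
    then show "gf {0} sq w $ N = 1 $ N" using assms(3) by (simp add: gf_nth)
  qed
  finally show ?thesis .
qed

text \<open>The positive odd n in the classes of c and - c together correspond, up to sign, to all
  odd n in the class of c.\<close>

lemma theta_pos_cls_sum:
  fixes \<xi> :: "'a::char_two"
  assumes p: "p = 2 * h + 1" "h \<ge> 0"
  shows "theta_pos (\<lambda>n. \<xi> ^ sq n) = theta_pos (cls p \<xi> 0) + (\<Sum>c\<in>{1..h}. theta_odd (cls p \<xi> c))"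
proof -
  have one: "(\<Sum>c\<in>{-h..h}. cls p \<xi> c n) = \<xi> ^ sq n" for n
  proof -
    define r where "r = (if n mod p \<le> h then n mod p else n mod p - p)"
    have "p > 0" using p by simp
    then have bounds: "0 \<le> n mod p" "n mod p < p" by simp_all
    have "p \<le> 2 * h + 1" "2 * h + 1 \<le> p" using p by simp_all
    then have r: "r \<in> {-h..h}" unfolding r_def using bounds p(2)
      by (simp only: atLeastAtMost_iff split: if_split) linarith
    have "p dvd n - n mod p" by (rule dvd_minus_mod)
    moreover from dvd_add[OF this dvd_refl] have "p dvd n - (n mod p - p)"
      by (simp add: algebra_simps)
    ultimately have pr: "p dvd n - r" unfolding r_def by simp
    have uniq: "c = r" if "c \<in> {-h..h}" "p dvd n - c" for c
    proof -
      have "p dvd c - r" using dvd_diff[OF pr that(2)] by simp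
      moreover have "\<bar>c - r\<bar> < p" using that(1) r p by auto
      ultimately show ?thesis using dvd_imp_le_int[of "c - r" p] p by fastforce
    qed
    have "cls p \<xi> c n = (if c = r then \<xi> ^ sq n else 0)" if "c \<in> {-h..h}" for c
      using uniq[OF that] pr unfolding cls_def by metis
    then have "(\<Sum>c\<in>{-h..h}. cls p \<xi> c n) = (\<Sum>c\<in>{-h..h}. if c = r then \<xi> ^ sq n else 0)"
      by (rule sum.cong[OF refl])
    then show ?thesis using r by simp
  qed
  have pair: "theta_pos (cls p \<xi> c) + theta_pos (cls p \<xi> (- c)) = theta_odd (cls p \<xi> c)" for c
  proof -
    have *: "{n::int. odd n} = {n. odd n \<and> n > 0} \<union> {n. odd n \<and> n < 0}"
      by (auto simp: not_less order_le_less)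
    have "theta_odd (cls p \<xi> c) = theta_pos (cls p \<xi> c) + gf {n. odd n \<and> n < 0} sq (cls p \<xi> c)"
      unfolding theta_odd_def theta_pos_def * by (intro gf_Un fin_fibres_sq) auto
    also have "gf {n. odd n \<and> n < 0} sq (cls p \<xi> c) = theta_pos (cls p \<xi> (- c))"
      unfolding theta_pos_def
    proof (rule gf_reindex[where h=uminus])
      show "bij_betw uminus {n::int. odd n \<and> n < 0} {n. odd n \<and> 0 < n}"
        by (rule bij_betwI[where g=uminus]) auto
      have "p dvd - n - c \<longleftrightarrow> p dvd n + c" "p dvd - n + c \<longleftrightarrow> p dvd n - c" for n
        using dvd_minus_iff[of p "n + c"] dvd_minus_iff[of p "n - c"] by simp_all
      then show "cls p \<xi> (- c) (- n) = cls p \<xi> c n" for n by (simp add: cls_def)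
    qed simp
    finally show ?thesis by simp
  qed
  have "theta_pos (\<lambda>n. \<xi> ^ sq n) = (\<Sum>c\<in>{-h..h}. theta_pos (cls p \<xi> c))"
    unfolding theta_pos_def gf_sum[symmetric] one ..
  also have "{-h..h} = insert 0 ({1..h} \<union> uminus ` {1..h})"
    unfolding image_uminus_atLeastAtMost using p(2) by auto
  also have "(\<Sum>c\<in>\<dots>. theta_pos (cls p \<xi> c))
      = theta_pos (cls p \<xi> 0) + ((\<Sum>c\<in>{1..h}. theta_pos (cls p \<xi> c)) + (\<Sum>c\<in>uminus ` {1..h}. theta_pos (cls p \<xi> c)))"
    by (subst sum.insert, force, force, subst sum.union_disjoint) auto
  also have "(\<Sum>c\<in>uminus ` {1..h}. theta_pos (cls p \<xi> c)) = (\<Sum>c\<in>{1..h}. theta_pos (cls p \<xi> (- c)))"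
    by (subst sum.reindex) auto
  also have "(\<Sum>c\<in>{1..h}. theta_pos (cls p \<xi> c)) + \<dots> = (\<Sum>c\<in>{1..h}. theta_odd (cls p \<xi> c))"
    by (simp only: sum.distrib[symmetric] pair)
  finally show ?thesis .
qed

section \<open>Level five: the algebraic relation between D and G\<close>

lemma cls_one: "cls p 1 c n = (if p dvd n - c then 1 else 0)"
  by (simp add: cls_def)

lemma gf_cls_one:
  "gf {n. P n} sq (cls p 1 c) = gf {n. P n \<and> p dvd n - c} sq (\<lambda>_. 1)"
proof -
  have "gf {n. P n} sq (cls p 1 c) = gf {n \<in> {n. P n}. p dvd n - c} sq (cls p 1 c)"
    by (rule gf_restrict[OF fin_fibres_sq]) (simp add: cls_def)
  also have "\<dots> = gf {n. P n \<and> p dvd n - c} sq (\<lambda>_. 1)"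
    by (rule gf_cong) (auto simp: cls_def)
  finally show ?thesis .
qed

lemma gf_Un3:
  assumes "fin_fibres (R \<union> (S \<union> T)) d" "R \<inter> (S \<union> T) = {}" "S \<inter> T = {}"
  shows "gf (R \<union> (S \<union> T)) d w = gf R d w + (gf S d w + gf T d w)"
  using assms by (subst gf_Un, auto intro: fin_fibres_subset)+

text \<open>
  Both sides count points \<open>(a, b)\<close>, up to sign, on the lattice \<open>a = 2 b\<close> modulo 5, which is the image
  of the square lattice under multiplication by \<open>2 + i\<close>, a map that scales the norm by 5.
\<close>

lemma level_five_theta:
  "ev 1 5 (theta_pos (\<lambda>_. 1 :: 'a::{field,char_two})) + theta_pos (cls 5 1 0)
    = theta_odd (cls 5 1 2) * theta_even (cls 5 1 1) + theta_odd (cls 5 1 1) * theta_even (cls 5 1 2)"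
proof -
  define T where "T = {(a::int, b::int). odd a \<and> even b \<and> a > 0 \<and> 5 dvd a - 2 * b}"
  define nrm :: "int \<times> int \<Rightarrow> int \<times> int" where "nrm x = (if fst x > 0 then x else (- fst x, - snd x))" for x
  let ?d = "\<lambda>x::int \<times> int. sq (fst x) + sq (snd x)" and ?one = "\<lambda>_::int \<times> int. 1 :: 'a"
  have fin: "fin_fibres U ?d" for U
    by (rule fin_fibres_subset[of UNIV])
       (use fin_fibres_Times'[OF fin_fibres_sq[of UNIV] fin_fibres_sq[of UNIV]] in auto)
  have dn: "?d (nrm x) = ?d x" for x by (simp add: nrm_def)
  have ev1: "theta_even (\<lambda>_. 1 :: 'a) = 1"
    using theta_even_zero[of "\<lambda>_. True" "\<lambda>_. 1 :: 'a"] by (simp add: theta_even_def)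
  have ev5: "gf {n. even n \<and> 5 dvd n} sq (\<lambda>_. 1 :: 'a) = 1"
    by (rule theta_even_zero) auto
  have G: "ev 1 5 (theta_pos (\<lambda>_. 1 :: 'a)) = gf T ?d ?one"
  proof -
    \<comment> \<open>The factor 1 turns the single sum into a sum over a two-dimensional lattice,
      where multiplication by 2 + i is available.\<close>
    have "ev 1 5 (theta_pos (\<lambda>_. 1 :: 'a)) = ev 1 5 (theta_one * theta_even (\<lambda>_. 1))"
      by (simp add: ev1)
    also have "\<dots> = gf ({n. odd n \<and> n > 0} \<times> {n. even n}) (\<lambda>x. 5 * ?d x) ?one"
      unfolding theta_pos_def theta_even_def gf_mult'[OF fin_fibres_sq fin_fibres_sq] by (simp add: ev_gf)
    also have "\<dots> = gf T ?d ?one"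
    proof (rule gf_reindex[where h="\<lambda>x. nrm (2 * snd x - fst x, snd x + 2 * fst x)"])
      \<comment> \<open>With the lattice points read as u + v i and a + b i, this is multiplication
        by (2 - i)/5, followed by the sign that makes v positive.\<close>
      define g :: "int \<times> int \<Rightarrow> int \<times> int"
        where "g y = (let v = (2 * snd y - fst y) div 5; u = (2 * fst y + snd y) div 5
          in if v > 0 then (v, u) else (- v, - u))" for y
      have g5: "g (a, b) = (if v > 0 then (v, u) else (- v, - u))" if "2 * b - a = 5 * v" "2 * a + b = 5 * u" for a b u v
        using that by (simp add: g_def Let_def)
      show "bij_betw (\<lambda>x. nrm (2 * snd x - fst x, snd x + 2 * fst x)) ({n. odd n \<and> n > 0} \<times> {n. even n}) T"
      proof (rule bij_betwI[where g=g])
        show "(\<lambda>x. nrm (2 * snd x - fst x, snd x + 2 * fst x)) \<in> {n. odd n \<and> n > 0} \<times> {n. even n} \<rightarrow> T"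
        proof
          fix x assume "x \<in> {n::int. odd n \<and> n > 0} \<times> {n::int. even n}"
          then obtain v u where x: "x = (v, u)" "odd v" "v > 0" "even u" by auto
          have "2 * u - v \<noteq> 0" using x by presburger
          moreover have "5 dvd 2 * u - v - 2 * (u + 2 * v)" "5 dvd - (2 * u - v) - 2 * (- (u + 2 * v))"
            by (simp_all add: algebra_simps)
          ultimately show "nrm (2 * snd x - fst x, snd x + 2 * fst x) \<in> T"
            using x(2-) unfolding x(1) nrm_def T_def by auto
        qed
        show "g \<in> T \<rightarrow> {n. odd n \<and> n > 0} \<times> {n. even n}"
        proof
          fix y assume "y \<in> T"
          then obtain a b where y: "y = (a, b)" "odd a" "even b" "a > 0" "5 dvd a - 2 * b" by (auto simp: T_def)
          then obtain v where v: "a - 2 * b = 5 * (- v)" by (metis dvdE minus_minus)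
          then have a: "a = 2 * b - 5 * v" by simp
          then have u: "2 * a + b = 5 * (b - 2 * v)" by simp
          have "odd v" using y(2) a by auto
          moreover from this have "v \<noteq> 0" by auto
          ultimately show "g y \<in> {n. odd n \<and> n > 0} \<times> {n. even n}"
            using g5[of b a v "b - 2 * v"] u a y by auto
        qed
        show "g (nrm (2 * snd x - fst x, snd x + 2 * fst x)) = x" if x0: "x \<in> {n. odd n \<and> n > 0} \<times> {n. even n}" for x
        proof -
          obtain v u where x: "x = (v, u)" "v > 0" using x0 by auto
          show ?thesis using x(2) g5[of "u + 2 * v" "2 * u - v" v u] g5[of "- (u + 2 * v)" "- (2 * u - v)" "- v" "- u"]
            unfolding x(1) nrm_def by auto
        qed
        show "nrm (2 * snd (g y) - fst (g y), snd (g y) + 2 * fst (g y)) = y" if "y \<in> T" for y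
        proof -
          obtain a b where y: "y = (a, b)" "odd a" "even b" "a > 0" "5 dvd a - 2 * b" using \<open>y \<in> T\<close> by (auto simp: T_def)
          then obtain v where v: "a - 2 * b = 5 * (- v)" by (metis dvdE minus_minus)
          then have a: "a = 2 * b - 5 * v" by simp
          then have u: "2 * a + b = 5 * (b - 2 * v)" by simp
          show ?thesis
            using g5[of b a v "b - 2 * v"] u a y(4) unfolding y(1) nrm_def by auto
        qed
      qed
      fix x :: "int \<times> int"
      have "int (?d (2 * snd x - fst x, snd x + 2 * fst x)) = int (5 * ?d x)"
        by (simp add: power2_eq_square algebra_simps)
      then show "?d (nrm (2 * snd x - fst x, snd x + 2 * fst x)) = 5 * ?d x"
        unfolding dn by (simp only: of_nat_eq_iff)
    qed simp
    finally show ?thesis .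
  qed
  have part: "theta_odd (cls 5 1 (2 * c)) * theta_even (cls 5 1 c)
      = gf {x \<in> T. 5 dvd snd x - c \<or> 5 dvd snd x + c} ?d ?one" if c: "\<not> 5 dvd c" for c
  proof -
    have "theta_odd (cls 5 1 (2 * c)) * theta_even (cls 5 1 c)
        = gf ({n. odd n \<and> 5 dvd n - 2 * c} \<times> {n. even n \<and> 5 dvd n - c}) ?d ?one"
      unfolding theta_odd_def theta_even_def gf_cls_one gf_mult'[OF fin_fibres_sq fin_fibres_sq] by simp
    also have "\<dots> = gf {x \<in> T. 5 dvd snd x - c \<or> 5 dvd snd x + c} ?d ?one"
    proof (rule gf_reindex[where h=nrm])
      show "bij_betw nrm ({n. odd n \<and> 5 dvd n - 2 * c} \<times> {n. even n \<and> 5 dvd n - c})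
          {x \<in> T. 5 dvd snd x - c \<or> 5 dvd snd x + c}"
      proof (rule bij_betwI[where g="\<lambda>x. if 5 dvd snd x - c then x else (- fst x, - snd x)"])
        show "nrm \<in> {n. odd n \<and> 5 dvd n - 2 * c} \<times> {n. even n \<and> 5 dvd n - c}
          \<rightarrow> {x \<in> T. 5 dvd snd x - c \<or> 5 dvd snd x + c}"
        proof
          fix x assume "x \<in> {n. odd n \<and> 5 dvd n - 2 * c} \<times> {n. even n \<and> 5 dvd n - c}"
          then obtain a b where x: "x = (a, b)" "odd a" "5 dvd a - 2 * c" "even b" "5 dvd b - c" by auto
          have "5 dvd a - 2 * b" "5 dvd - a - 2 * (- b)" "5 dvd - b + c" "a \<noteq> 0" using x by presburger+
          then show "nrm x \<in> {x \<in> T. 5 dvd snd x - c \<or> 5 dvd snd x + c}"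
            using x(2-) unfolding x(1) nrm_def T_def by auto
        qed
        show "(\<lambda>x. if 5 dvd snd x - c then x else (- fst x, - snd x)) \<in> {x \<in> T. 5 dvd snd x - c \<or> 5 dvd snd x + c}
          \<rightarrow> {n. odd n \<and> 5 dvd n - 2 * c} \<times> {n. even n \<and> 5 dvd n - c}"
        proof
          fix x assume "x \<in> {x \<in> T. 5 dvd snd x - c \<or> 5 dvd snd x + c}"
          then obtain a b where x: "x = (a, b)" "odd a" "even b" "5 dvd a - 2 * b" "5 dvd b - c \<or> 5 dvd b + c"
            by (auto simp: T_def)
          show "(if 5 dvd snd x - c then x else (- fst x, - snd x))
            \<in> {n. odd n \<and> 5 dvd n - 2 * c} \<times> {n. even n \<and> 5 dvd n - c}"
          proof (cases "5 dvd b - c")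
            case True
            then have "5 dvd a - 2 * c" using x(4) by presburger
            then show ?thesis using True x by auto
          next
            case False
            then have "5 dvd b + c" using x by simp
            then have "5 dvd - a - 2 * c" "5 dvd - b - c" using x(4) by presburger+
            then show ?thesis using False x by auto
          qed
        qed
        show "(if 5 dvd snd (nrm x) - c then nrm x else (- fst (nrm x), - snd (nrm x))) = x"
          if x0: "x \<in> {n. odd n \<and> 5 dvd n - 2 * c} \<times> {n. even n \<and> 5 dvd n - c}" for x
        proof -
          obtain a b where x: "x = (a, b)" "5 dvd b - c" using x0 by auto
          have "\<not> 5 dvd - b - c" using x(2) c by presburger
          then show ?thesis using x(2) unfolding x(1) nrm_def by auto
        qed
        show "nrm (if 5 dvd snd x - c then x else (- fst x, - snd x)) = x"
          if "x \<in> {x \<in> T. 5 dvd snd x - c \<or> 5 dvd snd x + c}" for x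
          using that by (auto simp: T_def nrm_def)
      qed
    qed (simp_all add: dn)
    finally show ?thesis .
  qed
  have "T = {x \<in> T. 5 dvd snd x} \<union> ({x \<in> T. 5 dvd snd x - 1 \<or> 5 dvd snd x + 1}
      \<union> {x \<in> T. 5 dvd snd x - 2 \<or> 5 dvd snd x + 2})"
  proof -
    have "5 dvd b \<or> (5 dvd b - 1 \<or> 5 dvd b + 1) \<or> (5 dvd b - 2 \<or> 5 dvd b + 2)" for b :: int
      by presburger
    then show ?thesis by blast
  qed
  then have "gf T ?d ?one = gf ({x \<in> T. 5 dvd snd x} \<union> ({x \<in> T. 5 dvd snd x - 1 \<or> 5 dvd snd x + 1}
      \<union> {x \<in> T. 5 dvd snd x - 2 \<or> 5 dvd snd x + 2})) ?d ?one" by (rule arg_cong)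
  also have "\<dots> = gf {x \<in> T. 5 dvd snd x} ?d ?one + (gf {x \<in> T. 5 dvd snd x - 1 \<or> 5 dvd snd x + 1} ?d ?one
      + gf {x \<in> T. 5 dvd snd x - 2 \<or> 5 dvd snd x + 2} ?d ?one)"
  proof (rule gf_Un3[OF fin])
    have "\<not> (5 dvd b \<and> (5 dvd b - 1 \<or> 5 dvd b + 1))" "\<not> (5 dvd b \<and> (5 dvd b - 2 \<or> 5 dvd b + 2))"
      "\<not> ((5 dvd b - 1 \<or> 5 dvd b + 1) \<and> (5 dvd b - 2 \<or> 5 dvd b + 2))" for b :: int
      by presburger+
    then show "{x \<in> T. 5 dvd snd x} \<inter> ({x \<in> T. 5 dvd snd x - 1 \<or> 5 dvd snd x + 1}
        \<union> {x \<in> T. 5 dvd snd x - 2 \<or> 5 dvd snd x + 2}) = {}"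
      "{x \<in> T. 5 dvd snd x - 1 \<or> 5 dvd snd x + 1} \<inter> {x \<in> T. 5 dvd snd x - 2 \<or> 5 dvd snd x + 2} = {}"
      by blast+
  qed
  also have "gf {x \<in> T. 5 dvd snd x} ?d ?one = theta_pos (cls 5 1 0)"
  proof -
    have "theta_pos (cls 5 1 0) = theta_pos (cls 5 1 0) * gf {n. even n \<and> 5 dvd n} sq (\<lambda>_. 1 :: 'a)"
      by (simp add: ev5)
    also have "\<dots> = gf ({n. (odd n \<and> n > 0) \<and> 5 dvd n - 0} \<times> {n. even n \<and> 5 dvd n}) ?d ?one"
      unfolding theta_pos_def gf_cls_one gf_mult'[OF fin_fibres_sq fin_fibres_sq] by simp
    also have "{n::int. (odd n \<and> n > 0) \<and> 5 dvd n - 0} \<times> {n. even n \<and> 5 dvd n} = {x \<in> T. 5 dvd snd x}"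
    proof -
      have "5 dvd a - 2 * b \<longleftrightarrow> 5 dvd a" if "5 dvd b" for a b :: int using that by presburger
      then show ?thesis by (auto simp: T_def)
    qed
    finally show ?thesis ..
  qed
  also have "gf {x \<in> T. 5 dvd snd x - 1 \<or> 5 dvd snd x + 1} ?d ?one = theta_odd (cls 5 1 2) * theta_even (cls 5 1 1)"
    using part[of 1] by simp
  also have "gf {x \<in> T. 5 dvd snd x - 2 \<or> 5 dvd snd x + 2} ?d ?one = theta_odd (cls 5 1 4) * theta_even (cls 5 1 2)"
    using part[of 2] by simp
  also have "theta_odd (cls 5 1 4 :: int \<Rightarrow> 'a) = theta_odd (cls 5 1 (- 1))"
    by (subst cls_cong[of 5 4 "- 1"]) simp_all
  also have "\<dots> = theta_odd (cls 5 1 1)" by (rule theta_cls_minus)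
  finally show ?thesis unfolding G[symmetric] by (metis add.commute add_self_left_char_two)
qed

definition theta_D :: "'a::field fps" where
  "theta_D = gf {n. odd n \<and> n > 0 \<and> \<not> 5 dvd n} sq (\<lambda>_. 1)"

lemma theta_D_eq: "theta_D = theta_odd (cls 5 1 1) + theta_odd (cls 5 1 (2::int) :: int \<Rightarrow> 'a::{field,char_two})"
proof -
  have "theta_pos (\<lambda>n. 1 ^ sq n) = theta_pos (cls 5 1 0) + (\<Sum>c\<in>{1..2}. theta_odd (cls 5 1 c :: int \<Rightarrow> 'a))"
    by (rule theta_pos_cls_sum) auto
  moreover have "{1..2::int} = {1, 2}" by auto
  ultimately have 1: "theta_pos (\<lambda>n. 1) = theta_pos (cls 5 1 0) + (theta_odd (cls 5 1 1) + theta_odd (cls 5 1 2 :: int \<Rightarrow> 'a))"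
    by simp
  have "theta_pos (\<lambda>n. 1 :: 'a) = gf ({n. (odd n \<and> n > 0) \<and> 5 dvd n - 0} \<union> {n. odd n \<and> n > 0 \<and> \<not> 5 dvd n}) sq (\<lambda>_. 1)"
    unfolding theta_pos_def by (rule gf_cong) auto
  also have "\<dots> = theta_pos (cls 5 1 0) + theta_D"
    unfolding theta_pos_def theta_D_def gf_cls_one by (intro gf_Un fin_fibres_sq) auto
  finally show ?thesis using 1 by simp
qed

lemma power2_inj_char_two:
  fixes x y :: "'a::{idom,char_two}"
  assumes "x\<^sup>2 = y\<^sup>2" shows "x = y"
proof -
  have "(x + y)\<^sup>2 = 0" using assms by (simp add: power2_add_char_two)
  then show ?thesis by (simp add: add_eq_0_iff_char_two)
qed

lemma power_4_5:
  fixes x :: "'a::monoid_mult"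
  shows "x ^ 4 = x * x * x * x" "x ^ 5 = x * x * x * x * x"
  by (simp_all add: eval_nat_numeral mult.assoc)

lemmas char_two_ring_simps = power2_eq_square power3_eq_cube power_4_5 distrib_left distrib_right
  ac_simps add_self_char_two add_self_left_char_two add_0_left add_0_right

text \<open>Elimination with b = G + \<open>\<Phi>\<close>. Since A_1 A_2 = b^2, symmetric
  expressions in A_1, A_2 are polynomials in D = A_1 + A_2 and b. This yields G = D K^2 and b^6 + b
  G = G^2, from which b drops out as D^6 = D^2 K^4 + K^3; squaring and multiplying by D^3 gives the
  claim.\<close>

lemma level_five_algebra:
  fixes A\<^sub>1 A\<^sub>2 B\<^sub>1 B\<^sub>2 \<Phi> G :: "'a::{idom,char_two}"
  assumes b: "G + \<Phi> = A\<^sub>2 * B\<^sub>1 + A\<^sub>1 * B\<^sub>2"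
    and d: "\<Phi> * A\<^sub>2 = (A\<^sub>1 * B\<^sub>1)\<^sup>2" "\<Phi> * A\<^sub>1 = (A\<^sub>2 * B\<^sub>2)\<^sup>2"
    and add: "A\<^sub>1 * A\<^sub>2 = (A\<^sub>1 * B\<^sub>2 + B\<^sub>1 * A\<^sub>2)\<^sup>2" "B\<^sub>1 * B\<^sub>2 = (A\<^sub>1 * A\<^sub>2 + B\<^sub>1 * B\<^sub>2)\<^sup>2"
    and nz: "A\<^sub>1 \<noteq> 0" "A\<^sub>2 \<noteq> 0" "\<Phi> \<noteq> 0"
  shows "(A\<^sub>1 + A\<^sub>2) ^ 15 = G ^ 4 * (A\<^sub>1 + A\<^sub>2) ^ 3 + G ^ 3"
proof -
  define b where "b = G + \<Phi>"
  define D where "D = A\<^sub>1 + A\<^sub>2"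
  define K where "K = D\<^sup>2 + D * b + b\<^sup>2"
  have P: "A\<^sub>1 * A\<^sub>2 = b\<^sup>2" using add(1) unfolding b_def assms(1) by (simp add: ac_simps)
  have G: "G = b + \<Phi>" by (simp add: b_def add.assoc)
  have "(A\<^sub>1 * A\<^sub>2) * \<Phi>\<^sup>2 = (\<Phi> * A\<^sub>2) * (\<Phi> * A\<^sub>1)" by (simp add: power2_eq_square ac_simps)
  also have "\<dots> = (A\<^sub>1 * A\<^sub>2) * ((A\<^sub>1 * A\<^sub>2) * (B\<^sub>1 * B\<^sub>2)\<^sup>2)" unfolding d by (simp add: power2_eq_square ac_simps)
  finally have "\<Phi>\<^sup>2 = (A\<^sub>1 * A\<^sub>2) * (B\<^sub>1 * B\<^sub>2)\<^sup>2" using nz by simp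
  then have "\<Phi>\<^sup>2 = (b * (B\<^sub>1 * B\<^sub>2))\<^sup>2" by (simp add: P power_mult_distrib)
  then have \<Phi>: "\<Phi> = b * (B\<^sub>1 * B\<^sub>2)" by (rule power2_inj_char_two)
  have "b * \<Phi> = b\<^sup>2 * (B\<^sub>1 * B\<^sub>2)" by (simp add: \<Phi> power2_eq_square ac_simps)
  also have "\<dots> = (b * (b\<^sup>2 + B\<^sub>1 * B\<^sub>2))\<^sup>2" using add(2) by (simp add: P power_mult_distrib)
  also have "b * (b\<^sup>2 + B\<^sub>1 * B\<^sub>2) = b ^ 3 + \<Phi>" by (simp add: \<Phi> distrib_left power2_eq_square power3_eq_cube)
  finally have b6: "b ^ 6 + \<Phi>\<^sup>2 = b * \<Phi>" by (simp add: power2_add_char_two flip: power_mult)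
  have b6': "b ^ 6 = \<Phi> * G"
  proof -
    have "b ^ 6 = (b ^ 6 + \<Phi>\<^sup>2) + \<Phi>\<^sup>2" by (simp add: add.assoc)
    then show ?thesis unfolding b6 G by (simp add: distrib_left power2_eq_square ac_simps)
  qed
  \<comment> \<open>The factor \<open>\<Phi>\<close> lets the duplication formulas replace one A in
    each fifth power, and is cancelled at the end.\<close>
  have "\<Phi> * (A\<^sub>1 ^ 5 + A\<^sub>2 ^ 5) = A\<^sub>1 ^ 4 * (\<Phi> * A\<^sub>1) + A\<^sub>2 ^ 4 * (\<Phi> * A\<^sub>2)"
    by (simp add: char_two_ring_simps)
  also have "\<dots> = (A\<^sub>1 * A\<^sub>2)\<^sup>2 * ((A\<^sub>1 * B\<^sub>2)\<^sup>2 + (A\<^sub>2 * B\<^sub>1)\<^sup>2)"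
    unfolding d by (simp add: char_two_ring_simps)
  also have "(A\<^sub>1 * B\<^sub>2)\<^sup>2 + (A\<^sub>2 * B\<^sub>1)\<^sup>2 = b\<^sup>2"
    unfolding power2_add_char_two[symmetric] b_def assms(1) by (simp add: ac_simps)
  also have "(A\<^sub>1 * A\<^sub>2)\<^sup>2 * b\<^sup>2 = \<Phi> * G" unfolding P b6'[symmetric] by (simp flip: power_mult power_add)
  finally have G5: "G = A\<^sub>1 ^ 5 + A\<^sub>2 ^ 5" using nz by simp
  also have "\<dots> = D ^ 5 + D ^ 3 * (A\<^sub>1 * A\<^sub>2) + D * (A\<^sub>1 * A\<^sub>2)\<^sup>2"
    unfolding D_def by (simp only: char_two_ring_simps)
  also have "\<dots> = D * K\<^sup>2"
    unfolding P K_def by (simp only: char_two_ring_simps)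
  finally have GK: "G = D * K\<^sup>2" .
  have "b ^ 6 = b * G + G\<^sup>2" unfolding b6' using G
    by (metis (no_types, lifting) add_self_left_char_two add.commute distrib_right power2_eq_square)
  then have "b ^ 6 + b * G = G\<^sup>2" by (simp add: ac_simps)
  then have e1: "D\<^sup>2 * K ^ 4 = b ^ 6 + b * D * K\<^sup>2" by (simp add: GK power_mult_distrib ac_simps flip: power_mult)
  \<comment> \<open>Here K + b D = (D + b)^2, and K (D + b) = D^3 + b^3 is the factorisation of a
    sum of cubes.\<close>
  have "K ^ 3 + b * D * K\<^sup>2 = (K * (D + b))\<^sup>2"
    unfolding power2_add_char_two power_mult_distrib
    by (simp add: K_def power3_eq_cube power2_eq_square distrib_left distrib_right ac_simps)
  also have "K * (D + b) = D ^ 3 + b ^ 3"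
    unfolding K_def by (simp only: char_two_ring_simps)
  finally have "K ^ 3 + b * D * K\<^sup>2 = D ^ 6 + b ^ 6"
    by (simp add: power2_add_char_two flip: power_mult)
  then have e2: "D ^ 6 = b ^ 6 + (K ^ 3 + b * D * K\<^sup>2)"
    by (simp only: ac_simps add_self_char_two add_self_left_char_two add_0_right add_0_left)
  have "D ^ 6 = D\<^sup>2 * K ^ 4 + K ^ 3" unfolding e1 e2 by (simp only: ac_simps)
  then have "(D ^ 6)\<^sup>2 = (D\<^sup>2 * K ^ 4)\<^sup>2 + (K ^ 3)\<^sup>2" by (simp add: power2_add_char_two)
  then have "D ^ 3 * D ^ 12 = D ^ 3 * (D ^ 4 * K ^ 8 + K ^ 6)"
    by (simp add: power_mult_distrib flip: power_mult)
  also have "\<dots> = G ^ 4 * D ^ 3 + G ^ 3"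
    unfolding GK by (simp add: power_mult_distrib distrib_left ac_simps flip: power_mult)
  finally show ?thesis unfolding D_def by (simp flip: power_add)
qed

text \<open>If n lies in the class of c then - n does not, so the coefficient at n^2 is a single
  power of \<open>\<xi>\<close>. Of c and c + p one is odd and one is even, which serves both
  series.\<close>

lemma theta_cls_nonzero:
  fixes \<xi> :: "'a::{field,char_two}"
  assumes p: "odd p" "\<not> p dvd c" and \<xi>: "\<xi> \<noteq> 0"
  shows "theta_odd (cls p \<xi> c) \<noteq> 0" "theta_even (cls p \<xi> c) \<noteq> 0"
proof -
  have coeff: "gf S sq (cls p \<xi> c) \<noteq> 0" if "n \<in> S" "p dvd n - c" for n S
  proof -
    have "\<not> p dvd - n - c"
    proof
      assume "p dvd - n - c"
      from dvd_add[OF this that(2)] have "p dvd 2 * (- c)" by simp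
      then have "p dvd - c" using dvd_double_iff[OF p(1)] by blast
      then show False using p(2) by simp
    qed
    then have z: "cls p \<xi> c (- n) = 0" by (simp add: cls_def)
    have "m = n \<or> m = - n" if "sq m = sq n" for m
    proof -
      have "m\<^sup>2 = n\<^sup>2" using that by (metis int_sq)
      then show ?thesis by (simp add: power2_eq_iff)
    qed
    then have "gf S sq (cls p \<xi> c) $ sq n = (\<Sum>m\<in>{n}. cls p \<xi> c m)"
      unfolding gf_nth using that z
      by (intro sum.mono_neutral_right) (auto intro: fin_fibresD[OF fin_fibres_sq])
    also have "\<dots> \<noteq> 0" using that(2) \<xi> by (simp add: cls_def)
    finally show ?thesis by auto
  qed
  have pp: "p dvd c + p - c" "p dvd c - c" by simp_all
  show "theta_odd (cls p \<xi> c) \<noteq> 0"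
    unfolding theta_odd_def using coeff[OF _ pp(1), of "{n. odd n}"] coeff[OF _ pp(2), of "{n. odd n}"] p(1) by (cases "odd c") auto
  show "theta_even (cls p \<xi> c) \<noteq> 0"
    unfolding theta_even_def using coeff[OF _ pp(1), of "{n. even n}"] coeff[OF _ pp(2), of "{n. even n}"] p(1) by (cases "odd c") auto
qed

lemma theta_pos_nonzero:
  assumes "w m \<noteq> 0" "odd m" "m > 0"
  shows "theta_pos w \<noteq> 0"
proof -
  have "n = m" if "sq n = sq m" "n > 0" for n
  proof -
    have "n\<^sup>2 = m\<^sup>2" using that(1) by (metis int_sq)
    then show ?thesis using that assms(3) by (auto simp: power2_eq_iff)
  qed
  then have "{n. (odd n \<and> n > 0) \<and> sq n = sq m} = {m}" using assms by auto
  then have "theta_pos w $ sq m = w m" by (simp add: theta_pos_def gf_nth)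
  then show ?thesis using assms by auto
qed

lemma theta_D_relation:
  "(theta_D :: 'a::{field,char_two} fps) ^ 15
    = ev 1 5 theta_one ^ 4 * theta_D ^ 3 + ev 1 5 theta_one ^ 3"
  unfolding theta_D_eq
proof (rule level_five_algebra[OF level_five_theta])
  have A4: "theta_odd (cls 5 1 4 :: int \<Rightarrow> 'a) = theta_odd (cls 5 1 1)"
    using cls_cong[of 5 4 "- 1" "1::'a"] theta_cls_minus(1)[of 5 "1::'a" 1] by simp
  have m1: "theta_odd (cls 5 1 (- 1) :: int \<Rightarrow> 'a) = theta_odd (cls 5 1 1)" "theta_even (cls 5 1 (- 1) :: int \<Rightarrow> 'a) = theta_even (cls 5 1 1)"
    by (rule theta_cls_minus)+
  have t3: "theta_odd (cls 5 1 3 :: int \<Rightarrow> 'a) = theta_odd (cls 5 1 2)" "theta_even (cls 5 1 3 :: int \<Rightarrow> 'a) = theta_even (cls 5 1 2)"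
    using cls_cong[of 5 3 "- 2" "1::'a"] theta_cls_minus[of 5 "1::'a" 2] by simp_all
  show "theta_pos (cls 5 1 0 :: int \<Rightarrow> 'a) * theta_odd (cls 5 1 2) = (theta_odd (cls 5 1 1) * theta_even (cls 5 1 1))\<^sup>2"
    using theta_cls_doubling(1)[of 5 "1::'a" 1] by simp
  show "theta_pos (cls 5 1 0 :: int \<Rightarrow> 'a) * theta_odd (cls 5 1 1) = (theta_odd (cls 5 1 2) * theta_even (cls 5 1 2))\<^sup>2"
    using theta_cls_doubling(1)[of 5 "1::'a" 2] by (simp add: A4)
  \<comment> \<open>Adding and subtracting the points 1 and 2 gives 3 = - 2 and - 1, so up to sign
    only the classes 1 and 2 occur.\<close>
  have "cls 5 1 3 (a + b) * cls 5 1 (- 1) (a - b) = (cls 5 1 1 a)\<^sup>2 * (cls 5 1 2 b :: 'a)\<^sup>2" for a b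
  proof -
    have "5 dvd a + b - 3 \<and> 5 dvd a - b - - 1 \<longleftrightarrow> 5 dvd a - 1 \<and> 5 dvd b - 2" by presburger
    then show ?thesis unfolding cls_one by auto
  qed
  from theta_addition[where \<chi>="cls 5 1 3" and \<xi>="cls 5 1 (- 1)" and \<phi>="cls 5 1 1 :: int \<Rightarrow> 'a" and \<psi>="cls 5 1 2", OF this]
  show "theta_odd (cls 5 1 1) * theta_odd (cls 5 1 2 :: int \<Rightarrow> 'a) = (theta_odd (cls 5 1 1) * theta_even (cls 5 1 2) + theta_even (cls 5 1 1) * theta_odd (cls 5 1 2))\<^sup>2"
    "theta_even (cls 5 1 1) * theta_even (cls 5 1 2 :: int \<Rightarrow> 'a) = (theta_odd (cls 5 1 1) * theta_odd (cls 5 1 2) + theta_even (cls 5 1 1) * theta_even (cls 5 1 2))\<^sup>2"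
    unfolding m1 t3 by (simp_all only: mult.commute)
  show "theta_odd (cls 5 1 1 :: int \<Rightarrow> 'a) \<noteq> 0" "theta_odd (cls 5 1 2 :: int \<Rightarrow> 'a) \<noteq> 0"
    by (rule theta_cls_nonzero; simp)+
  show "theta_pos (cls 5 1 0 :: int \<Rightarrow> 'a) \<noteq> 0"
    by (rule theta_pos_nonzero[of _ 5]) (auto simp: cls_one)
qed

section \<open>Pole orders under isogenies\<close>

locale valuation =
  fixes V :: "'a::field set"
  assumes valuation_ring: "valuation_ring V"
begin

lemma subring: "subring_set V"
  using valuation_ring by (simp add: valuation_ring_def)

lemmas V_intros = subring_setD(1-4)[OF subring] subring_set_power[OF subring] subring_set_sum[OF subring]

lemma not_inD: "x \<notin> V \<Longrightarrow> x \<noteq> 0 \<and> inverse x \<in> nonunits V"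
  using valuation_ring V_intros(1) by (auto simp: valuation_ring_def nonunits_def)

lemma nonunits_in: "x \<in> nonunits V \<Longrightarrow> x \<in> V"
  by (simp add: nonunits_def)

lemma one_not_nonunit: "1 \<notin> nonunits V"
  using V_intros(2) by (simp add: nonunits_def)

lemma nonunits_mult: "x \<in> nonunits V \<Longrightarrow> y \<in> V \<Longrightarrow> x * y \<in> nonunits V"
proof (cases "x * y = 0")
  case False
  assume *: "x \<in> nonunits V" "y \<in> V"
  have "inverse (x * y) \<notin> V"
  proof
    assume "inverse (x * y) \<in> V"
    then have "y * inverse (x * y) \<in> V" using * V_intros by blast
    moreover have "y * inverse (x * y) = inverse x" using False by (simp add: field_simps)
    ultimately have "inverse x \<in> V" by (simp only:)
    then show False using * False by (simp add: nonunits_def)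
  qed
  then show ?thesis using V_intros(4)[OF nonunits_in[OF *(1)] *(2)] by (simp add: nonunits_def)
qed (auto simp: nonunits_def V_intros)

lemma nonunits_mult': "x \<in> V \<Longrightarrow> y \<in> nonunits V \<Longrightarrow> x * y \<in> nonunits V"
  using nonunits_mult[of y x] by (simp add: mult.commute)

lemma nonunits_add: "x \<in> nonunits V \<Longrightarrow> y \<in> nonunits V \<Longrightarrow> x + y \<in> nonunits V"
proof -
  have *: "a + b \<in> nonunits V" if "a \<in> nonunits V" "b \<in> nonunits V" "b \<noteq> 0" "a / b \<in> V" for a b
  proof -
    have "a + b = b * (a / b + 1)" using that by (simp add: field_simps)
    then show ?thesis using nonunits_mult[OF that(2) V_intros(3)[OF that(4) V_intros(2)]] by simp
  qed
  assume xy: "x \<in> nonunits V" "y \<in> nonunits V"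
  show ?thesis
  proof (cases "x = 0 \<or> y = 0")
    case True then show ?thesis using xy by auto
  next
    case False
    have "x / y \<in> V \<or> y / x \<in> V"
      using valuation_ring False by (metis inverse_divide valuation_ring_def)
    then show ?thesis using *[of x y] *[of y x] xy False by (auto simp: add.commute)
  qed
qed

lemma nonunits_sum: "(\<And>i. i \<in> I \<Longrightarrow> f i \<in> nonunits V) \<Longrightarrow> sum f I \<in> nonunits V"
  by (induction I rule: infinite_finite_induct)
     (auto simp: nonunits_add, auto simp: nonunits_def V_intros)

lemma one_plus_nonunit:
  assumes "x \<in> nonunits V"
  shows "1 + x \<in> V" "inverse (1 + x) \<in> V" "1 + x \<noteq> 0"
proof -
  show 1: "1 + x \<in> V" using assms nonunits_in V_intros by blast
  have "- x \<in> nonunits V" using nonunits_mult'[of "- 1" x] assms subring_setD(2,5)[OF subring] by auto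
  then have *: "1 + x \<notin> nonunits V"
    using nonunits_add[of "1 + x" "- x"] one_not_nonunit by auto
  then show "inverse (1 + x) \<in> V" "1 + x \<noteq> 0" using 1 by (auto simp: nonunits_def)
qed

lemma power_in_imp: "x ^ n \<in> V \<Longrightarrow> n > 0 \<Longrightarrow> x \<in> V"
proof (rule ccontr)
  assume *: "x ^ n \<in> V" "n > 0" "x \<notin> V"
  obtain k where n: "n = Suc k" using *(2) by (cases n) auto
  have x: "x \<noteq> 0" "inverse x \<in> nonunits V" using not_inD[OF *(3)] by auto
  have "inverse x ^ k \<in> V" using x nonunits_in V_intros by blast
  then have "x ^ n * inverse x ^ k \<in> V" using * V_intros by blast
  moreover have "x ^ n * inverse x ^ k = x" using x by (simp add: n field_simps)
  ultimately show False using * by simp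
qed

lemma power_nonunit_imp:
  assumes "x ^ n \<in> nonunits V" "n > 0" shows "x \<in> nonunits V"
proof -
  have "x \<in> V" using power_in_imp assms nonunits_in by blast
  moreover have "x = 0 \<or> inverse x \<notin> V"
  proof (rule ccontr)
    assume "\<not> (x = 0 \<or> inverse x \<notin> V)"
    then have "x \<noteq> 0" "inverse (x ^ n) \<in> V" using V_intros by (auto simp flip: power_inverse)
    then show False using assms by (simp add: nonunits_def)
  qed
  ultimately show ?thesis by (simp add: nonunits_def)
qed

lemma nonunit_power: "x \<in> nonunits V \<Longrightarrow> n > 0 \<Longrightarrow> x ^ n \<in> nonunits V"
  by (cases n) (auto intro!: nonunits_mult V_intros simp: nonunits_in)

text \<open>The doubling map has no periodic points outside the units: off the units it is expanding.\<close>

lemma doubling_unit_ratio: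
  assumes \<Phi>: "inverse \<Phi> \<in> nonunits V" "\<Phi> \<noteq> 0"
    and nz: "\<And>i. A i \<noteq> 0" "\<And>i. B i \<noteq> 0"
    and dA: "\<And>i. \<Phi> * A (Suc i) = (A i * B i)\<^sup>2" and dB: "\<And>i. B (Suc i) = (A i + B i) ^ 4"
    and per: "n > 0" "A n = A 0" "B n = B 0"
  shows "B 0 / A 0 \<in> V" "A 0 / B 0 \<in> V"
proof -
  have perS: "A (n + i) = A i \<and> B (n + i) = B i" for i
  proof (induction i)
    case (Suc i)
    have "\<Phi> * A (Suc (n + i)) = \<Phi> * A (Suc i)" "B (Suc (n + i)) = B (Suc i)"
      unfolding dA dB using Suc by auto
    then show ?case using \<Phi>(2) by simp
  qed (use per in auto)
  define R where "R i = B i / A i" for i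
  have R0: "R i \<noteq> 0" for i using nz by (simp add: R_def)
  have step: "R (Suc i) = \<Phi> * (1 + R i) ^ 4 / (R i)\<^sup>2" for i
  proof -
    have A': "A (Suc i) = (A i * B i)\<^sup>2 / \<Phi>" using dA[of i] \<Phi>(2) by (simp add: field_simps)
    have r: "1 + R i = (A i + B i) / A i" using nz by (simp add: R_def field_simps)
    have "x ^ 4 / ((a * b)\<^sup>2 / \<Phi>) = \<Phi> * (x / a) ^ 4 / (b / a)\<^sup>2" if "a \<noteq> 0" "b \<noteq> 0" for a b x :: 'a
      using that \<Phi>(2) by (simp add: power_divide power_mult_distrib divide_simps)
    then show ?thesis unfolding r unfolding R_def dB A' using nz by blast
  qed
  have inv_step: "inverse (R (Suc i)) \<in> nonunits V \<and> R i / R (Suc i) \<in> nonunits V"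
    if "inverse (R i) \<in> nonunits V" for i
  proof -
    define y where "y = inverse (R i)"
    have y: "y \<in> nonunits V" "y \<noteq> 0" "R i = inverse y" using that R0 by (simp_all add: y_def)
    note y1 = one_plus_nonunit[OF y(1)]
    have "(1 + R i) ^ 4 / (R i)\<^sup>2 = (1 + y) ^ 4 / y\<^sup>2"
    proof -
      have "1 + R i = (1 + y) / y" using y by (simp add: field_simps)
      then show ?thesis using y(2) by (simp add: y(3) field_simps)
    qed
    then have RS: "R (Suc i) = \<Phi> * ((1 + y) ^ 4 / y\<^sup>2)" unfolding step by (simp only: times_divide_eq_right[symmetric])
    then have e: "inverse (R (Suc i)) = y * (y * (inverse \<Phi> * inverse (1 + y) ^ 4))"
      "R i / R (Suc i) = y * (inverse \<Phi> * inverse (1 + y) ^ 4)"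
      unfolding RS y(3) using y1(3) y(2) \<Phi>(2) by (simp_all add: field_simps power2_eq_square)
    have u: "inverse \<Phi> * inverse (1 + y) ^ 4 \<in> V" by (intro V_intros nonunits_in[OF \<Phi>(1)] y1(2))
    show ?thesis unfolding e by (intro conjI nonunits_mult y(1) V_intros(4)[OF nonunits_in[OF y(1)]] u)
  qed
  \<comment> \<open>A zero of R becomes a pole after one step, so from R 1 on only the growing case
    remains.\<close>
  have inv_step': "inverse (R (Suc i)) \<in> nonunits V" if "R i \<in> nonunits V" for i
  proof -
    note r1 = one_plus_nonunit[OF that]
    have "inverse (R (Suc i)) = R i * (R i * (inverse \<Phi> * inverse (1 + R i) ^ 4))"
      unfolding step using r1(3) \<Phi>(2) R0[of i] by (simp add: field_simps power2_eq_square)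
    moreover have "inverse \<Phi> * inverse (1 + R i) ^ 4 \<in> V"
      by (intro V_intros nonunits_in[OF \<Phi>(1)] r1(2))
    then have "R i * (R i * (inverse \<Phi> * inverse (1 + R i) ^ 4)) \<in> nonunits V"
      by (intro nonunits_mult that V_intros(4)[OF nonunits_in[OF that]])
    ultimately show ?thesis by simp
  qed
  have "R 0 \<in> V \<and> inverse (R 0) \<in> V"
  proof (rule ccontr)
    assume "\<not> (R 0 \<in> V \<and> inverse (R 0) \<in> V)"
    then have "inverse (R 0) \<in> nonunits V \<or> R 0 \<in> nonunits V"
      using not_inD[of "R 0"] not_inD[of "inverse (R 0)"] by auto
    then have 1: "inverse (R 1) \<in> nonunits V" using inv_step inv_step' by auto
    have all: "inverse (R (Suc k)) \<in> nonunits V" for k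
      by (induction k) (use 1 inv_step in auto)
    have "R 1 / R (Suc (Suc k)) \<in> nonunits V" for k
    proof (induction k)
      case 0 then show ?case using inv_step[OF all[of 0]] by simp
    next
      case (Suc k)
      have "R 1 / R (Suc (Suc (Suc k))) = R 1 / R (Suc (Suc k)) * (R (Suc (Suc k)) / R (Suc (Suc (Suc k))))"
        using R0 by (simp add: field_simps)
      then show ?case
        using nonunits_mult[OF Suc nonunits_in[OF inv_step[OF all[of "Suc k"], THEN conjunct2]]] by (simp only:)
    qed
    moreover obtain m where "n = Suc m" using per(1) by (cases n) auto
    ultimately have "R 1 / R (Suc n) \<in> nonunits V" by simp
    moreover have "R (Suc n) = R 1" using perS[of 1] by (simp add: R_def)
    ultimately show False using one_not_nonunit R0 by simp
  qed
  then show "B 0 / A 0 \<in> V" "A 0 / B 0 \<in> V" by (simp_all add: R_def)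
qed

text \<open>A and B have the same size a along the orbit, and duplication sends a to 4 a minus the
  size of \<open>\<Phi>\<close>; the fixed point is one third of \<open>\<Phi>\<close>. Precisely, z
  = \<open>\<Phi>\<close> / A^3 becomes z^4 (A / B)^6, so a nonunit z would shrink at every step,
  against periodicity.\<close>

lemma doubling_size:
  assumes \<Phi>: "inverse \<Phi> \<in> nonunits V" "\<Phi> \<noteq> 0"
    and nz: "\<And>i. A i \<noteq> 0" "\<And>i. B i \<noteq> 0"
    and dA: "\<And>i. \<Phi> * A (Suc i) = (A i * B i)\<^sup>2" and dB: "\<And>i. B (Suc i) = (A i + B i) ^ 4"
    and per: "n > 0" "\<And>i. A (n + i) = A i" "\<And>i. B (n + i) = B i"
  shows "A 0 ^ 3 / \<Phi> \<in> V"
proof (rule ccontr)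
  assume neg: "A 0 ^ 3 / \<Phi> \<notin> V"
  define z where "z i = \<Phi> / A i ^ 3" for i
  have z0: "z i \<noteq> 0" for i using nz \<Phi> by (simp add: z_def)
  have "z 0 \<in> nonunits V" using not_inD[OF neg] by (simp add: z_def)
  have unit: "A i / B i \<in> V" for i
  proof -
    have "B (n + i) = B i" "A (n + i) = A i" using per by auto
    then show ?thesis
      using doubling_unit_ratio(2)[OF \<Phi>, of "\<lambda>k. A (k + i)" "\<lambda>k. B (k + i)" n] nz dA dB per(1) by simp
  qed
  have step: "z (Suc i) = z i * ((z i) ^ 3 * (A i / B i) ^ 6)" for i
  proof -
    have A': "A (Suc i) = (A i * B i)\<^sup>2 / \<Phi>" using dA[of i] \<Phi>(2) by (simp add: field_simps)
    have "\<Phi> / ((a * b)\<^sup>2 / \<Phi>) ^ 3 = \<Phi> / a ^ 3 * ((\<Phi> / a ^ 3) ^ 3 * (a / b) ^ 6)"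
      if "a \<noteq> 0" "b \<noteq> 0" for a b :: 'a
      using that \<Phi>(2) by (simp add: power_divide power_mult_distrib divide_simps flip: power_mult)
    then show ?thesis unfolding z_def A' using nz by blast
  qed
  have all: "z k \<in> nonunits V" for k
  proof (induction k)
    case (Suc k)
    then show ?case unfolding step
      by (intro nonunits_mult V_intros(4,5) nonunits_in[OF Suc] unit)
  qed fact
  have "\<exists>t\<in>nonunits V. z (Suc k) = z 0 * t" for k
  proof (induction k)
    case 0
    have "(z 0) ^ 3 * (A 0 / B 0) ^ 6 \<in> nonunits V"
      by (intro nonunits_mult nonunit_power V_intros(5) unit all) simp
    then show ?case using step[of 0] by blast
  next
    case (Suc k)
    then obtain t where t: "t \<in> nonunits V" "z (Suc k) = z 0 * t" by auto
    have "(z (Suc k)) ^ 3 * (A (Suc k) / B (Suc k)) ^ 6 \<in> V"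
      by (intro V_intros(4,5) unit nonunits_in[OF all])
    then have "t * ((z (Suc k)) ^ 3 * (A (Suc k) / B (Suc k)) ^ 6) \<in> nonunits V" using t nonunits_mult by blast
    moreover have "z (Suc (Suc k)) = z 0 * (t * ((z (Suc k)) ^ 3 * (A (Suc k) / B (Suc k)) ^ 6))"
      using step[of "Suc k"] t(2) by (metis mult.assoc)
    ultimately show ?case by blast
  qed
  moreover obtain m where "n = Suc m" using per(1) by (cases n) auto
  ultimately obtain t where "t \<in> nonunits V" "z n = z 0 * t" by blast
  moreover have "z n = z 0" using per(2)[of 0] by (simp add: z_def)
  ultimately show False using z0[of 0] one_not_nonunit by simp
qed

end

text \<open>Injective ring homomorphisms. The different substitutions of x into one series become
  different embeddings into one field, whose values can be compared by a single valuation
  ring.\<close>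

definition field_embedding :: "('a::field fps \<Rightarrow> 'b::field) \<Rightarrow> bool" where
  "field_embedding h \<longleftrightarrow> (\<forall>f g. h (f + g) = h f + h g) \<and> (\<forall>f g. h (f * g) = h f * h g)
     \<and> h 1 = 1 \<and> (\<forall>f. h f = 0 \<longrightarrow> f = 0)"

lemma field_embeddingD:
  assumes "field_embedding h"
  shows "h (f + g) = h f + h g" "h (f * g) = h f * h g" "h 1 = 1" "h 0 = 0" "h f = 0 \<longleftrightarrow> f = 0"
proof -
  have "h (0 + 0) = h 0 + h 0" using assms unfolding field_embedding_def by blast
  then show 0: "h 0 = 0" by (metis add.right_neutral add_left_imp_eq)
  then show "h f = 0 \<longleftrightarrow> f = 0" using assms unfolding field_embedding_def by metis
qed (use assms in \<open>auto simp: field_embedding_def\<close>)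

lemma field_embedding_power: "field_embedding h \<Longrightarrow> h (f ^ n) = h f ^ n"
  by (induction n) (simp_all add: field_embeddingD)

lemma field_embedding_sum: "field_embedding h \<Longrightarrow> h (\<Sum>i\<in>I. f i) = (\<Sum>i\<in>I. h (f i))"
  by (induction I rule: infinite_finite_induct) (simp_all add: field_embeddingD)

lemma field_embedding_ev:
  "field_embedding h \<Longrightarrow> c \<noteq> 0 \<Longrightarrow> e > 0 \<Longrightarrow> field_embedding (\<lambda>f. h (ev c e f))"
  using ev_eq_0_iff[of c e] unfolding field_embedding_def by (simp add: ev_ring_hom) blast

section \<open>Torsion points and isogenies\<close>

lemma power_eq_1_coprime_imp:
  fixes \<omega> :: "'a::field"
  assumes "\<omega> ^ N = 1" "\<omega> ^ M = 1" "coprime M N" shows "\<omega> = 1"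
  using powi_eq_1_coprime[of \<omega> "int M" "int N"] assms by simp

lemma dsum_one_nonzero:
  fixes \<omega> :: "'a::{field,char_two}"
  assumes "\<omega> ^ N = 1" "odd N" "\<omega> \<noteq> 1" shows "dsum \<omega> 1 \<noteq> 0"
proof
  have "\<omega> \<noteq> 0" using assms by (auto simp: power_0_left split: if_splits)
  assume "dsum \<omega> 1 = 0"
  then have "\<omega> = inverse \<omega>" by (simp add: dsum_def add_eq_0_iff_char_two power_int_minus)
  then have "\<omega> * \<omega> = \<omega> * inverse \<omega>" by simp
  then have "\<omega> ^ 2 = 1" using \<open>\<omega> \<noteq> 0\<close> by (simp add: power2_eq_square)
  moreover have "coprime 2 N" using assms(2) by simp
  ultimately show False using power_eq_1_coprime_imp[OF assms(1)] assms(3) by blast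
qed

lemma theta_powi_nonzero:
  fixes \<omega> :: "'a::{field,char_two}"
  shows "dsum \<omega> 1 \<noteq> 0 \<Longrightarrow> theta_odd ((powi) \<omega>) \<noteq> 0" "theta_even ((powi) \<omega>) \<noteq> 0"
proof -
  show "dsum \<omega> 1 \<noteq> 0 \<Longrightarrow> theta_odd ((powi) \<omega>) \<noteq> 0"
    unfolding theta_odd_powi by (rule theta_pos_nonzero[of _ 1]) auto
  have "{n::int. (even n \<and> n > 0) \<and> sq n = 0} = {}" by (auto simp: sq_def)
  then have "gf {n. even n \<and> n > 0} sq (dsum \<omega>) $ 0 = 0" by (simp only: gf_nth mem_Collect_eq sum.empty)
  then have "theta_even ((powi) \<omega>) $ 0 = 1" unfolding theta_even_powi by simp
  then show "theta_even ((powi) \<omega>) \<noteq> 0" by auto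
qed

lemma theta_powi_doubling:
  fixes \<omega> :: "'a::{field,char_two}"
  assumes "\<omega> \<noteq> 0"
  shows "theta_one * theta_odd ((powi) (\<omega>\<^sup>2))
      = (theta_odd ((powi) \<omega>) * theta_even ((powi) \<omega>))\<^sup>2"
    "theta_even ((powi) (\<omega>\<^sup>2)) = (theta_odd ((powi) \<omega>) + theta_even ((powi) \<omega>)) ^ 4"
proof -
  have *: "(\<omega>\<^sup>2) powi n = (\<omega> powi n)\<^sup>2" for n
    by (simp add: power2_eq_square power_int_mult_distrib)
  show "theta_one * theta_odd ((powi) (\<omega>\<^sup>2))
      = (theta_odd ((powi) \<omega>) * theta_even ((powi) \<omega>))\<^sup>2"
    by (rule theta_odd_doubling) (use assms in \<open>simp_all add: * power_int_add power_mult_distrib\<close>)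
  show "theta_even ((powi) (\<omega>\<^sup>2)) = (theta_odd ((powi) \<omega>) + theta_even ((powi) \<omega>)) ^ 4"
  proof (rule theta_even_doubling)
    fix m
    have "\<omega> powi (2 * m) = (\<omega> powi m)\<^sup>2"
      using power_int_mult[of \<omega> m 2] by (simp add: mult.commute)
    then show "(\<omega>\<^sup>2) powi (2 * m) = (\<omega> powi m) ^ 4" by (simp add: * flip: power_mult)
  qed
qed

context valuation
begin

text \<open>Squaring permutes the roots of unity of odd order N, and by Euler's theorem the orbit of
  \<open>\<omega>\<close> returns after \<open>totient N\<close> steps, so
  \<open>doubling_unit_ratio\<close> applies.\<close>

lemma theta_unit_ratio:
  fixes \<omega> :: "'k::{field,char_two}" and h :: "'k fps \<Rightarrow> 'a"
  assumes h: "field_embedding h" and \<omega>: "\<omega> ^ N = 1" "odd N" "\<omega> \<noteq> 1"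
    and F: "inverse (h theta_one) \<in> nonunits V"
  shows "h (theta_even ((powi) \<omega>)) / h (theta_odd ((powi) \<omega>)) \<in> V"
    "h (theta_odd ((powi) \<omega>)) / h (theta_even ((powi) \<omega>)) \<in> V"
proof -
  define A where "A i = h (theta_odd ((powi) (\<omega> ^ (2 ^ i))))" for i :: nat
  define B where "B i = h (theta_even ((powi) (\<omega> ^ (2 ^ i))))" for i :: nat
  have \<omega>0: "\<omega> \<noteq> 0" using \<omega> by (auto simp: power_0_left split: if_splits)
  have N: "N > 0" using \<omega>(2) by (cases N) auto
  have \<omega>i: "(\<omega> ^ (2 ^ i)) ^ N = 1" "\<omega> ^ (2 ^ i) \<noteq> 1" for i :: nat
  proof -
    show "(\<omega> ^ (2 ^ i)) ^ N = 1" using \<omega>(1) by (metis mult.commute power_mult power_one)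
    have "coprime (2 ^ i) N" using \<omega>(2) by simp
    then show "\<omega> ^ (2 ^ i) \<noteq> 1" using power_eq_1_coprime_imp[OF \<omega>(1)] \<omega>(3) by blast
  qed
  have nz: "A i \<noteq> 0" "B i \<noteq> 0" for i
    unfolding A_def B_def field_embeddingD(5)[OF h]
    using theta_powi_nonzero dsum_one_nonzero[OF \<omega>i(1) \<omega>(2) \<omega>i(2)] by blast+
  have sq: "\<omega> ^ (2 ^ Suc i) = (\<omega> ^ (2 ^ i))\<^sup>2" for i :: nat by (simp add: mult.commute flip: power_mult)
  have F0: "h theta_one \<noteq> 0"
    unfolding field_embeddingD(5)[OF h] by (rule theta_pos_nonzero[of _ 1]) auto
  have dA: "h theta_one * A (Suc i) = (A i * B i)\<^sup>2" for i
    using theta_powi_doubling(1)[of "\<omega> ^ (2 ^ i)"] \<omega>0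
    unfolding A_def B_def sq by (simp flip: field_embeddingD(2)[OF h] field_embedding_power[OF h])
  have dB: "B (Suc i) = (A i + B i) ^ 4" for i
    using theta_powi_doubling(2)[of "\<omega> ^ (2 ^ i)"] \<omega>0
    unfolding A_def B_def sq by (simp flip: field_embeddingD(1)[OF h] field_embedding_power[OF h])
  have "[2 ^ totient N = 1] (mod N)" using \<omega>(2) by (intro euler_theorem) simp
  then have "N dvd 2 ^ totient N - 1" by (simp add: cong_altdef_nat)
  then obtain k where "2 ^ totient N - 1 = N * k" by (elim dvdE)
  moreover have "(1::nat) \<le> 2 ^ totient N" by simp
  ultimately have k: "2 ^ totient N = 1 + N * k" by linarith
  have "\<omega> ^ (2 ^ totient N) = \<omega>" unfolding k using \<omega>(1) by (simp add: power_add power_mult)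
  then have per: "A (totient N) = A 0" "B (totient N) = B 0" by (simp_all add: A_def B_def)
  have "totient N > 0" using N by simp
  from doubling_unit_ratio[OF F F0 nz dA dB this per]
  show "h (theta_even ((powi) \<omega>)) / h (theta_odd ((powi) \<omega>)) \<in> V"
    "h (theta_odd ((powi) \<omega>)) / h (theta_even ((powi) \<omega>)) \<in> V"
    by (simp_all add: A_def B_def)
qed

text \<open>
  The series \<open>lambert \<omega> = F B(\<omega>) / A(\<omega>)\<close> has the pole of \<open>F\<close>, and it is additive under isogenies:
  its value at \<open>x^p\<close> is a sum of its values at \<open>x\<close>.
\<close>

lemma theta_pos_ev_le:
  fixes \<eta> :: "'k::{field,char_two}" and h :: "'k fps \<Rightarrow> 'a"
  assumes h: "field_embedding h" and p: "prime p" "odd p" and \<eta>: "\<eta> ^ (p * p) = 1" "\<eta> ^ p \<noteq> 1"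
    and F: "inverse (h theta_one) \<in> nonunits V"
  shows "h (ev 1 p theta_one) / h theta_one \<in> V"
proof (rule ccontr)
  let ?F = "theta_one :: 'k fps"
  define h' where "h' f = h (ev 1 p f)" for f
  \<comment> \<open>Arguing by contradiction supplies the pole of F under \<open>h'\<close>, which
    is needed to apply \<open>theta_unit_ratio\<close> to \<open>h'\<close> as well.\<close>
  assume neg: "h (ev 1 p ?F) / h ?F \<notin> V"
  have p0: "p > 0" using p(2) by (cases p) auto
  have h': "field_embedding h'" unfolding h'_def by (rule field_embedding_ev[OF h _ p0]) simp
  have \<eta>0: "\<eta> \<noteq> 0" using \<eta>(1) p0 by (auto simp: power_0_left)
  have F0: "h ?F \<noteq> 0" "h' ?F \<noteq> 0"
    unfolding field_embeddingD(5)[OF h] field_embeddingD(5)[OF h']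
    by (rule theta_pos_nonzero[of _ 1]; simp)+
  have "inverse (h' ?F) = inverse (h' ?F / h ?F) * inverse (h ?F)" using F0 by (simp add: field_simps)
  then have F': "inverse (h' ?F) \<in> nonunits V"
    using nonunits_mult[OF not_inD[OF neg, THEN conjunct2] nonunits_in[OF F]] by (simp only: h'_def)
  have \<zeta>: "(\<eta> ^ p) ^ p = 1" "\<eta> ^ p \<noteq> 1" using \<eta> by (simp_all flip: power_mult)
  have lam: "h'' (lambert \<omega>) = h'' ?F * (h'' (theta_even ((powi) \<omega>)) / h'' (theta_odd ((powi) \<omega>)))"
    if h'': "field_embedding h''" and \<omega>: "\<omega> \<noteq> 0" "dsum \<omega> 1 \<noteq> 0" for h'' :: "'k fps \<Rightarrow> 'a" and \<omega>
  proof -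
    have "h'' ?F * h'' (theta_even ((powi) \<omega>)) = h'' (theta_odd ((powi) \<omega>)) * h'' (lambert \<omega>)"
      using lambert_theta[OF \<omega>] by (simp flip: field_embeddingD(2)[OF h''])
    moreover have "h'' (theta_odd ((powi) \<omega>)) \<noteq> 0"
      unfolding field_embeddingD(5)[OF h''] by (rule theta_powi_nonzero(1)[OF \<omega>(2)])
    ultimately show ?thesis by (simp add: field_simps)
  qed
  \<comment> \<open>These are the p-th roots of \<open>\<eta> ^ p\<close>. Order p^2 is required
    because the target \<open>\<eta> ^ p\<close> must itself be a nontrivial torsion point.\<close>
  have \<omega>i: "((\<eta> ^ p) ^ i * \<eta>) ^ (p * p) = 1" "(\<eta> ^ p) ^ i * \<eta> \<noteq> 1" for i
  proof -
    have *: "(\<eta> ^ p) ^ i * \<eta> = \<eta> ^ (p * i + 1)" by (simp add: power_mult)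
    have "((\<eta> ^ (p * p)) ^ (p * i + 1)) = 1" using \<eta>(1) by simp
    then show "((\<eta> ^ p) ^ i * \<eta>) ^ (p * p) = 1" unfolding * by (metis mult.commute power_mult)
    show "(\<eta> ^ p) ^ i * \<eta> \<noteq> 1"
    proof
      assume "(\<eta> ^ p) ^ i * \<eta> = 1"
      then have "((\<eta> ^ p) ^ p) ^ i * \<eta> ^ p = 1" by (metis mult.commute power_mult power_mult_distrib power_one)
      then show False using \<zeta> by simp
    qed
  qed
  have d: "dsum ((\<eta> ^ p) ^ i * \<eta>) 1 \<noteq> 0" "dsum (\<eta> ^ p) 1 \<noteq> 0" for i
    by (rule dsum_one_nonzero[OF \<omega>i(1) _ \<omega>i(2)], use p in simp, rule dsum_one_nonzero[OF \<zeta>(1) p(2) \<zeta>(2)])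
  have "h' (lambert (\<eta> ^ p)) = (\<Sum>i<p. h (lambert ((\<eta> ^ p) ^ i * \<eta>)))"
    unfolding h'_def lambert_sum[OF p \<zeta> \<eta>0 d, symmetric] by (rule field_embedding_sum[OF h])
  also have "\<dots> = (\<Sum>i<p. h ?F * (h (theta_even ((powi) ((\<eta> ^ p) ^ i * \<eta>))) / h (theta_odd ((powi) ((\<eta> ^ p) ^ i * \<eta>)))))"
    using \<eta>0 d by (intro sum.cong lam h) auto
  finally have "h' (lambert (\<eta> ^ p)) / h ?F
     = (\<Sum>i<p. h (theta_even ((powi) ((\<eta> ^ p) ^ i * \<eta>))) / h (theta_odd ((powi) ((\<eta> ^ p) ^ i * \<eta>))))"
    by (simp only: sum_distrib_left[symmetric] nonzero_mult_div_cancel_left[OF F0(1)])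
  also have "\<dots> \<in> V"
    by (intro V_intros(6) theta_unit_ratio[OF h \<omega>i(1) _ \<omega>i(2) F]) (use p in simp)
  finally have 1: "h' (lambert (\<eta> ^ p)) / h ?F \<in> V" .
  have 2: "h' (theta_odd ((powi) (\<eta> ^ p))) / h' (theta_even ((powi) (\<eta> ^ p))) \<in> V"
    by (rule theta_unit_ratio(2)[OF h' \<zeta>(1) p(2) \<zeta>(2) F'])
  have "h' ?F = h' (lambert (\<eta> ^ p)) * (h' (theta_odd ((powi) (\<eta> ^ p))) / h' (theta_even ((powi) (\<eta> ^ p))))"
    using lam[OF h' _ d(2)] \<eta>0 theta_powi_nonzero[of "\<eta> ^ p"] d(2) by (simp add: field_embeddingD(5)[OF h'])
  then have "h' ?F / h ?F = h' (lambert (\<eta> ^ p)) / h ?F * (h' (theta_odd ((powi) (\<eta> ^ p))) / h' (theta_even ((powi) (\<eta> ^ p))))"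
    by simp
  also have "\<dots> \<in> V" by (intro V_intros(4) 1 2)
  finally show False using neg by (simp add: h'_def)
qed

text \<open>
  Splitting \<open>F\<close> by residues modulo \<open>p\<close> gives \<open>F(x^(p^2))\<close> plus theta series at \<open>p\<close>-torsion points for the
  base \<open>x^(p^2)\<close>, each of which has only a third of the pole of \<open>F(x^(p^2))\<close>.
\<close>

lemma theta_pos_square_level:
  fixes \<xi> :: "'k::{field,char_two}" and h :: "'k fps \<Rightarrow> 'a"
  assumes h: "field_embedding h" and p: "prime p" "odd p" and \<xi>: "\<xi> ^ (p * p) = 1"
    and F: "inverse (h (ev 1 (p * p) theta_one)) \<in> nonunits V"
  shows "h (ev \<xi> 1 theta_one) / h (ev 1 (p * p) theta_one) \<in> V"
    "h (ev 1 (p * p) theta_one) / h (ev \<xi> 1 theta_one) \<in> V"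
proof -
  define \<Phi> where "\<Phi> = h (ev 1 (p * p) theta_one)"
  have p0: "p > 0" using p(2) by (cases p) auto
  have \<xi>0: "\<xi> \<noteq> 0" using \<xi> p0 by (auto simp: power_0_left)
  have base: "theta_pos (cls (int p) \<xi> 0) = ev 1 (p * p) theta_one"
  proof -
    have "theta_pos (cls (int p) \<xi> 0) = gf {n \<in> {n. odd n \<and> n > 0}. int p dvd n} sq (cls (int p) \<xi> 0)"
      unfolding theta_pos_def by (rule gf_restrict[OF fin_fibres_sq]) (simp add: cls_def)
    also have "\<dots> = gf {n. odd n \<and> n > 0} (\<lambda>n. p * p * sq n) (\<lambda>_. 1)"
    proof (rule gf_reindex[symmetric, where h="\<lambda>n. int p * n"])
      show "bij_betw ((*) (int p)) {n. odd n \<and> n > 0} {n \<in> {n. odd n \<and> n > 0}. int p dvd n}"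
        by (rule bij_betwI[where g="\<lambda>n. n div int p"]) (use p p0 in \<open>auto simp: zero_less_mult_iff\<close>)
      fix n
      have "int (sq (int p * n)) = int (p * p * sq n)" by (simp add: power2_eq_square)
      then show e: "sq (int p * n) = p * p * sq n" by (simp only: of_nat_eq_iff)
      show "cls (int p) \<xi> 0 (int p * n) = 1" unfolding cls_def e power_mult[of _ "p * p"] \<xi> by simp
    qed
    also have "\<dots> = ev 1 (p * p) theta_one"
      using p0 by (simp add: theta_pos_def ev_gf)
    finally show ?thesis .
  qed
  have \<Phi>0: "\<Phi> \<noteq> 0" unfolding \<Phi>_def field_embeddingD(5)[OF h] base[symmetric]
    by (rule theta_pos_nonzero[of _ "int p"]) (use p0 p \<xi>0 in \<open>auto simp: cls_def\<close>)
  have small: "h (theta_odd (cls (int p) \<xi> c)) / \<Phi> \<in> nonunits V" if c: "\<not> int p dvd c" for c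
  proof -
    define A where "A i = h (theta_odd (cls (int p) \<xi> (2 ^ i * c)))" for i :: nat
    define B where "B i = h (theta_even (cls (int p) \<xi> (2 ^ i * c)))" for i :: nat
    have ci: "\<not> int p dvd 2 ^ i * c" for i :: nat
      by (induction i) (use c p dvd_double_iff[of "int p"] in \<open>simp_all add: mult.assoc\<close>)
    have nz: "A i \<noteq> 0" "B i \<noteq> 0" for i
      unfolding A_def B_def field_embeddingD(5)[OF h] using theta_cls_nonzero[OF _ ci \<xi>0] p by auto
    have dA: "\<Phi> * A (Suc i) = (A i * B i)\<^sup>2" for i
      using theta_cls_doubling(1)[of "int p" \<xi> "2 ^ i * c"] p unfolding A_def B_def \<Phi>_def base[symmetric]
      by (simp add: mult.assoc flip: field_embeddingD(2)[OF h] field_embedding_power[OF h])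
    have dB: "B (Suc i) = (A i + B i) ^ 4" for i
      using theta_cls_doubling(2)[of "int p" \<xi> "2 ^ i * c"] p unfolding A_def B_def
      by (simp add: mult.assoc flip: field_embeddingD(1)[OF h] field_embedding_power[OF h])
    have "[2 ^ totient p = 1] (mod p)" using p by (intro euler_theorem) simp
    then have "[int (2 ^ totient p) = int 1] (mod int p)" by (simp only: cong_int_iff)
    then have t: "int p dvd 2 ^ totient p - 1" by (simp add: cong_iff_dvd_diff)
    have "int p dvd 2 ^ (totient p + i) * c - 2 ^ i * c" for i
    proof -
      have "2 ^ (totient p + i) * c - 2 ^ i * c = (2 ^ totient p - 1) * (2 ^ i * c)"
        by (simp add: power_add algebra_simps)
      then show ?thesis using t by simp
    qed
    then have per: "A (totient p + i) = A i" "B (totient p + i) = B i" for i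
      unfolding A_def B_def by (simp_all add: cls_cong[of "int p" "2 ^ (totient p + i) * c" "2 ^ i * c"])
    have "totient p > 0" using p0 by simp
    from doubling_size[OF F[folded \<Phi>_def] \<Phi>0 nz dA dB this per] have "A 0 ^ 3 / \<Phi> \<in> V" .
    \<comment> \<open>A pole of at most one third of that of \<open>\<Phi>\<close> is strictly
      smaller than that of \<open>\<Phi>\<close>, so \<open>\<Phi>\<close> dominates the whole
      decomposition.\<close>
    then have "inverse \<Phi> * (inverse \<Phi> * (A 0 ^ 3 / \<Phi>)) \<in> nonunits V"
      by (intro nonunits_mult F[folded \<Phi>_def] V_intros(4) nonunits_in[OF F[folded \<Phi>_def]])
    moreover have "inverse \<Phi> * (inverse \<Phi> * (A 0 ^ 3 / \<Phi>)) = (A 0 / \<Phi>) ^ 3"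
      using \<Phi>0 by (simp add: field_simps power3_eq_cube)
    ultimately have "(A 0 / \<Phi>) ^ 3 \<in> nonunits V" by simp
    then have "A 0 / \<Phi> \<in> nonunits V" by (rule power_nonunit_imp) simp
    then show ?thesis by (simp add: A_def)
  qed
  define H where "H = int p div 2"
  have H: "int p = 2 * H + 1" "H \<ge> 0" using p(2) unfolding H_def by presburger+
  have "ev \<xi> 1 theta_one = theta_pos (\<lambda>n. \<xi> ^ sq n)"
    by (simp add: theta_pos_def ev_gf)
  also have "\<dots> = ev 1 (p * p) theta_one + (\<Sum>c\<in>{1..H}. theta_odd (cls (int p) \<xi> c))"
    unfolding theta_pos_cls_sum[OF H] base ..
  finally have "h (ev \<xi> 1 theta_one) = \<Phi> + (\<Sum>c\<in>{1..H}. h (theta_odd (cls (int p) \<xi> c)))"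
    by (simp add: \<Phi>_def field_embeddingD(1)[OF h] field_embedding_sum[OF h])
  then have e: "h (ev \<xi> 1 theta_one) / \<Phi> = 1 + (\<Sum>c\<in>{1..H}. h (theta_odd (cls (int p) \<xi> c)) / \<Phi>)"
    using \<Phi>0 by (simp add: add_divide_distrib sum_divide_distrib)
  have "(\<Sum>c\<in>{1..H}. h (theta_odd (cls (int p) \<xi> c)) / \<Phi>) \<in> nonunits V"
  proof (rule nonunits_sum, rule small)
    fix c assume "c \<in> {1..H}"
    then show "\<not> int p dvd c" using H by (auto dest: zdvd_imp_le)
  qed
  note * = one_plus_nonunit[OF this, folded e]
  show "h (ev \<xi> 1 theta_one) / h (ev 1 (p * p) theta_one) \<in> V"
    using *(1) by (simp add: \<Phi>_def)
  show "h (ev 1 (p * p) theta_one) / h (ev \<xi> 1 theta_one) \<in> V"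
    using *(2) by (simp add: \<Phi>_def inverse_eq_divide)
qed

end

section \<open>The series \<open>D_k\<close> and their pole orders\<close>

lemma sum_symmetric_difference:
  fixes f :: "'i \<Rightarrow> 'a::char_two"
  assumes "finite U" "finite Y"
  shows "sum f U + sum f Y = sum f ((U - Y) \<union> (Y - U))"
proof -
  have "sum f U = sum f (U - Y) + sum f (U \<inter> Y)" "sum f Y = sum f (Y - U) + sum f (U \<inter> Y)"
    using assms by (subst sum.union_disjoint[symmetric]; force intro!: sum.cong)+
  moreover have "sum f ((U - Y) \<union> (Y - U)) = sum f (U - Y) + sum f (Y - U)"
    using assms by (intro sum.union_disjoint) auto
  ultimately show ?thesis by (simp add: ac_simps)
qed

text \<open>The term of degree \<open>M\<close> may cancel between the two sums, but then the weight \<open>1 + \<delta>\<close> of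
  the second one leaves \<open>\<delta>\<close> behind.\<close>

lemma weighted_sum_lower_bound:
  fixes V :: "'a::{field,char_two} set"
  assumes V: "valuation V" and \<gamma>: "inverse \<gamma> \<in> nonunits V" "\<gamma> \<noteq> 0"
    and \<delta>: "\<delta> \<in> nonunits V" "\<delta> \<noteq> 0" "inverse \<gamma> ^ 2 / \<delta> \<in> nonunits V"
    and fin: "finite U" "finite Y" and M: "M \<in> U \<union> Y" "\<And>m. m \<in> U \<union> Y \<Longrightarrow> m \<le> M"
  defines "z \<equiv> (\<Sum>m\<in>U. \<gamma> ^ (2 * m)) + (1 + \<delta>) * (\<Sum>m\<in>Y. \<gamma> ^ (2 * m))"
  shows "z \<noteq> 0" "\<delta> * \<gamma> ^ (2 * M) / z \<in> V"
proof -
  interpret valuation V by fact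
  define q where "q = inverse \<gamma> ^ 2"
  have q: "q \<in> nonunits V" unfolding q_def using \<gamma> by (intro nonunit_power) auto
  \<comment> \<open>The power sums over \<open>W\<close> divided by their largest possible term;
    \<open>s W\<close> is congruent to 1 or to 0 according to whether M lies in
    \<open>W\<close>.\<close>
  define s where "s W = (\<Sum>m\<in>W. q ^ (M - m))" for W
  have sV: "s W \<in> V" for W unfolding s_def by (intro V_intros(5,6) nonunits_in q)
  have less: "\<exists>v\<in>V. s W = q * v" if "\<And>m. m \<in> W \<Longrightarrow> m < M" for W
  proof (rule bexI)
    have "q ^ (M - m) = q * q ^ (M - m - 1)" if "m < M" for m using that by (metis Suc_diff_1 zero_less_diff power_Suc)
    then show "s W = q * (\<Sum>m\<in>W. q ^ (M - m - 1))"
      unfolding s_def sum_distrib_left using that by (intro sum.cong) auto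
    show "(\<Sum>m\<in>W. q ^ (M - m - 1)) \<in> V" by (intro V_intros(5,6) nonunits_in q)
  qed
  have top: "s W + 1 \<in> nonunits V" if W: "finite W" "M \<in> W" "\<And>m. m \<in> W \<Longrightarrow> m \<le> M" for W
  proof -
    have "s W = 1 + s (W - {M})" unfolding s_def using W by (simp add: sum.remove[of W M])
    moreover obtain v where "v \<in> V" "s (W - {M}) = q * v"
      using less[of "W - {M}"] W by (metis DiffD1 DiffD2 insertI1 le_neq_implies_less)
    ultimately show ?thesis using nonunits_mult[OF q] by (simp add: add.commute add.left_commute)
  qed
  have \<gamma>q: "\<gamma> ^ (2 * m) = \<gamma> ^ (2 * M) * q ^ (M - m)" if mM: "m \<le> M" for m
  proof -
    have "\<gamma>\<^sup>2 * q = 1" using \<gamma>(2) by (simp add: q_def power2_eq_square field_simps)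
    then have *: "(\<gamma>\<^sup>2) ^ k * q ^ k = 1" for k by (metis power_mult_distrib power_one)
    obtain k where k: "M = m + k" using le_Suc_ex[OF mM] by blast
    have "\<gamma> ^ (2 * M) = \<gamma> ^ (2 * m) * (\<gamma>\<^sup>2) ^ k"
      by (simp only: k distrib_left power_add power_mult)
    moreover have "M - m = k" using k by simp
    ultimately show ?thesis by (simp only: mult.assoc * mult_1_right)
  qed
  have sums: "(\<Sum>m\<in>W. \<gamma> ^ (2 * m)) = \<gamma> ^ (2 * M) * s W" if "W \<subseteq> U \<union> Y" for W
    unfolding s_def sum_distrib_left by (intro sum.cong refl \<gamma>q M(2)) (use that in blast)
  define Z where "Z = (U - Y) \<union> (Y - U)"
  define u where "u = s Z + \<delta> * s Y"
  have z: "z = \<gamma> ^ (2 * M) * u"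
  proof -
    have "z = (\<Sum>m\<in>Z. \<gamma> ^ (2 * m)) + \<delta> * (\<Sum>m\<in>Y. \<gamma> ^ (2 * m))"
      unfolding z_def Z_def sum_symmetric_difference[OF fin, symmetric] by (simp add: distrib_right add.assoc)
    also have "\<dots> = \<gamma> ^ (2 * M) * s Z + \<delta> * (\<gamma> ^ (2 * M) * s Y)"
      by (subst (1 2) sums) (auto simp: Z_def)
    finally show ?thesis by (simp add: u_def algebra_simps)
  qed
  have Zfin: "finite Z" "\<And>m. m \<in> Z \<Longrightarrow> m \<le> M" using fin M by (auto simp: Z_def)
  have "u \<noteq> 0 \<and> \<delta> / u \<in> V"
  proof (cases "M \<in> Z")
    case True
    have "s Z + 1 + \<delta> * s Y \<in> nonunits V"
      by (intro nonunits_add top[OF Zfin(1) True Zfin(2)] nonunits_mult \<delta> sV)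
    note * = one_plus_nonunit[OF this]
    have "1 + (s Z + 1 + \<delta> * s Y) = u" by (simp add: u_def ac_simps)
    then have "u \<noteq> 0" "inverse u \<in> V" using * by simp_all
    then show ?thesis using V_intros(4)[OF nonunits_in[OF \<delta>(1)]] by (simp add: divide_inverse)
  next
    case False
    then have MY: "M \<in> Y" using M by (auto simp: Z_def)
    \<comment> \<open>M occurs in both sums and cancels. What is left of the symmetric difference
      has the factor q, negligible against \<open>\<delta>\<close>, so u is \<open>\<delta>\<close>
      times a unit.\<close>
    obtain v where v: "v \<in> V" "s Z = q * v"
      using less[of Z] Zfin(2) False by (metis le_neq_implies_less)
    have "s Y + 1 + q / \<delta> * v \<in> nonunits V"
      by (intro nonunits_add top[OF fin(2) MY M(2)] nonunits_mult v) (use \<delta> in \<open>auto simp: q_def\<close>)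
    note * = one_plus_nonunit[OF this]
    define t where "t = 1 + (s Y + 1 + q / \<delta> * v)"
    have t: "t \<noteq> 0" "inverse t \<in> V" using * by (simp_all only: t_def not_False_eq_True)
    have u: "u = \<delta> * t"
      using \<delta>(2) by (simp add: t_def u_def v field_simps)
    have "\<delta> / u = inverse t" using \<delta>(2) by (simp add: u divide_inverse)
    then show ?thesis using t \<delta>(2) u by simp
  qed
  then show "z \<noteq> 0" "\<delta> * \<gamma> ^ (2 * M) / z \<in> V" unfolding z using \<gamma>(2) by (simp_all add: field_simps)
qed

section \<open>Exponents modulo 5\<close>

lemma fps_power2_nth_char_two:
  fixes f :: "'a::char_two fps"
  shows "(f\<^sup>2) $ (2 * m) = (f $ m)\<^sup>2" "odd n \<Longrightarrow> (f\<^sup>2) $ n = 0"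
proof -
  have f: "f = gf UNIV (\<lambda>n. n) (\<lambda>n. f $ n)" by (rule fps_ext) (simp add: gf_nth)
  have "f\<^sup>2 = gf UNIV (\<lambda>n. 2 * n) (\<lambda>n. (f $ n)\<^sup>2)"
    by (subst f, rule gf_power2) (simp add: fin_fibres_def)
  then have *: "(f\<^sup>2) $ n = (\<Sum>s | 2 * s = n. (f $ s)\<^sup>2)" for n by (simp add: gf_nth)
  have "{s. 2 * s = 2 * m} = {m}" by auto
  then show "(f\<^sup>2) $ (2 * m) = (f $ m)\<^sup>2" unfolding * by simp
  show "(f\<^sup>2) $ n = 0" if "odd n"
  proof -
    have "{s. 2 * s = n} = {}" using that by auto
    then show ?thesis unfolding * by (simp only: sum.empty)
  qed
qed

definition supported :: "nat set \<Rightarrow> 'a::zero fps \<Rightarrow> bool" where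
  "supported C f \<longleftrightarrow> (\<forall>m. f $ m \<noteq> 0 \<longrightarrow> m mod 5 \<in> C)"

lemma supported_mult:
  fixes f g :: "'a::semiring_0 fps"
  assumes "supported A f" "supported B g" "\<And>a b. a \<in> A \<Longrightarrow> b \<in> B \<Longrightarrow> (a + b) mod 5 \<in> C"
  shows "supported C (f * g)"
  unfolding supported_def
proof (intro allI impI)
  fix m assume "(f * g) $ m \<noteq> 0"
  then obtain i where i: "i \<in> {0..m}" "f $ i * g $ (m - i) \<noteq> 0"
    unfolding fps_mult_nth by (rule sum.not_neutral_contains_not_neutral)
  then have "f $ i \<noteq> 0" "g $ (m - i) \<noteq> 0" by (metis mult_zero_left, metis mult_zero_right)
  then have "i mod 5 \<in> A" "(m - i) mod 5 \<in> B" using assms(1,2) by (auto simp: supported_def)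
  from assms(3)[OF this] show "m mod 5 \<in> C" using i(1) by (simp add: mod_add_eq)
qed

lemma supported_add: "supported C f \<Longrightarrow> supported C g \<Longrightarrow> supported C (f + g)"
  for f g :: "'a::monoid_add fps"
  unfolding supported_def by (metis fps_add_nth add_0_left)

lemma supported_sum: "(\<And>i. i \<in> I \<Longrightarrow> supported C (f i)) \<Longrightarrow> supported C (\<Sum>i\<in>I. f i)"
  for f :: "'i \<Rightarrow> 'a::comm_monoid_add fps"
  by (induction I rule: infinite_finite_induct) (auto simp: supported_add, auto simp: supported_def)

text \<open>Squaring only doubles exponents, hence an equivalence. Read backwards it determines the
  exponents of a series from those of its square, as is done for D_3.\<close>

lemma supported_power2:
  fixes f :: "'a::{idom,char_two} fps"
  shows "supported {2, 3} (f\<^sup>2) \<longleftrightarrow> supported {1, 4} f" "supported {1, 4} (f\<^sup>2) \<longleftrightarrow> supported {2, 3} f"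
proof -
  have "(2 * m) mod 5 \<in> {2, 3} \<longleftrightarrow> m mod 5 \<in> {1, 4}" "(2 * m) mod 5 \<in> {1, 4} \<longleftrightarrow> m mod 5 \<in> {2, 3}" for m :: nat
    by (simp_all, presburger+)
  moreover have "(\<forall>n. (f\<^sup>2) $ n \<noteq> 0 \<longrightarrow> P n) \<longleftrightarrow> (\<forall>m. f $ m \<noteq> 0 \<longrightarrow> P (2 * m))" for P
    using fps_power2_nth_char_two[where f=f] by (metis evenE zero_eq_power2)
  ultimately show "supported {2, 3} (f\<^sup>2) \<longleftrightarrow> supported {1, 4} f" "supported {1, 4} (f\<^sup>2) \<longleftrightarrow> supported {2, 3} f"
    unfolding supported_def by simp_all
qed

section \<open>The given series as theta series, and the D_k in terms of D and G\<close>

lemma gf_sq_nth: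
  "gf {n. P n \<and> n > 0} sq (\<lambda>_. 1) $ m = of_bool (\<exists>n>0. P n \<and> m = sq n)"
proof (cases "\<exists>n>0. P n \<and> m = sq n")
  case True
  then obtain n where n: "n > 0" "P n" "m = sq n" by auto
  have "n' = n" if "sq n' = sq n" "n' > 0" for n'
  proof -
    have "n'\<^sup>2 = n\<^sup>2" using that(1) by (metis int_sq)
    then show ?thesis using that n(1) by (auto simp: power2_eq_iff)
  qed
  then have "{n'. (P n' \<and> n' > 0) \<and> sq n' = m} = {n}" using n by auto
  then show ?thesis using True by (simp add: gf_nth)
next
  case False
  then have "{n'. (P n' \<and> n' > 0) \<and> sq n' = m} = {}" by auto
  then show ?thesis using False by (simp only: gf_nth mem_Collect_eq sum.empty of_bool_eq)
qed

lemma ex_int_pos_iff: "(\<exists>n::int>0. P n) \<longleftrightarrow> (\<exists>n::nat>0. P (int n))"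
  by (metis of_nat_0_less_iff zero_less_imp_eq_int)

lemma F_eq: "F = theta_one"
proof (rule fps_ext)
  fix m
  have "(\<exists>n::nat. odd n \<and> n > 0 \<and> m = n^2) \<longleftrightarrow> (\<exists>n>0. odd n \<and> m = sq n)"
    unfolding ex_int_pos_iff by (auto simp: sq_def nat_power_eq)
  then show "F $ m = theta_one $ m"
    unfolding theta_pos_def gf_sq_nth by (simp add: F_def)
qed

lemma G_eq: "G = ev 1 5 theta_one"
  unfolding F_eq[symmetric] by (rule fps_ext) (simp add: G_def ev_def)

lemma coprime_10_iff: "coprime n 10 \<longleftrightarrow> odd n \<and> \<not> 5 dvd (n::nat)"
proof -
  have "coprime n (2 * 5) \<longleftrightarrow> coprime n 2 \<and> coprime n 5" by (rule coprime_mult_right_iff)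
  moreover have "coprime n 5 \<longleftrightarrow> \<not> 5 dvd n"
    using prime_imp_coprime[of 5 n] by (auto simp: coprime_commute)
  ultimately show ?thesis by simp
qed

lemma D_eq: "D = theta_D"
proof (rule fps_ext)
  fix m
  have "(\<exists>n::nat. n > 0 \<and> coprime n 10 \<and> m = n^2) \<longleftrightarrow> (\<exists>n>0. (odd n \<and> \<not> 5 dvd n) \<and> m = sq n)"
  proof -
    have "5 dvd int n \<longleftrightarrow> 5 dvd n" for n using int_dvd_int_iff[of 5 n] by simp
    then show ?thesis
      unfolding ex_int_pos_iff coprime_10_iff by (auto simp: sq_def nat_power_eq)
  qed
  moreover have "{n::int. odd n \<and> n > 0 \<and> \<not> 5 dvd n} = {n. (odd n \<and> \<not> 5 dvd n) \<and> n > 0}" by auto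
  ultimately show "D $ m = theta_D $ m"
    unfolding theta_D_def by (simp only: gf_sq_nth) (simp add: D_def)
qed

lemma D_relation: "D ^ 15 = G ^ 4 * D ^ 3 + G ^ 3"
  unfolding D_eq G_eq by (rule theta_D_relation)

lemma D_nth_low: "D $ 0 = 0" "D $ 1 = 1"
  by (auto simp: D_def intro: exI[of _ 1])

lemma subdegree_D: "subdegree D = 1"
  by (rule subdegreeI) (use D_nth_low in auto)

lemma G_nth_low: "G $ 5 = 1" "n < 5 \<Longrightarrow> G $ n = 0"
proof -
  have "\<exists>n::nat. odd n \<and> 0 < n \<and> 1 = n\<^sup>2" by (rule exI[of _ 1]) simp
  then show "G $ 5 = 1" by (simp add: G_def F_def)
  assume "n < 5"
  then have "5 dvd n \<longleftrightarrow> n = 0" by auto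
  then show "G $ n = 0" by (simp add: G_def F_def)
qed

lemma subdegree_G: "subdegree G = 5"
  by (rule subdegreeI) (use G_nth_low in auto)

lemma D_G_nonzero: "D \<noteq> 0" "G \<noteq> 0"
  using D_nth_low(2) G_nth_low(1) by auto

text \<open>The quotient defining D_3 is exact because D^8 has order 8 at x = 0 and G only
  5.\<close>

lemma Dk_3: "Dk 3 * G = D ^ 8"
proof -
  have "subdegree (D ^ 8) = 8" using D_G_nonzero by (simp add: subdegree_D subdegree_power)
  then have "G dvd D ^ 8" using D_G_nonzero by (simp add: fps_dvd_iff subdegree_G)
  then show ?thesis by simp
qed

lemma Dk_simps [simp]: "Dk (Suc 0) = D" "Dk 7 = D\<^sup>2 * G" "Dk 9 = D ^ 4 * G"
  by simp_all

lemma Dk_shift: "r < 10 \<Longrightarrow> Dk (10 * m + r) = G ^ (2 * m) * Dk r"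
proof (induction m)
  case (Suc m)
  have "Dk (10 * Suc m + r) = G\<^sup>2 * Dk (10 * m + r)"
    by (subst Dk.simps) (simp add: add.commute)
  then show ?case using Suc by (simp add: power_add power2_eq_square mult.assoc del: Dk.simps)
qed (simp del: Dk.simps)

declare Dk.simps [simp del]

lemma coprime_10_mod_cases:
  assumes "coprime n (10::nat)"
  obtains "n mod 10 = 1" | "n mod 10 = 3" | "n mod 10 = 7" | "n mod 10 = 9"
proof -
  have "odd n" "\<not> 5 dvd n" using assms by (simp_all add: coprime_10_iff)
  then have "n mod 10 = 1 \<or> n mod 10 = 3 \<or> n mod 10 = 7 \<or> n mod 10 = 9" by presburger
  then show ?thesis using that by blast
qed

lemma Dk_mod: "Dk n = G ^ (2 * (n div 10)) * Dk (n mod 10)"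
  using Dk_shift[of "n mod 10" "n div 10"] by simp

text \<open>A bound on the pole of G from above says nothing about D^8 / G. The relation between D
  and G removes the denominator from the cube.\<close>

lemma Dk_3_power3: "Dk 3 ^ 3 = D ^ 9 * (G * D ^ 3 + 1)"
proof -
  have "Dk 3 ^ 3 * G ^ 3 = D ^ 9 * D ^ 15"
    by (simp add: Dk_3 flip: power_mult_distrib power_mult power_add)
  also have "\<dots> = D ^ 9 * (G * D ^ 3 + 1) * G ^ 3"
    unfolding D_relation by (simp add: algebra_simps eval_nat_numeral)
  finally show ?thesis using D_G_nonzero by simp
qed

text \<open>The same removal of the denominator, in the form from which the exponents of D_3 modulo
  5 are read off.\<close>

lemma Dk_3_power2: "(Dk 3)\<^sup>2 = G\<^sup>2 * D ^ 4 + G * D"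
proof -
  have "(Dk 3)\<^sup>2 * G\<^sup>2 = D * D ^ 15"
    by (simp add: Dk_3 flip: power_mult_distrib power_mult power_Suc)
  also have "\<dots> = (G\<^sup>2 * D ^ 4 + G * D) * G\<^sup>2"
    unfolding D_relation by (simp add: algebra_simps eval_nat_numeral)
  finally show ?thesis using D_G_nonzero by simp
qed

lemma supported_D: "supported {1, 4} D"
  unfolding supported_def
proof (intro allI impI)
  fix m assume "D $ m \<noteq> 0"
  then obtain n where n: "coprime n 10" "m = n\<^sup>2" by (auto simp: D_def split: if_splits)
  have "n\<^sup>2 mod 5 = (n mod 5)\<^sup>2 mod 5" by (simp add: power_mod)
  moreover have "n mod 5 = 1 \<or> n mod 5 = 2 \<or> n mod 5 = 3 \<or> n mod 5 = 4"
    using n(1) unfolding coprime_10_iff by presburger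
  ultimately show "m mod 5 \<in> {1, 4}" using n(2) by auto
qed

lemma supported_G: "supported {0} G"
  by (auto simp: supported_def G_def split: if_splits)

lemma supported_mult_G:
  assumes "supported C f" "C \<subseteq> {..<5}" shows "supported C (f * G ^ n)"
proof (induction n)
  case (Suc n)
  have "supported C (f * G ^ n * G)"
    by (rule supported_mult[OF Suc supported_G]) (use assms(2) in auto)
  then show ?case by (simp add: ac_simps)
qed (simp add: assms)

lemma supported_Dk:
  assumes "coprime n 10"
  shows "n mod 10 \<in> {1, 9} \<Longrightarrow> supported {1, 4} (Dk n)" "n mod 10 \<in> {3, 7} \<Longrightarrow> supported {2, 3} (Dk n)"
proof -
  have D2: "supported {2, 3} (D\<^sup>2)" using supported_D supported_power2 by blast
  have "supported {1, 4} ((D\<^sup>2)\<^sup>2)" using D2 supported_power2 by blast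
  then have D4: "supported {1, 4} (D ^ 4)" by (simp flip: power_mult)
  have "supported {1, 4} (D ^ 4 * G ^ 2 + D * G ^ 1)"
    by (intro supported_add supported_mult_G D4 supported_D) auto
  then have "supported {1, 4} ((Dk 3)\<^sup>2)" unfolding Dk_3_power2 by (simp add: mult.commute)
  then have D3: "supported {2, 3} (Dk 3)" using supported_power2 by blast
  have D7: "supported {2, 3} (Dk 7)" using supported_mult_G[OF D2, of 1] by simp
  have D9: "supported {1, 4} (Dk 9)" using supported_mult_G[OF D4, of 1] by simp
  show "n mod 10 \<in> {1, 9} \<Longrightarrow> supported {1, 4} (Dk n)"
    unfolding Dk_mod[of n] mult.commute[of "G ^ _"] by (rule supported_mult_G) (use supported_D D9 in auto)
  show "n mod 10 \<in> {3, 7} \<Longrightarrow> supported {2, 3} (Dk n)"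
    unfolding Dk_mod[of n] mult.commute[of "G ^ _"] by (rule supported_mult_G) (use D3 D7 in auto)
qed

text \<open>A nonzero coefficient of T_p f at m comes from an exponent p m or m / p of f. As p is 2
  or - 2 modulo 5, both multiplication and division by p exchange the squares 1, 4 with the
  nonsquares 2, 3.\<close>

lemma supported_Tp:
  assumes "p mod 5 \<in> {2, 3}"
  shows "supported {1, 4} f \<Longrightarrow> supported {2, 3} (Tp p f)" "supported {2, 3} f \<Longrightarrow> supported {1, 4} (Tp p f)"
proof -
  have mod: "(p * m) mod 5 = (if p mod 5 = 2 then 2 * (m mod 5) mod 5 else 3 * (m mod 5) mod 5)" for m
    using assms by (metis empty_iff insert_iff mod_mult_eq mod_mult_right_eq)
  have m5: "m mod 5 \<in> {0, 1, 2, 3, 4}" for m :: nat by (simp, presburger)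
  have key: "(p * m) mod 5 \<in> {1, 4} \<longleftrightarrow> m mod 5 \<in> {2, 3}" "(p * m) mod 5 \<in> {2, 3} \<longleftrightarrow> m mod 5 \<in> {1, 4}" for m
    unfolding mod using m5[of m] by auto
  have *: "f $ (p * m) \<noteq> 0 \<or> (\<exists>l. m = p * l \<and> f $ l \<noteq> 0)" if "Tp p f $ m \<noteq> 0" for m
  proof (cases "p dvd m \<and> f $ (m div p) \<noteq> 0")
    case True
    then show ?thesis by (intro disjI2 exI[of _ "m div p"]) auto
  next
    case False
    then show ?thesis using that by (auto simp: Tp_def split: if_splits)
  qed
  show "supported {1, 4} f \<Longrightarrow> supported {2, 3} (Tp p f)" "supported {2, 3} f \<Longrightarrow> supported {1, 4} (Tp p f)"
    unfolding supported_def using * key by metis+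
qed

section \<open>T_p as a sum of p + 1 substitutions over the algebraic closure\<close>

instance alg_closure :: ("{field,char_two}") char_two
proof
  have "to_ac (1 + 1 :: 'a) = 0" by (simp only: add_self_char_two to_ac_0)
  then show "1 + 1 = (0 :: 'a alg_closure)" by (simp only: to_ac_add to_ac_1)
qed

definition lift_ac :: "'a::field fps \<Rightarrow> 'a alg_closure fps" where
  "lift_ac f = Abs_fps (\<lambda>n. to_ac (f $ n))"

lemma lift_ac_hom:
  "lift_ac (f + g) = lift_ac f + lift_ac g" "lift_ac (f * g) = lift_ac f * lift_ac g" "lift_ac 1 = 1"
  "lift_ac f = 0 \<longleftrightarrow> f = 0"
  by (simp_all add: fps_eq_iff lift_ac_def fps_mult_nth to_ac_sum)

lemma lift_ac_gf: "lift_ac (gf S d (\<lambda>_. 1)) = gf S d (\<lambda>_. 1)"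
  by (rule fps_ext) (simp add: lift_ac_def gf_nth to_ac_sum)

lemma lift_ac_ev: "lift_ac (ev 1 e f) = ev 1 e (lift_ac f)"
  by (rule fps_ext) (simp add: lift_ac_def ev_def)

lemma field_embedding_lift_ac:
  assumes "field_embedding h" shows "field_embedding (\<lambda>f. h (lift_ac f))"
  unfolding field_embedding_def
  by (simp add: lift_ac_hom field_embeddingD[OF assms])

lemma field_embedding_fps_to_fls: "field_embedding fps_to_fls"
  by (simp add: field_embedding_def fls_times_fps_to_fls)

text \<open>Averaging over the p-th roots of unity selects the exponents divisible by p. The
  substitution x^p on the left avoids fractional powers, and p = 1 in characteristic 2 avoids a
  factor 1/p.\<close>

lemma Tp_lift_ac:
  fixes f :: "bit fps"
  assumes p: "prime p" "odd p" and \<zeta>: "\<zeta> ^ p = 1" "\<zeta> \<noteq> 1"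
  shows "ev 1 p (lift_ac (Tp p f)) = ev 1 (p * p) (lift_ac f) + (\<Sum>i<p. ev (\<zeta> ^ i) 1 (lift_ac f))"
proof (rule fps_ext)
  fix n
  have p0: "p > 0" using p(2) by (cases p) auto
  have "(\<Sum>i<p. (\<zeta> ^ i) ^ n) = (if p dvd n then 1 else 0)"
    using sum_roots_of_unity_powi[OF p \<zeta>, of "int n"] by simp
  then have s: "(\<Sum>i<p. ev (\<zeta> ^ i) 1 (lift_ac f)) $ n = (if p dvd n then to_ac (f $ n) else 0)"
    by (simp add: fps_sum_nth ev_def lift_ac_def flip: sum_distrib_right)
  show "ev 1 p (lift_ac (Tp p f)) $ n = (ev 1 (p * p) (lift_ac f) + (\<Sum>i<p. ev (\<zeta> ^ i) 1 (lift_ac f))) $ n"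
  proof (cases "p dvd n")
    case True
    then obtain m where n: "n = p * m" by auto
    have "p * p dvd p * m \<longleftrightarrow> p dvd m" using p0 by simp
    moreover have "(p * m) div (p * p) = m div p" using p0 by simp
    ultimately show ?thesis using p0 unfolding fps_add_nth s
      by (simp add: n ev_def lift_ac_def Tp_def add.commute)
  next
    case False
    then have "\<not> p * p dvd n" using dvd_mult_left by blast
    then show ?thesis using False unfolding fps_add_nth s by (simp add: ev_def)
  qed
qed

lemma ev_sum: "e > 0 \<Longrightarrow> ev c e (\<Sum>i\<in>I. f i) = (\<Sum>i\<in>I. ev c e (f i))"
proof (induction I rule: infinite_finite_induct)
qed (simp_all add: ev_ring_hom, simp_all add: ev_def fps_eq_iff)

text \<open>One more substitution x^p puts T_p f at the base x^(p^2). Then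
  f(\<open>\<zeta>\<close>^i x^p) can be compared with f(x^(p^2)) by way of f at a p^2-th root of
  unity times x.\<close>

lemma Tp_embeddings:
  fixes f :: "bit fps"
  assumes p: "prime p" "odd p" and \<zeta>: "\<zeta> ^ p = 1" "\<zeta> \<noteq> 1"
  shows "ev 1 (p * p) (lift_ac (Tp p f)) = ev 1 (p * (p * p)) (lift_ac f) + (\<Sum>i<p. ev (\<zeta> ^ i) p (lift_ac f))"
proof -
  have p0: "p > 0" using p(2) by (cases p) auto
  have "ev 1 (p * p) (lift_ac (Tp p f)) = ev 1 p (ev 1 p (lift_ac (Tp p f)))"
    using p0 by (simp add: ev_ev)
  also have "\<dots> = ev 1 (p * (p * p)) (lift_ac f) + (\<Sum>i<p. ev (\<zeta> ^ i) p (lift_ac f))"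
    unfolding Tp_lift_ac[OF p \<zeta>] using p0 by (simp add: ev_ring_hom ev_sum ev_ev)
  finally show ?thesis .
qed

lemma exists_root_of_unity_square:
  assumes p: "prime p" "odd p"
  obtains \<eta> :: "bit alg_closure" where "\<eta> ^ (p * p) = 1" "\<eta> ^ p \<noteq> 1"
proof -
  have p2: "p \<ge> 2" using p(1) prime_ge_2_nat by blast
  \<comment> \<open>A root of the p-th cyclotomic polynomial; it differs from 1 because the
    polynomial takes the value p = 1 there.\<close>
  obtain \<zeta> :: "bit alg_closure" where \<zeta>: "(\<Sum>k\<le>p - 1. 1 * \<zeta> ^ k) = 0"
    using alg_closed[of "p - 1" "\<lambda>_. 1 :: bit alg_closure"] p2 by auto
  then have \<zeta>s: "(\<Sum>k<p. \<zeta> ^ k) = 0"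
    using p2 by (metis (no_types, lifting) Suc_diff_1 lessThan_Suc_atMost mult_1 pos2 less_le_trans sum.cong)
  have \<zeta>1: "\<zeta> \<noteq> 1"
  proof
    assume "\<zeta> = 1"
    then have "of_nat p = (0 :: bit alg_closure)" using \<zeta>s by simp
    then show False using of_nat_odd_char_two[OF p(2), where 'a="bit alg_closure"] by simp
  qed
  have \<zeta>p: "\<zeta> ^ p = 1"
    using \<zeta>s \<zeta>1 by (simp add: sum_gp_strict)
  define f where "f k = (if k = p then 1 else if k = 0 then - \<zeta> else 0)" for k
  obtain \<eta> where "(\<Sum>k\<le>p. f k * \<eta> ^ k) = 0"
    using alg_closed[of p f] p2 by (auto simp: f_def)
  moreover have "(\<Sum>k\<le>p. f k * \<eta> ^ k) = (\<Sum>k\<in>{0, p}. f k * \<eta> ^ k)"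
    by (rule sum.mono_neutral_right) (auto simp: f_def)
  moreover have "(\<Sum>k\<in>{0, p}. f k * \<eta> ^ k) = \<eta> ^ p - \<zeta>"
    using p2 by (simp add: f_def)
  ultimately have "\<eta> ^ p = \<zeta>" by simp
  then show ?thesis using that[of \<eta>] \<zeta>1 \<zeta>p by (simp add: power_mult)
qed

text \<open>A power series y without constant term is transcendental over the constants, so s = 1/y
  is no unit of the polynomial ring in s, and Chevalley's theorem gives a place where y has a pole
  although y vanishes at x = 0.\<close>

lemma valuation_exists_pole:
  fixes y :: "'k::field fps"
  assumes y: "y \<noteq> 0" "y $ 0 = 0"
  obtains V where "valuation V" "inverse (fps_to_fls y) \<in> nonunits V"
proof -
  define s where "s = inverse (fps_to_fls y)"
  let ?M = "range (fls_const :: 'k \<Rightarrow> 'k fls)"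
  have M: "subring_set ?M"
    unfolding subring_set_def
    by (auto simp: image_iff fls_plus_const fls_const_mult_const simp flip: fls_const_0 fls_const_1 fls_const_uminus
       intro: exI[of _ 0] exI[of _ 1])
  let ?A = "{poly q s |q. \<forall>i. coeff q i \<in> ?M}"
  have sA: "s \<in> ?A"
  proof -
    have "\<forall>i. coeff [:0, 1 :: 'k fls:] i \<in> ?M"
      using subring_setD(1,2)[OF M] by (auto simp: coeff_pCons split: nat.split)
    moreover have "s = poly [:0, 1:] s" by simp
    ultimately show ?thesis by blast
  qed
  have no: "s * a \<noteq> 1" if aA: "a \<in> ?A" for a
  proof
    assume sa: "s * a = 1"
    obtain q where q: "a = poly q s" "\<forall>i. coeff q i \<in> ?M" using aA by auto
    obtain c where c: "\<And>i. coeff q i = fls_const (c i)" using q(2) unfolding image_iff by metis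
    define n where "n = degree q"
    define Y where "Y = fps_to_fls y"
    have Y: "Y \<noteq> 0" "s * Y = 1" using y by (simp_all add: Y_def s_def)
    have sY: "s ^ i * Y ^ n = Y ^ (n - i)" if "i \<le> n" for i
    proof -
      obtain k where "n = i + k" using le_Suc_ex[OF \<open>i \<le> n\<close>] by blast
      then show ?thesis using Y(2) by (simp add: power_add mult.assoc[symmetric] flip: power_mult_distrib)
    qed
    have "Y ^ Suc n = (s * a) * Y ^ Suc n" using sa by simp
    also have "\<dots> = (s * Y) * (a * Y ^ n)" by (simp add: ac_simps)
    also have "a * Y ^ n = (\<Sum>i\<le>n. coeff q i * (s ^ i * Y ^ n))"
      by (simp add: q(1) poly_altdef n_def sum_distrib_right mult.assoc)
    also have "\<dots> = (\<Sum>i\<le>n. coeff q i * Y ^ (n - i))"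
      by (intro sum.cong) (auto simp: sY)
    also have "\<dots> = fps_to_fls (\<Sum>i\<le>n. fps_const (c i) * y ^ (n - i))"
      by (simp add: field_embedding_sum[OF field_embedding_fps_to_fls] fls_times_fps_to_fls fps_to_fls_power c Y_def)
    finally have "fps_to_fls (y ^ Suc n) = fps_to_fls (\<Sum>i\<le>n. fps_const (c i) * y ^ (n - i))"
      using Y by (simp only: mult_1_left fps_to_fls_power Y_def)
    \<comment> \<open>At x = 0 every positive power of y vanishes, and only the leading coefficient
      of q remains.\<close>
    then have "(y ^ Suc n) $ 0 = (\<Sum>i\<le>n. fps_const (c i) * y ^ (n - i)) $ 0"
      by (simp only: fps_to_fls_eq_iff)
    also have "\<dots> = (\<Sum>i\<le>n. if i = n then c n else 0)"
      unfolding fps_sum_nth by (intro sum.cong) (use y(2) in \<open>auto simp: power_0_left\<close>)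
    finally have "c n = 0" using y(2) by simp
    then have "lead_coeff q = 0" using c[of n] by (simp add: n_def)
    then have "q = 0" by simp
    then show False using sa q(1) by simp
  qed
  obtain V where "valuation_ring V" "?A \<subseteq> V" "s \<in> nonunits V"
    by (rule valuation_ring_exists[OF subring_set_adjoin[OF M] sA no])
  then show ?thesis using that unfolding valuation_def s_def by blast
qed

text \<open>Three times the expected pole of D_n in units of that of G, when D counts 1/3: each
  factor G^2 gives 6, D gives 1, D^4 G gives 4 + 3, and D^2 G and D^8 / G both give 5.\<close>

definition size_exp :: "nat \<Rightarrow> nat" where
  "size_exp n = 6 * (n div 10) + (if n mod 10 = 1 then 1 else if n mod 10 = 9 then 7 else 5)"

text \<open>Dividing the relation between D and G by \<open>\<gamma> ^ 5\<close> shows that u = D^3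
  / \<open>\<gamma>\<close> is a root of a monic polynomial over \<open>V\<close>, hence lies in
  \<open>V\<close>. Only an upper bound for G is assumed, so that the result applies to all
  conjugates.\<close>

lemma Dk_size_bound:
  fixes V :: "'b::field set"
  assumes V: "valuation V" and e: "field_embedding e" and \<gamma>: "inverse \<gamma> \<in> nonunits V" "\<gamma> \<noteq> 0"
    and G: "e G / \<gamma> \<in> V" and n: "coprime n 10"
  shows "e (Dk n) ^ 3 / \<gamma> ^ size_exp n \<in> V"
proof -
  interpret valuation V by fact
  define u where "u = e D ^ 3 / \<gamma>"
  define v where "v = e G / \<gamma>"
  have d: "e D ^ 3 = u * \<gamma>" and g: "e G = v * \<gamma>" using \<gamma> by (simp_all add: u_def v_def)
  have vV: "v \<in> V" using G by (simp add: v_def)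
  have i\<gamma>: "inverse \<gamma> \<in> V" by (rule nonunits_in[OF \<gamma>(1)])
  have "e (D ^ 15) = e (G ^ 4 * D ^ 3 + G ^ 3)" by (simp only: D_relation)
  then have "(e D ^ 3) ^ 5 = e G ^ 4 * e D ^ 3 + e G ^ 3"
    by (simp add: field_embeddingD[OF e] field_embedding_power[OF e] flip: power_mult)
  then have "u ^ 5 * \<gamma> ^ 5 = (v ^ 4 * u + v ^ 3 * inverse \<gamma> ^ 2) * \<gamma> ^ 5"
    unfolding d g using \<gamma>(2) by (simp add: power_mult_distrib field_simps) (simp add: eval_nat_numeral algebra_simps)
  then have u5: "u ^ 5 = v ^ 4 * u + v ^ 3 * inverse \<gamma> ^ 2" using \<gamma>(2) by simp
  have uV: "u \<in> V"
  proof (rule ccontr)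
    assume "u \<notin> V"
    then have u: "u \<noteq> 0" "inverse u \<in> nonunits V" using not_inD by auto
    have "inverse u * (v ^ 4 * inverse u ^ 3) + inverse u * (inverse u ^ 4 * (v ^ 3 * inverse \<gamma> ^ 2)) \<in> nonunits V"
      by (intro nonunits_add nonunits_mult u V_intros(4,5) vV i\<gamma> nonunits_in[OF u(2)])
    also have "inverse u * (v ^ 4 * inverse u ^ 3) + inverse u * (inverse u ^ 4 * (v ^ 3 * inverse \<gamma> ^ 2))
        = (v ^ 4 * u + v ^ 3 * inverse \<gamma> ^ 2) * inverse u ^ 5"
      using u(1) by (simp add: field_simps) (simp add: eval_nat_numeral)
    also have "\<dots> = 1" unfolding u5[symmetric] using u(1) by (simp flip: power_mult_distrib)
    finally show False using one_not_nonunit by simp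
  qed
  define r where "r = n mod 10"
  define m where "m = n div 10"
  have eDk: "e (Dk n) ^ 3 = e G ^ (6 * m) * e (Dk r) ^ 3"
    unfolding Dk_mod[of n] by (simp add: field_embeddingD[OF e] field_embedding_power[OF e] r_def m_def power_mult_distrib flip: power_mult)
  have gm: "e G ^ (6 * m) / \<gamma> ^ (6 * m) \<in> V"
    unfolding g by (simp add: power_mult_distrib \<gamma> V_intros(5) vV)
  have "e (Dk r) ^ 3 / \<gamma> ^ (if r = 1 then 1 else if r = 9 then 7 else 5) \<in> V"
    using n
  proof (cases rule: coprime_10_mod_cases)
    case 1
    then show ?thesis using uV by (simp add: r_def u_def)
  next
    case 2
    have "e (Dk 3 ^ 3) = (e D ^ 3) ^ 3 * (e G * e D ^ 3 + 1)"
      unfolding Dk_3_power3 by (simp add: field_embeddingD[OF e] field_embedding_power[OF e] flip: power_mult)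
    also have "\<dots> = \<gamma> ^ 5 * (u ^ 3 * (v * u + inverse \<gamma> ^ 2))"
      unfolding d g using \<gamma>(2) by (simp add: field_simps) (simp add: eval_nat_numeral algebra_simps)
    finally have "e (Dk 3) ^ 3 / \<gamma> ^ 5 = u ^ 3 * (v * u + inverse \<gamma> ^ 2)"
      using \<gamma>(2) by (simp add: field_embedding_power[OF e])
    also have "\<dots> \<in> V" by (intro V_intros(3,4,5) uV vV i\<gamma>)
    finally show ?thesis using 2 by (simp add: r_def)
  next
    case 3
    have "e (Dk 7) ^ 3 = (e D ^ 3) ^ 2 * e G ^ 3"
      by (simp add: field_embeddingD[OF e] field_embedding_power[OF e] power_mult_distrib flip: power_mult)
    also have "\<dots> = \<gamma> ^ 5 * (u ^ 2 * v ^ 3)" unfolding d g by (simp add: power_mult_distrib)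
    finally have "e (Dk 7) ^ 3 / \<gamma> ^ 5 = u ^ 2 * v ^ 3" using \<gamma>(2) by simp
    also have "\<dots> \<in> V" by (intro V_intros(4,5) uV vV)
    finally show ?thesis using 3 by (simp add: r_def)
  next
    case 4
    have "e (Dk 9) ^ 3 = (e D ^ 3) ^ 4 * e G ^ 3"
      by (simp add: field_embeddingD[OF e] field_embedding_power[OF e] power_mult_distrib flip: power_mult)
    also have "\<dots> = \<gamma> ^ 7 * (u ^ 4 * v ^ 3)" unfolding d g by (simp add: power_mult_distrib)
    finally have "e (Dk 9) ^ 3 / \<gamma> ^ 7 = u ^ 4 * v ^ 3" using \<gamma>(2) by simp
    also have "\<dots> \<in> V" by (intro V_intros(4,5) uV vV)
    finally show ?thesis using 4 by (simp add: r_def)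
  qed
  from V_intros(4)[OF gm this] show ?thesis
    unfolding eDk size_exp_def r_def[symmetric] m_def[symmetric] power_add by simp
qed


section \<open>Cancellation among the D_k at the place where \<open>\<epsilon>\<close>
  vanishes\<close>

context
  fixes V :: "'b::{field,char_two} set" and e :: "bit fps \<Rightarrow> 'b" and \<gamma> \<epsilon> :: 'b
  assumes V: "valuation V" and e: "field_embedding e"
  defines "\<gamma> \<equiv> e G" and "\<epsilon> \<equiv> e D ^ 3 / e G + 1"
  assumes \<epsilon>: "\<epsilon> \<in> nonunits V"
begin

interpretation valuation V by fact

lemma gamma_nonzero: "\<gamma> \<noteq> 0"
  unfolding \<gamma>_def field_embeddingD(5)[OF e] by (rule D_G_nonzero)

lemma e_D_power3: "e D ^ 3 = (1 + \<epsilon>) * \<gamma>"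
  using gamma_nonzero unfolding \<epsilon>_def \<gamma>_def by (simp add: add.commute)

lemma epsilon_relation: "(1 + \<epsilon>) * \<epsilon> ^ 4 * \<gamma>\<^sup>2 = 1"
proof -
  have "e (D ^ 15) = e (G ^ 4 * D ^ 3 + G ^ 3)" by (simp only: D_relation)
  then have "(e D ^ 3) ^ 5 = \<gamma> ^ 4 * e D ^ 3 + \<gamma> ^ 3"
    by (simp add: field_embeddingD[OF e] field_embedding_power[OF e] \<gamma>_def flip: power_mult)
  then have "\<gamma> ^ 3 * ((1 + \<epsilon>) ^ 5 * \<gamma>\<^sup>2) = \<gamma> ^ 3 * ((1 + \<epsilon>) * \<gamma>\<^sup>2 + 1)"
    unfolding e_D_power3 by (simp add: power_mult_distrib algebra_simps eval_nat_numeral)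
  then have "(1 + \<epsilon>) ^ 5 * \<gamma>\<^sup>2 = (1 + \<epsilon>) * \<gamma>\<^sup>2 + 1" using gamma_nonzero by simp
  moreover have "(1 + \<epsilon>) ^ 5 = (1 + \<epsilon>) + (1 + \<epsilon>) * \<epsilon> ^ 4"
  proof -
    have "(1 + \<epsilon>) ^ 5 = (1 + \<epsilon>) * (1 + \<epsilon>) ^ 4" by (simp add: eval_nat_numeral)
    then show ?thesis unfolding power4_add_char_two by (simp add: distrib_left)
  qed
  ultimately have "(1 + \<epsilon>) * \<gamma>\<^sup>2 + (1 + \<epsilon>) * \<epsilon> ^ 4 * \<gamma>\<^sup>2 = (1 + \<epsilon>) * \<gamma>\<^sup>2 + 1"
    by (simp only: distrib_right)
  then show ?thesis by (simp only: add_left_cancel)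
qed

lemma epsilon_nonzero: "\<epsilon> \<noteq> 0"
  using epsilon_relation by auto

lemma one_plus_epsilon_in: "1 + \<epsilon> \<in> V"
  by (rule one_plus_nonunit(1)[OF \<epsilon>])

lemma inverse_gamma_power2: "inverse \<gamma> ^ 2 = (1 + \<epsilon>) * \<epsilon> ^ 4"
  using epsilon_relation gamma_nonzero by (simp add: field_simps)

lemma inverse_gamma_nonunit: "inverse \<gamma> \<in> nonunits V"
proof -
  have "inverse \<gamma> ^ 2 \<in> nonunits V"
    unfolding inverse_gamma_power2
    by (intro nonunits_mult' one_plus_epsilon_in nonunit_power \<epsilon>) simp
  then show ?thesis by (rule power_nonunit_imp) simp
qed

text \<open>Within one class each term is a common factor \<open>c\<close> times a power of
  \<open>\<gamma>\<close>^2, and the flag \<open>b\<close> marks those with the extra factor 1 +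
  \<open>\<delta>\<close>. Each exponent occurs at most once with each flag, so only a single factor
  \<open>\<delta>\<close> can be lost.\<close>

lemma Dk_sum_lower_bound:
  assumes \<delta>: "\<delta> \<in> nonunits V" "\<delta> \<noteq> 0" "inverse \<gamma> ^ 2 / \<delta> \<in> nonunits V" and c: "c \<noteq> 0"
    and S: "finite S" "S \<noteq> {}"
    and inj: "\<And>k k'. k \<in> S \<Longrightarrow> k' \<in> S \<Longrightarrow> i k = i k' \<Longrightarrow> b k = b k' \<Longrightarrow> k = k'"
    and term_eq: "\<And>k. k \<in> S \<Longrightarrow> e (Dk k) = c * ((if b k then 1 + \<delta> else 1) * \<gamma> ^ (2 * i k))"
  defines "M \<equiv> Max (i ` S)" and "g \<equiv> e (\<Sum>k\<in>S. Dk k)"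
  shows "g \<noteq> 0" "c * \<delta> * \<gamma> ^ (2 * M) / g \<in> V"
proof -
  define A where "A = {k \<in> S. \<not> b k}"
  define B where "B = {k \<in> S. b k}"
  have AB: "S = A \<union> B" "A \<inter> B = {}" "finite A" "finite B" using S by (auto simp: A_def B_def)
  have injA: "inj_on i A" and injB: "inj_on i B" using inj by (auto simp: inj_on_def A_def B_def)
  define z where "z = (\<Sum>m\<in>i ` A. \<gamma> ^ (2 * m)) + (1 + \<delta>) * (\<Sum>m\<in>i ` B. \<gamma> ^ (2 * m))"
  have img: "i ` S = i ` A \<union> i ` B" unfolding AB(1) by (rule image_Un)
  have M: "M \<in> i ` A \<union> i ` B" "\<And>m. m \<in> i ` A \<union> i ` B \<Longrightarrow> m \<le> M"
    unfolding img[symmetric] M_def using S by auto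
  have "g = (\<Sum>k\<in>S. e (Dk k))" unfolding g_def by (rule field_embedding_sum[OF e])
  also have "\<dots> = (\<Sum>k\<in>A. e (Dk k)) + (\<Sum>k\<in>B. e (Dk k))"
    unfolding AB(1) by (rule sum.union_disjoint[OF AB(3,4,2)])
  also have "(\<Sum>k\<in>A. e (Dk k)) = (\<Sum>k\<in>A. c * \<gamma> ^ (2 * i k))"
    by (intro sum.cong refl) (simp add: A_def term_eq)
  also have "(\<Sum>k\<in>B. e (Dk k)) = (\<Sum>k\<in>B. c * ((1 + \<delta>) * \<gamma> ^ (2 * i k)))"
    by (intro sum.cong refl) (simp add: B_def term_eq)
  also have "(\<Sum>k\<in>A. c * \<gamma> ^ (2 * i k)) + \<dots> = c * z"
    unfolding z_def sum.reindex[OF injA] sum.reindex[OF injB]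
    by (simp add: sum_distrib_left distrib_left)
  finally have g: "g = c * z" .
  note z = weighted_sum_lower_bound[OF V inverse_gamma_nonunit gamma_nonzero \<delta> finite_imageI[OF AB(3)] finite_imageI[OF AB(4)] M, folded z_def]
  show "g \<noteq> 0" using z c by (simp add: g)
  have "c * \<delta> * \<gamma> ^ (2 * M) / g = \<delta> * \<gamma> ^ (2 * M) / z" using c by (simp add: g)
  then show "c * \<delta> * \<gamma> ^ (2 * M) / g \<in> V" using z(2) by simp
qed

text \<open>If every summand were strictly smaller than w, and hence than g, then the quotients f_j
  / g would be nonunits with sum 1. Cubes occur because the bounds on the summands are in
  thirds.\<close>

lemma sum_not_small:
  assumes g: "g \<noteq> 0" "w / g \<in> V" "w \<noteq> 0" "(\<Sum>j\<in>J. f j) = g" and f: "\<And>j. j \<in> J \<Longrightarrow> f j ^ 3 / \<gamma> ^ N \<in> V"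
  shows "\<gamma> ^ N / w ^ 3 \<notin> nonunits V"
proof
  assume *: "\<gamma> ^ N / w ^ 3 \<in> nonunits V"
  have "f j / g \<in> nonunits V" if j: "j \<in> J" for j
  proof -
    have "f j ^ 3 / \<gamma> ^ N * (\<gamma> ^ N / w ^ 3 * (w / g) ^ 3) \<in> nonunits V"
      by (intro nonunits_mult' nonunits_mult f j * V_intros(5) g)
    also have "f j ^ 3 / \<gamma> ^ N * (\<gamma> ^ N / w ^ 3 * (w / g) ^ 3) = (f j / g) ^ 3"
      using g gamma_nonzero by (simp add: power_divide)
    finally show ?thesis by (rule power_nonunit_imp) simp
  qed
  then have "(\<Sum>j\<in>J. f j / g) \<in> nonunits V" by (rule nonunits_sum)
  then show False using g one_not_nonunit by (simp flip: sum_divide_distrib)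
qed

lemma Dk_sum_mod_1_9:
  assumes S: "finite S" "S \<noteq> {}" "\<And>k. k \<in> S \<Longrightarrow> k mod 10 \<in> {1, 9}"
  shows "e (\<Sum>k\<in>S. Dk k) \<noteq> 0"
    and "\<And>f J n. (\<Sum>j\<in>J. f j) = e (\<Sum>k\<in>S. Dk k) \<Longrightarrow> n mod 10 \<in> {3, 7} \<Longrightarrow>
      (\<And>j. j \<in> J \<Longrightarrow> f j ^ 3 / \<gamma> ^ size_exp n \<in> V) \<Longrightarrow> \<forall>k\<in>S. k < n"
proof -
  \<comment> \<open>The shift by one pairs k = 10 i - 1 with k = 10 i + 1, which have the same
    leading pole since D_9 = (1 + \<open>\<epsilon>\<close>) D G^2.\<close>
  define i where "i k = (k + 1) div 10" for k :: nat
  define M where "M = Max (i ` S)"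
  have d0: "e D \<noteq> 0" unfolding field_embeddingD(5)[OF e] by (rule D_G_nonzero)
  have \<delta>: "inverse \<gamma> ^ 2 / \<epsilon> \<in> nonunits V"
  proof -
    have "inverse \<gamma> ^ 2 / \<epsilon> = \<epsilon> * ((1 + \<epsilon>) * \<epsilon> ^ 2)"
      unfolding inverse_gamma_power2 using epsilon_nonzero by (simp add: field_simps eval_nat_numeral)
    also have "\<dots> \<in> nonunits V"
      by (intro nonunits_mult \<epsilon> V_intros(4,5) one_plus_epsilon_in nonunits_in[OF \<epsilon>])
    finally show ?thesis .
  qed
  have k_eq: "k + 1 = 10 * i k + (if k mod 10 = 9 then 0 else 2)" if "k \<in> S" for k
  proof -
    have "(k + 1) mod 10 = (if k mod 10 = 9 then 0 else 2)" using S(3)[OF that] by (auto simp: mod_Suc)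
    then show ?thesis using mult_div_mod_eq[of 10 "k + 1"] by (simp only: i_def)
  qed
  have inj: "k = k'" if "k \<in> S" "k' \<in> S" "i k = i k'" "(k mod 10 = 9) = (k' mod 10 = 9)" for k k'
    using k_eq[OF that(1)] k_eq[OF that(2)] that(3,4) by simp
  have "e (Dk k) = e D * ((if k mod 10 = 9 then 1 + \<epsilon> else 1) * \<gamma> ^ (2 * i k))" if k: "k \<in> S" for k
  proof -
    have k': "e (Dk k) = \<gamma> ^ (2 * (k div 10)) * e (Dk (k mod 10))"
      unfolding Dk_mod[of k] by (simp add: field_embeddingD[OF e] field_embedding_power[OF e] \<gamma>_def)
    consider "k mod 10 = 1" | "k mod 10 = 9" using S(3)[OF k] by auto
    then show ?thesis
    proof cases
      case 1
      then have "i k = k div 10" using k_eq[OF k] mult_div_mod_eq[of 10 k] by simp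
      then show ?thesis using 1 by (simp add: k')
    next
      case 2
      then have "i k = Suc (k div 10)" using k_eq[OF k] mult_div_mod_eq[of 10 k] by simp
      moreover have "e D * e D ^ 3 = e D ^ 4" by (simp add: eval_nat_numeral)
      then have "e (Dk 9) = e D * e D ^ 3 * \<gamma>"
        by (simp add: field_embeddingD[OF e] field_embedding_power[OF e] \<gamma>_def)
      ultimately show ?thesis unfolding k' using 2
        by (simp add: e_D_power3 power2_eq_square mult_ac)
    qed
  qed
  note lb = Dk_sum_lower_bound[OF \<epsilon> epsilon_nonzero \<delta> d0 S(1,2) inj this, folded M_def]
  show "e (\<Sum>k\<in>S. Dk k) \<noteq> 0" by (rule lb(1))
  fix f :: "'j \<Rightarrow> 'b" and J n
  assume f: "(\<Sum>j\<in>J. f j) = e (\<Sum>k\<in>S. Dk k)" "n mod 10 \<in> {3, 7}"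
    "\<And>j. j \<in> J \<Longrightarrow> f j ^ 3 / \<gamma> ^ size_exp n \<in> V"
  have w: "e D * \<epsilon> * \<gamma> ^ (2 * M) \<noteq> 0" using d0 epsilon_nonzero gamma_nonzero by simp
  have not: "\<gamma> ^ size_exp n / (e D * \<epsilon> * \<gamma> ^ (2 * M)) ^ 3 \<notin> nonunits V"
    by (rule sum_not_small[OF lb w f(1,3)])
  have "M \<le> n div 10"
  proof (rule ccontr)
    assume "\<not> M \<le> n div 10"
    then obtain t where M: "M = n div 10 + 1 + t" by (metis Suc_eq_plus1 less_eq_Suc_le le_Suc_ex not_le)
    define r where "r = \<gamma> ^ (6 * (n div 10))"
    have "(e D * \<epsilon> * \<gamma> ^ (2 * M)) ^ 3 = e D ^ 3 * \<epsilon> ^ 3 * \<gamma> ^ (6 * M)"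
      by (simp add: power_mult_distrib mult.commute flip: power_mult)
    also have "\<gamma> ^ (6 * M) = r * (\<gamma> ^ 6 * \<gamma> ^ (6 * t))"
      unfolding M r_def by (simp add: power_add distrib_left)
    finally have w3: "(e D * \<epsilon> * \<gamma> ^ (2 * M)) ^ 3 = (1 + \<epsilon>) * \<gamma> * \<epsilon> ^ 3 * (r * (\<gamma> ^ 6 * \<gamma> ^ (6 * t)))"
      unfolding e_D_power3 .
    have "size_exp n = 6 * (n div 10) + 5" using f(2) by (auto simp: size_exp_def)
    then have num: "\<gamma> ^ size_exp n = r * \<gamma> ^ 5" by (simp add: r_def power_add)
    have nz: "r \<noteq> 0" "1 + \<epsilon> \<noteq> 0" using gamma_nonzero one_plus_nonunit(3)[OF \<epsilon>] by (simp_all add: r_def)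
    \<comment> \<open>The inserted factor is 1. It trades \<open>\<gamma>\<close>^2 for
      \<open>\<epsilon>\<close>^4; three of these powers pay for the cancellation, and the fourth
      makes the quotient a nonunit.\<close>
    have "\<gamma> ^ size_exp n = (r * \<gamma> ^ 5) * ((1 + \<epsilon>) * \<epsilon> ^ 4 * \<gamma>\<^sup>2)"
      unfolding num epsilon_relation by simp
    also have "\<dots> = \<epsilon> * inverse \<gamma> ^ (6 * t) * (e D * \<epsilon> * \<gamma> ^ (2 * M)) ^ 3"
      unfolding w3 using gamma_nonzero by (simp add: power_inverse field_simps) (simp add: eval_nat_numeral)
    finally have "\<gamma> ^ size_exp n / (e D * \<epsilon> * \<gamma> ^ (2 * M)) ^ 3 = \<epsilon> * inverse \<gamma> ^ (6 * t)"
      using w by simp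
    also have "\<dots> \<in> nonunits V"
      by (intro nonunits_mult \<epsilon> V_intros(5) nonunits_in[OF inverse_gamma_nonunit])
    finally show False using not by simp
  qed
  moreover have "i k \<le> M" if "k \<in> S" for k using S that by (auto simp: M_def)
  ultimately have le: "i k \<le> n div 10" if "k \<in> S" for k
    using that by (meson le_trans)
  show "\<forall>k\<in>S. k < n"
  proof
    fix k assume k: "k \<in> S"
    have "n mod 10 \<ge> 3" using f(2) by auto
    moreover have "k + 1 \<le> 10 * i k + 2" using k_eq[OF k] by (simp split: if_splits)
    ultimately show "k < n" using le[OF k] mult_div_mod_eq[of 10 n] by linarith
  qed
qed

lemma Dk_sum_mod_3_7:
  assumes S: "finite S" "S \<noteq> {}" "\<And>k. k \<in> S \<Longrightarrow> k mod 10 \<in> {3, 7}"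
  shows "e (\<Sum>k\<in>S. Dk k) \<noteq> 0"
    and "\<And>f J n. (\<Sum>j\<in>J. f j) = e (\<Sum>k\<in>S. Dk k) \<Longrightarrow> n mod 10 \<in> {1, 9} \<Longrightarrow>
      (\<And>j. j \<in> J \<Longrightarrow> f j ^ 3 / \<gamma> ^ size_exp n \<in> V) \<Longrightarrow> \<forall>k\<in>S. k < n"
proof -
  define i where "i k = k div 10" for k :: nat
  define M where "M = Max (i ` S)"
  define c where "c = (e D)\<^sup>2 * \<gamma>"
  have c0: "c \<noteq> 0" unfolding c_def using gamma_nonzero D_G_nonzero by (simp add: field_embeddingD(5)[OF e])
  have c3: "c ^ 3 = (1 + \<epsilon>)\<^sup>2 * \<gamma> ^ 5"
  proof -
    have "c ^ 3 = (e D ^ 3)\<^sup>2 * \<gamma> ^ 3" by (simp add: c_def power_mult_distrib flip: power_mult)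
    then show ?thesis unfolding e_D_power3 by (simp add: power_mult_distrib eval_nat_numeral)
  qed
  have \<delta>1: "\<epsilon>\<^sup>2 \<in> nonunits V" using \<epsilon> by (rule nonunit_power) simp
  have \<delta>: "inverse \<gamma> ^ 2 / \<epsilon>\<^sup>2 \<in> nonunits V"
  proof -
    have "inverse \<gamma> ^ 2 / \<epsilon>\<^sup>2 = \<epsilon> * ((1 + \<epsilon>) * \<epsilon>)"
      unfolding inverse_gamma_power2 using epsilon_nonzero by (simp add: field_simps eval_nat_numeral)
    also have "\<dots> \<in> nonunits V"
      by (intro nonunits_mult \<epsilon> V_intros(4,5) one_plus_epsilon_in nonunits_in[OF \<epsilon>])
    finally show ?thesis .
  qed
  have k_eq: "k = 10 * i k + (if k mod 10 = 3 then 3 else 7)" if "k \<in> S" for k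
  proof -
    have "k mod 10 = (if k mod 10 = 3 then 3 else 7)" using S(3)[OF that] by auto
    then show ?thesis using mult_div_mod_eq[of 10 k] by (simp only: i_def)
  qed
  have inj: "k = k'" if "k \<in> S" "k' \<in> S" "i k = i k'" "(k mod 10 = 3) = (k' mod 10 = 3)" for k k'
    using k_eq[OF that(1)] k_eq[OF that(2)] that(3,4) by simp
  \<comment> \<open>In D_3 = D^8 / G the factor D^6 / G^2 is (1 + \<open>\<epsilon>\<close>)^2, so
    D_3 = (1 + \<open>\<epsilon>\<close>^2) D_7; here a cancellation costs
    \<open>\<epsilon>\<close>^2.\<close>
  have "e (Dk k) = c * ((if k mod 10 = 3 then 1 + \<epsilon>\<^sup>2 else 1) * \<gamma> ^ (2 * i k))" if k: "k \<in> S" for k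
  proof -
    have k': "e (Dk k) = \<gamma> ^ (2 * (k div 10)) * e (Dk (k mod 10))"
      unfolding Dk_mod[of k] by (simp add: field_embeddingD[OF e] field_embedding_power[OF e] \<gamma>_def)
    consider "k mod 10 = 7" | "k mod 10 = 3" using S(3)[OF k] by auto
    then show ?thesis
    proof cases
      case 1
      then show ?thesis unfolding k'
        by (simp add: i_def c_def field_embeddingD[OF e] field_embedding_power[OF e] \<gamma>_def)
    next
      case 2
      have "e (Dk 3) * \<gamma> = (e D)\<^sup>2 * (e D ^ 3)\<^sup>2"
        using arg_cong[OF Dk_3, of e]
        by (simp add: field_embeddingD[OF e] field_embedding_power[OF e] \<gamma>_def flip: power_mult power_add)
      also have "\<dots> = (c * (1 + \<epsilon>\<^sup>2)) * \<gamma>"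
        unfolding e_D_power3 c_def power_mult_distrib power2_add_char_two by (simp add: power2_eq_square mult_ac)
      finally have "e (Dk 3) = c * (1 + \<epsilon>\<^sup>2)" using gamma_nonzero by simp
      then show ?thesis unfolding k' using 2 by (simp add: i_def mult_ac)
    qed
  qed
  note lb = Dk_sum_lower_bound[OF \<delta>1 _ \<delta> c0 S(1,2) inj this, folded M_def]
  have e2: "\<epsilon>\<^sup>2 \<noteq> 0" using epsilon_nonzero by simp
  show "e (\<Sum>k\<in>S. Dk k) \<noteq> 0" by (rule lb(1)[OF e2])
  fix f :: "'j \<Rightarrow> 'b" and J n
  assume f: "(\<Sum>j\<in>J. f j) = e (\<Sum>k\<in>S. Dk k)" "n mod 10 \<in> {1, 9}"
    "\<And>j. j \<in> J \<Longrightarrow> f j ^ 3 / \<gamma> ^ size_exp n \<in> V"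
  have w: "c * \<epsilon>\<^sup>2 * \<gamma> ^ (2 * M) \<noteq> 0" using c0 e2 gamma_nonzero by simp
  have not: "\<gamma> ^ size_exp n / (c * \<epsilon>\<^sup>2 * \<gamma> ^ (2 * M)) ^ 3 \<notin> nonunits V"
    by (rule sum_not_small[OF lb[OF e2] w f(1,3)])
  \<comment> \<open>The multiple of ten next to n, divided by ten: n is 10 l + 1 or 10 l - 1, and
    both have pole 2 l + 1/3.\<close>
  define l where "l = (if n mod 10 = 1 then n div 10 else n div 10 + 1)"
  have size: "size_exp n = 6 * l + 1" using f(2) by (auto simp: size_exp_def l_def)
  have "M < l"
  proof (rule ccontr)
    assume "\<not> M < l"
    then obtain t where M: "M = l + t" by (metis le_Suc_ex not_le)
    define r where "r = \<gamma> ^ (6 * l)"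
    have "(c * \<epsilon>\<^sup>2 * \<gamma> ^ (2 * M)) ^ 3 = c ^ 3 * \<epsilon> ^ 6 * \<gamma> ^ (6 * M)"
      by (simp add: power_mult_distrib mult.commute flip: power_mult)
    also have "\<gamma> ^ (6 * M) = r * \<gamma> ^ (6 * t)"
      unfolding M r_def by (simp add: power_add distrib_left)
    finally have w3: "(c * \<epsilon>\<^sup>2 * \<gamma> ^ (2 * M)) ^ 3 = (1 + \<epsilon>)\<^sup>2 * \<gamma> ^ 5 * \<epsilon> ^ 6 * (r * \<gamma> ^ (6 * t))"
      unfolding c3 .
    \<comment> \<open>Of the eight powers of \<open>\<epsilon>\<close> supplied by this factor 1,
      six pay for the cancellation and two are left over.\<close>
    have "\<gamma> ^ size_exp n = (r * \<gamma>) * ((1 + \<epsilon>) * \<epsilon> ^ 4 * \<gamma>\<^sup>2)\<^sup>2"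
      unfolding size r_def epsilon_relation by simp
    also have "(r * \<gamma>) * (a * \<epsilon> ^ 4 * \<gamma>\<^sup>2)\<^sup>2
        = \<epsilon>\<^sup>2 * inverse \<gamma> ^ (6 * t) * (a\<^sup>2 * \<gamma> ^ 5 * \<epsilon> ^ 6 * (r * \<gamma> ^ (6 * t)))" for a
      using gamma_nonzero by (simp add: power_inverse field_simps) (simp add: eval_nat_numeral)
    note this[of "1 + \<epsilon>", folded w3]
    finally have "\<gamma> ^ size_exp n / (c * \<epsilon>\<^sup>2 * \<gamma> ^ (2 * M)) ^ 3 = \<epsilon>\<^sup>2 * inverse \<gamma> ^ (6 * t)"
      using w by simp
    also have "\<dots> \<in> nonunits V"
      by (intro nonunits_mult \<delta>1 V_intros(5) nonunits_in[OF inverse_gamma_nonunit])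
    finally show False using not by simp
  qed
  moreover have "i k \<le> M" if "k \<in> S" for k using S that by (auto simp: M_def)
  ultimately have le: "i k < l" if "k \<in> S" for k
    using that by (meson le_less_trans)
  show "\<forall>k\<in>S. k < n"
  proof
    fix k assume k: "k \<in> S"
    have "n + 1 \<ge> 10 * l"
    proof (cases "n mod 10 = 1")
      case True
      then have "l = n div 10" by (simp add: l_def)
      then show ?thesis using mult_div_mod_eq[of 10 n] by linarith
    next
      case False
      then have "n mod 10 = 9" using f(2) by auto
      moreover have "l = n div 10 + 1" using False by (simp add: l_def)
      ultimately show ?thesis using mult_div_mod_eq[of 10 n] by linarith
    qed
    moreover have "k \<le> 10 * i k + 7" using k_eq[OF k] by (simp split: if_splits)
    ultimately show "k < n" using le[OF k] by linarith
  qed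
qed

end


text \<open>The series y = G / (D^3 + G) is the inverse of \<open>\<epsilon>\<close>, and has order
  5 - 3 = 2 at x = 0. A place where y has a pole is one where \<open>\<epsilon>\<close> is a
  nonunit.\<close>

lemma exists_pole_at_D_cube:
  "\<exists>y. y * (D ^ 3 + G) = G \<and> y \<noteq> 0 \<and> y $ 0 = 0"
proof -
  have D3: "subdegree (D ^ 3) = 3" using D_G_nonzero by (simp add: subdegree_D)
  have sd: "subdegree (D ^ 3 + G) = 3"
    using subdegree_add_eq1[of "D ^ 3" G] D_G_nonzero by (simp add: subdegree_D subdegree_G)
  then have nz: "D ^ 3 + G \<noteq> 0" by auto
  then have "D ^ 3 + G dvd G" using D_G_nonzero by (simp add: fps_dvd_iff sd subdegree_G)
  then obtain y where y: "G = (D ^ 3 + G) * y" by (elim dvdE)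
  have y0: "y \<noteq> 0" using y D_G_nonzero by auto
  have "subdegree G = subdegree (D ^ 3 + G) + subdegree y"
    using nz y0 y by (metis subdegree_mult)
  then have "subdegree y = 2" by (simp add: sd subdegree_G)
  then have "y $ 0 = 0" by (intro nth_less_subdegree_zero) simp
  then show ?thesis using y y0 by (intro exI[of _ y]) (simp add: mult.commute)
qed

section \<open>Comparison of T_p D_n with a sum of D_k at the place\<close>

lemma Tp_Dk_lower:
  fixes p n :: nat
  assumes p: "prime p" "odd p" and n: "coprime n 10" and S: "finite S" "S \<noteq> {}"
    and classes: "(n mod 10 \<in> {3, 7} \<and> (\<forall>k\<in>S. k mod 10 \<in> {1, 9})) \<or> (n mod 10 \<in> {1, 9} \<and> (\<forall>k\<in>S. k mod 10 \<in> {3, 7}))"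
    and T: "Tp p (Dk n) = (\<Sum>k\<in>S. Dk k)"
  shows "\<forall>k\<in>S. k < n"
proof -
  have p0: "p > 0" using p(2) by (cases p) auto
  obtain \<eta> :: "bit alg_closure" where \<eta>: "\<eta> ^ (p * p) = 1" "\<eta> ^ p \<noteq> 1"
    using exists_root_of_unity_square[OF p] by blast
  define \<zeta> where "\<zeta> = \<eta> ^ p"
  have \<zeta>: "\<zeta> ^ p = 1" "\<zeta> \<noteq> 1" using \<eta> by (simp_all add: \<zeta>_def flip: power_mult)
  have nz: "\<eta> \<noteq> 0" "\<zeta> \<noteq> 0" using \<eta> \<zeta> p0 by (auto simp: power_0_left)
  have emb: "field_embedding (\<lambda>f. fps_to_fls (ev c m f))" if "c \<noteq> 0" "m > 0" for c :: "bit alg_closure" and m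
    by (rule field_embedding_ev[OF field_embedding_fps_to_fls that])
  define e :: "bit fps \<Rightarrow> bit alg_closure fls" where "e f = fps_to_fls (ev 1 (p * p) (lift_ac f))" for f
  define e' where "e' j f = (if j < p then fps_to_fls (ev (\<zeta> ^ j) p (lift_ac f)) else fps_to_fls (ev 1 (p * (p * p)) (lift_ac f)))"
    for j and f :: "bit fps"
  have e: "field_embedding e" unfolding e_def using p0 by (intro field_embedding_lift_ac emb) auto
  have e': "field_embedding (e' j)" for j
    unfolding e'_def using p0 nz by (cases "j < p") (simp_all add: field_embedding_lift_ac[OF emb])
  have Tsum: "(\<Sum>j\<in>{..p}. e' j (Dk n)) = e (Tp p (Dk n))"
  proof -
    have "{..p} = insert p {..<p}" by auto
    then show ?thesis
      by (simp add: e_def Tp_embeddings[OF p \<zeta>] e'_def field_embedding_sum[OF field_embedding_fps_to_fls])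
  qed
  obtain y where y: "y * (D ^ 3 + G) = G" "y \<noteq> 0" "y $ 0 = 0" using exists_pole_at_D_cube by blast
  have "ev 1 (p * p) (lift_ac y) \<noteq> 0" "ev 1 (p * p) (lift_ac y) $ 0 = 0"
    using y p0 by (simp_all add: ev_eq_0_iff lift_ac_hom(4), simp add: ev_def lift_ac_def)
  then obtain V where V: "valuation V" "inverse (e y) \<in> nonunits V"
    unfolding e_def by (rule valuation_exists_pole)
  have "e y * (e D ^ 3 + e G) = e G"
    using arg_cong[OF y(1), of e] by (simp add: field_embeddingD[OF e] field_embedding_power[OF e])
  moreover have G0: "e G \<noteq> 0" "e y \<noteq> 0" using D_G_nonzero y by (simp_all add: field_embeddingD(5)[OF e])
  ultimately have "inverse (e y) = e D ^ 3 / e G + 1" by (simp add: field_simps)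
  then have \<epsilon>: "e D ^ 3 / e G + 1 \<in> nonunits V" using V(2) by simp
  note \<gamma> = inverse_gamma_nonunit[OF V(1) e \<epsilon>]
  interpret valuation V by (rule V(1))
  let ?F = "theta_one :: bit alg_closure fps"
  have liftG: "lift_ac G = ev 1 5 ?F"
    unfolding G_eq lift_ac_ev by (simp add: theta_pos_def lift_ac_gf)
  have Gj: "e' j G / e G \<in> V" for j
  \<comment> \<open>For j \<ge> p the series F(x^(5 p^3)) is compared directly with F(x^(5 p^2)).
    For j < p the comparison passes through F(\<open>\<xi>\<close> x^5), which has the same size as
    F(x^(5 p^2)).\<close>
  proof (cases "j < p")
    case False
    have h: "field_embedding (\<lambda>f. fps_to_fls (ev 1 (5 * (p * p)) f :: bit alg_closure fps))"
      using p0 by (intro emb) auto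
    have 1: "fps_to_fls (ev 1 (5 * (p * p)) ?F) = e G"
      using p0 by (simp add: e_def liftG ev_ev mult.commute)
    have 2: "fps_to_fls (ev 1 (5 * (p * p)) (ev 1 p ?F)) = e' j G"
      using p0 False by (simp add: e'_def liftG ev_ev mult_ac)
    show ?thesis
      using theta_pos_ev_le[OF h p \<eta>] unfolding 1 2 using \<gamma> .
  next
    case True
    \<comment> \<open>Chosen so that \<open>\<xi>\<close>^p = \<open>\<zeta>\<close>^(5 j), the root
      of unity that appears when \<open>\<zeta>\<close>^j x^p is inserted into G = F(x^5).\<close>
    define \<xi> where "\<xi> = \<eta> ^ (5 * j)"
    have \<xi>: "\<xi> ^ (p * p) = 1" unfolding \<xi>_def by (metis \<eta>(1) mult.commute power_mult power_one)
    have \<xi>0: "\<xi> \<noteq> 0" using nz by (simp add: \<xi>_def)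
    have h: "field_embedding (\<lambda>f. fps_to_fls (ev 1 5 f :: bit alg_closure fps))"
      by (intro emb) auto
    have 1: "fps_to_fls (ev 1 5 (ev 1 (p * p) ?F)) = e G"
      using p0 by (simp add: e_def liftG ev_ev mult.commute)
    have h2: "field_embedding (\<lambda>f. fps_to_fls (ev \<xi> 5 f :: bit alg_closure fps))"
      using \<xi>0 by (intro emb) auto
    have 2: "fps_to_fls (ev 1 5 (ev \<xi> 1 ?F)) = fps_to_fls (ev \<xi> 5 ?F)"
      by (simp add: ev_ev)
    have 3: "fps_to_fls (ev \<xi> 5 (ev 1 p ?F)) = e' j G"
    proof -
      have "(\<zeta> ^ j) ^ 5 = \<xi> ^ p" by (simp add: \<zeta>_def \<xi>_def mult_ac flip: power_mult)
      then show ?thesis using p0 True by (simp add: e'_def liftG ev_ev mult.commute)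
    qed
    have sq: "fps_to_fls (ev \<xi> 5 ?F) / e G \<in> V" "e G / fps_to_fls (ev \<xi> 5 ?F) \<in> V"
      using theta_pos_square_level[OF h p \<xi>] unfolding 1 2 using \<gamma> by blast+
    have F0: "fps_to_fls (ev \<xi> 5 ?F) \<noteq> 0"
      unfolding field_embeddingD(5)[OF h2] by (rule theta_pos_nonzero[of _ 1]) auto
    have "inverse (e G) * (e G / fps_to_fls (ev \<xi> 5 ?F)) \<in> nonunits V"
      by (rule nonunits_mult[OF \<gamma> sq(2)])
    then have "inverse (fps_to_fls (ev \<xi> 5 ?F)) \<in> nonunits V"
      using G0 by (simp add: field_simps)
    from theta_pos_ev_le[OF h2 p \<eta> this] have "e' j G / fps_to_fls (ev \<xi> 5 ?F) \<in> V"
      unfolding 3 .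
    then have "e' j G / fps_to_fls (ev \<xi> 5 ?F) * (fps_to_fls (ev \<xi> 5 ?F) / e G) \<in> V"
      using sq(1) by (rule V_intros(4))
    then show ?thesis using F0 by simp
  qed
  have bound: "e' j (Dk n) ^ 3 / e G ^ size_exp n \<in> V" for j
    by (rule Dk_size_bound[OF V(1) e' \<gamma> G0(1) Gj n])
  have sum: "(\<Sum>j\<in>{..p}. e' j (Dk n)) = e (\<Sum>k\<in>S. Dk k)" unfolding Tsum T ..
  from classes show ?thesis
  proof
    assume *: "n mod 10 \<in> {3, 7} \<and> (\<forall>k\<in>S. k mod 10 \<in> {1, 9})"
    show ?thesis
      by (rule Dk_sum_mod_1_9(2)[OF V(1) e \<epsilon> S _ sum _ bound]) (use * in auto)
  next
    assume *: "n mod 10 \<in> {1, 9} \<and> (\<forall>k\<in>S. k mod 10 \<in> {3, 7})"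
    show ?thesis
      by (rule Dk_sum_mod_3_7(2)[OF V(1) e \<epsilon> S _ sum _ bound]) (use * in auto)
  qed
qed

text \<open>Linear independence within each class, from the same pole estimate at a place of the
  unsubstituted series. It serves to discard the class that cannot occur in T_p D_n.\<close>

lemma Dk_sum_nonzero:
  assumes S: "finite S" "S \<noteq> {}" and classes: "(\<forall>k\<in>S. k mod 10 \<in> {1, 9}) \<or> (\<forall>k\<in>S. k mod 10 \<in> {3, 7})"
  shows "(\<Sum>k\<in>S. Dk k) \<noteq> 0"
proof -
  define e :: "bit fps \<Rightarrow> bit fls" where "e = fps_to_fls"
  have e: "field_embedding e" unfolding e_def by (rule field_embedding_fps_to_fls)
  obtain y where y: "y * (D ^ 3 + G) = G" "y \<noteq> 0" "y $ 0 = 0" using exists_pole_at_D_cube by blast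
  obtain V where V: "valuation V" "inverse (e y) \<in> nonunits V"
    unfolding e_def by (rule valuation_exists_pole[OF y(2,3)])
  have "e y * (e D ^ 3 + e G) = e G"
    using arg_cong[OF y(1), of e] by (simp add: field_embeddingD[OF e] field_embedding_power[OF e])
  moreover have "e G \<noteq> 0" "e y \<noteq> 0" using D_G_nonzero y by (simp_all add: field_embeddingD(5)[OF e])
  ultimately have "inverse (e y) = e D ^ 3 / e G + 1" by (simp add: field_simps)
  then have \<epsilon>: "e D ^ 3 / e G + 1 \<in> nonunits V" using V(2) by simp
  have "e (\<Sum>k\<in>S. Dk k) \<noteq> 0"
    using classes Dk_sum_mod_1_9(1)[OF V(1) e \<epsilon> S] Dk_sum_mod_3_7(1)[OF V(1) e \<epsilon> S] by blast
  then show ?thesis by (simp add: field_embeddingD(5)[OF e])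
qed

lemma supported_disjoint_eq_0:
  "supported {1, 4} f \<Longrightarrow> supported {2, 3} f \<Longrightarrow> f = 0"
  unfolding supported_def by (rule fps_ext) fastforce

theorem theorem2p24:
  fixes p n :: nat and S :: "nat set"
  assumes "prime p" and "p mod 10 = 3 \<or> p mod 10 = 7"
    and "n > 0" and "coprime n 10"
    and "finite S" and "\<forall>k\<in>S. k > 0 \<and> coprime k 10"
    and "Tp p (Dk n) = (\<Sum>k\<in>S. Dk k)"
  shows "\<forall>k\<in>S. k < n"
proof -
  have odd: "odd p" and p5: "p mod 5 \<in> {2, 3}" using assms(2) by (presburger, simp, presburger)
  have cop: "coprime k 10" if "k \<in> S" for k using assms(6) that by blast
  define S1 where "S1 = {k \<in> S. k mod 10 \<in> {1, 9}}"
  define S3 where "S3 = {k \<in> S. k mod 10 \<in> {3, 7}}"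
  have S: "S = S1 \<union> S3" "S1 \<inter> S3 = {}" "finite S1" "finite S3"
  proof -
    have "k \<in> S1 \<union> S3" if "k \<in> S" for k
      using coprime_10_mod_cases[OF cop[OF that]] that unfolding S1_def S3_def by blast
    then show "S = S1 \<union> S3" by (auto simp: S1_def S3_def)
  qed (use assms(5) in \<open>auto simp: S1_def S3_def\<close>)
  have s1: "supported {1, 4} (\<Sum>k\<in>S1. Dk k)"
    by (rule supported_sum, rule supported_Dk(1)) (auto simp: S1_def cop)
  have s3: "supported {2, 3} (\<Sum>k\<in>S3. Dk k)"
    by (rule supported_sum, rule supported_Dk(2)) (auto simp: S3_def cop)
  have split: "Tp p (Dk n) = (\<Sum>k\<in>S1. Dk k) + (\<Sum>k\<in>S3. Dk k)"
    unfolding assms(7) S(1) by (rule sum.union_disjoint[OF S(3,4,2)])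
  have nmod: "n mod 10 \<in> {1, 9} \<or> n mod 10 \<in> {3, 7}"
    using assms(4) by (elim coprime_10_mod_cases) auto
  then have classes: "(n mod 10 \<in> {3, 7} \<and> (\<forall>k\<in>S. k mod 10 \<in> {1, 9})) \<or> (n mod 10 \<in> {1, 9} \<and> (\<forall>k\<in>S. k mod 10 \<in> {3, 7}))"
  proof
    assume n: "n mod 10 \<in> {1, 9}"
    have "supported {2, 3} (Tp p (Dk n))"
      by (rule supported_Tp(1)[OF p5 supported_Dk(1)[OF assms(4) n]])
    \<comment> \<open>The sum over \<open>S1\<close> is T_p D_n plus the sum over \<open>S3\<close>,
      hence has exponents 2, 3 modulo 5; its own exponents are 1, 4 modulo 5, so it
      vanishes.\<close>
    from supported_add[OF this s3] have "supported {2, 3} (\<Sum>k\<in>S1. Dk k)"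
      unfolding split by (simp add: add.assoc)
    with s1 have "(\<Sum>k\<in>S1. Dk k) = 0" by (rule supported_disjoint_eq_0)
    then have "S1 = {}" using Dk_sum_nonzero[OF S(3)] by (auto simp: S1_def)
    then show ?thesis using n S(1) by (auto simp: S3_def)
  next
    assume n: "n mod 10 \<in> {3, 7}"
    have "supported {1, 4} (Tp p (Dk n))"
      by (rule supported_Tp(2)[OF p5 supported_Dk(2)[OF assms(4) n]])
    from supported_add[OF s1 this] have "supported {1, 4} (\<Sum>k\<in>S3. Dk k)"
      unfolding split by simp
    then have "(\<Sum>k\<in>S3. Dk k) = 0" using s3 by (rule supported_disjoint_eq_0)
    then have "S3 = {}" using Dk_sum_nonzero[OF S(4)] by (auto simp: S3_def)
    then show ?thesis using n S(1) by (auto simp: S1_def)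
  qed
  show ?thesis
  proof (cases "S = {}")
    case False
    then show ?thesis
      by (rule Tp_Dk_lower[OF assms(1) odd assms(4,5) _ classes assms(7)])
  qed simp
qed

end
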